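(* Let $M=M_1\# M_2$ be the connected sum of two closed, orientable, smooth $m$-manifolds, where $m\ge3$, with $b_1(M_1)$ and $b_1(M_2)$ both non-zero. Then $\mathcal V^1_1(M)=H^1(M,\mathbb C^* )$ and $\mathcal R^1_1(M)=H^1(M,\mathbb C)$.
   Context: A closed manifold is a compact, connected manifold without boundary. $H^1(M,\mathbb C^* )=\mathrm{Hom}(\pi_1(M),\mathbb C^* )$ is the character group. The characteristic variety $\mathcal V^1_1(M)$ is the set of characters $\rho\in H^1(M,\mathbb C^* )$ such that $\dim_{\mathbb C}H_1(M,\mathbb C_\rho)\ge1$, where $\mathbb C_\rho$ is the rank $1$ local system defined by $\rho$. The resonance variety $\mathcal R^1_1(M)$ is the set of classes $a\in H^1(M,\mathbb C)$ such that the degree $1$ cohomology of the cochain complex $(H^\bullet(M,\mathbb C),\,u\mapsto a\cup u)$ has dimension at least $1$. *)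

theory Defs
  imports
    "HOL-Analysis.Analysis"
    "HOL-Homology.Homology"
    "HOL-Algebra.Algebraic_Closure_Type"
    "Jordan_Normal_Form.Missing_VectorSpace"
    "HOL-Library.Extended_Nat"
begin

section \<open>Closed orientable smooth manifolds\<close>

text \<open>
  \<open>Ck_on k f S\<close> is meant for open \<open>S\<close>: all iterated directional derivatives
  of order at most \<open>k\<close> exist and are continuous on \<open>S\<close>.
\<close>

primrec Ck_on :: "nat \<Rightarrow> ('v::euclidean_space \<Rightarrow> 'w::euclidean_space) \<Rightarrow> 'v set \<Rightarrow> bool" where
  "Ck_on 0 f S \<longleftrightarrow> continuous_on S f"
| "Ck_on (Suc k) f S \<longleftrightarrow> (\<forall>x\<in>S. f differentiable (at x)) \<and>
     (\<forall>v. Ck_on k (\<lambda>x. frechet_derivative f (at x) v) S)"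

definition smooth_on :: "'v set \<Rightarrow> ('v::euclidean_space \<Rightarrow> 'w::euclidean_space) \<Rightarrow> bool" where
  "smooth_on S f \<longleftrightarrow> (\<forall>k. Ck_on k f S)"

type_synonym ('a, 'm) chart = "'a set \<times> ('a \<Rightarrow> real^'m)"

definition is_chart :: "'a topology \<Rightarrow> ('a, 'm::finite) chart \<Rightarrow> bool" where
  "is_chart \<X> c \<longleftrightarrow> (case c of (U, f) \<Rightarrow>
     openin \<X> U \<and> open (f ` U) \<and>
     homeomorphic_map (subtopology \<X> U) (top_of_set (f ` U)) f)"

definition transition :: "('a, 'm::finite) chart \<Rightarrow> ('a, 'm) chart \<Rightarrow> real^'m \<Rightarrow> real^'m" where
  "transition c d = snd d \<circ> inv_into (fst c) (snd c)"

definition transition_domain :: "('a, 'm::finite) chart \<Rightarrow> ('a, 'm) chart \<Rightarrow> (real^'m) set" where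
  "transition_domain c d = snd c ` (fst c \<inter> fst d)"

definition compatible :: "('a, 'm::finite) chart \<Rightarrow> ('a, 'm) chart \<Rightarrow> bool" where
  "compatible c d \<longleftrightarrow>
     smooth_on (transition_domain c d) (transition c d) \<and>
     smooth_on (transition_domain d c) (transition d c)"

definition smooth_atlas :: "'a topology \<Rightarrow> ('a, 'm::finite) chart set \<Rightarrow> bool" where
  "smooth_atlas \<X> A \<longleftrightarrow>
     (\<forall>c\<in>A. is_chart \<X> c) \<and> (\<Union>c\<in>A. fst c) = topspace \<X> \<and>
     (\<forall>c\<in>A. \<forall>d\<in>A. compatible c d)"

definition closed_smooth_manifold :: "'a topology \<Rightarrow> ('a, 'm::finite) chart set \<Rightarrow> bool" where
  "closed_smooth_manifold \<X> A \<longleftrightarrow>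
     Hausdorff_space \<X> \<and> second_countable \<X> \<and> compact_space \<X> \<and>
     topspace \<X> \<noteq> {} \<and> connected_space \<X> \<and> smooth_atlas \<X> A"

definition orientable :: "'a topology \<Rightarrow> ('a, 'm::finite) chart set \<Rightarrow> bool" where
  "orientable \<X> A \<longleftrightarrow>
     (\<exists>B. smooth_atlas \<X> B \<and> (\<forall>b\<in>B. \<forall>a\<in>A. compatible b a) \<and>
          (\<forall>b\<in>B. \<forall>c\<in>B. \<forall>x\<in>transition_domain b c.
             0 < det (matrix (frechet_derivative (transition b c) (at x)))))"


section \<open>Connected sums\<close>

text \<open>
  A smooth embedding of the closed unit disc of the same dimension as the manifold: it
  extends to a diffeomorphism from a neighbourhood of the disc onto an open subset,
  i.e. the inverse of the extension is a chart of the given smooth structure.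
\<close>

definition disc_embedding ::
    "'a topology \<Rightarrow> ('a, 'm::finite) chart set \<Rightarrow> (real^'m \<Rightarrow> 'a) \<Rightarrow> bool" where
  "disc_embedding \<X> A h \<longleftrightarrow>
     (\<exists>U. open U \<and> cball 0 1 \<subseteq> U \<and> inj_on h U \<and>
          is_chart \<X> (h ` U, inv_into U h) \<and>
          (\<forall>c\<in>A. compatible (h ` U, inv_into U h) c))"

definition disjoint_union_topology :: "'a topology \<Rightarrow> 'b topology \<Rightarrow> ('a + 'b) topology" where
  "disjoint_union_topology \<X> \<Y> =
     topology (\<lambda>U. openin \<X> (Inl -` U) \<and> openin \<Y> (Inr -` U))"

lemma openin_disjoint_union_topology:
  "openin (disjoint_union_topology \<X> \<Y>) U \<longleftrightarrow> openin \<X> (Inl -` U) \<and> openin \<Y> (Inr -` U)"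
proof -
  have "istopology (\<lambda>U. openin \<X> (Inl -` U) \<and> openin \<Y> (Inr -` U))"
    unfolding istopology_def by (auto simp: vimage_Union)
  then show ?thesis
    by (simp add: disjoint_union_topology_def)
qed

text \<open>
  The Kervaire--Milnor construction: remove the centres of two embedded discs and identify
  \<open>h (t u)\<close> with \<open>k ((1 - t) u)\<close> for \<open>0 < t < 1\<close> and unit vectors \<open>u\<close>.  The space \<open>M\<close> is
  a connected sum if it is, via \<open>q\<close>, the topological quotient for some choice of discs; the
  manifold is thus specified up to homeomorphism.

  The construction requires \<open>h\<close> to preserve and \<open>k\<close> to reverse orientation.
  On connected orientable manifolds this is no restriction on the pair of discs but
  a choice of one of the two orientations of each summand, so no orientation occurs here.
\<close>

definition gluing :: "(real^'m::finite \<Rightarrow> 'a) \<Rightarrow> (real^'m \<Rightarrow> 'b) \<Rightarrow> (('a + 'b) \<times> ('a + 'b)) set" where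
  "gluing h k =
     {(Inl (h (t *\<^sub>R u)), Inr (k ((1 - t) *\<^sub>R u))) | t u. 0 < t \<and> t < 1 \<and> norm u = 1}"

definition connected_sum ::
    "'c topology \<Rightarrow> 'a topology \<Rightarrow> ('a, 'm::finite) chart set \<Rightarrow>
       'b topology \<Rightarrow> ('b, 'm) chart set \<Rightarrow> bool" where
  "connected_sum M \<X> A \<Y> B \<longleftrightarrow>
     (\<exists>h k. disc_embedding \<X> A h \<and> disc_embedding \<Y> B k \<and>
        (let S = disjoint_union_topology
                   (subtopology \<X> (- {h 0})) (subtopology \<Y> (- {k 0}))
         in \<exists>q. quotient_map S M q \<and>
              (\<forall>x\<in>topspace S. \<forall>y\<in>topspace S.
                 q x = q y \<longleftrightarrow> (x, y) \<in> Id \<union> gluing h k \<union> (gluing h k)\<inverse>)))"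


section \<open>Rank and dimension\<close>

definition abelian_rank :: "('g, 'z) monoid_scheme \<Rightarrow> enat" where
  "abelian_rank G =
     Sup {enat (card S) | S. finite S \<and> S \<subseteq> carrier G \<and>
       (\<forall>c :: 'g \<Rightarrow> int. finprod G (\<lambda>x. x [^]\<^bsub>G\<^esub> c x) S = \<one>\<^bsub>G\<^esub> \<longrightarrow> (\<forall>x\<in>S. c x = 0))}"

definition betti :: "nat \<Rightarrow> 'a topology \<Rightarrow> enat" where
  "betti n \<X> = abelian_rank (homology_group (int n) \<X>)"

abbreviation complex_field :: "complex ring" where
  "complex_field \<equiv> ring_of_type_algebra"

text \<open>
  The dimension as an extended natural number, since \<open>vectorspace.dim\<close> is unspecified
  on spaces that are not finitely generated.
\<close>

definition vdim :: "(complex, 'v, 'z) module_scheme \<Rightarrow> enat" where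
  "vdim V = Sup {enat (card S) | S. finite S \<and> S \<subseteq> carrier V \<and>
                                    \<not> module.lin_dep complex_field V S}"

definition quotient_module ::
    "(complex, 'v, 'z) module_scheme \<Rightarrow> 'v set \<Rightarrow> (complex, 'v set) module" where
  "quotient_module V W =
     \<lparr>carrier = a_rcosets\<^bsub>V\<^esub> W, mult = undefined, one = undefined, zero = W,
      add = set_add V, smult = (\<lambda>z C. \<Union>v\<in>C. W +>\<^bsub>V\<^esub> (z \<odot>\<^bsub>V\<^esub> v))\<rparr>"

definition subquotient ::
    "(complex, 'v) module \<Rightarrow> 'v set \<Rightarrow> 'v set \<Rightarrow> (complex, 'v set) module" where
  "subquotient V Z B = quotient_module (V\<lparr>carrier := Z\<rparr>) B"


section \<open>The fundamental group and its characters\<close>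

definition path_class :: "'a topology \<Rightarrow> (real \<Rightarrow> 'a) \<Rightarrow> (real \<Rightarrow> 'a) set" where
  "path_class \<X> p =
     {q. homotopic_with (\<lambda>r. r 0 = p 0 \<and> r 1 = p 1) (top_of_set {0..1}) \<X> p q}"

definition path_join :: "(real \<Rightarrow> 'a) \<Rightarrow> (real \<Rightarrow> 'a) \<Rightarrow> real \<Rightarrow> 'a" where
  "path_join p q = (\<lambda>t. if t \<le> 1/2 then p (2 * t) else q (2 * t - 1))"

definition path_rev :: "(real \<Rightarrow> 'a) \<Rightarrow> real \<Rightarrow> 'a" where
  "path_rev p = (\<lambda>t. p (1 - t))"

definition fundamental_group :: "'a topology \<Rightarrow> 'a \<Rightarrow> (real \<Rightarrow> 'a) set monoid" where
  "fundamental_group \<X> x0 =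
     \<lparr>carrier = path_class \<X> ` {p. pathin \<X> p \<and> p 0 = x0 \<and> p 1 = x0},
      mult = (\<lambda>P Q. \<Union>p\<in>P. \<Union>q\<in>Q. path_class \<X> (path_join p q)),
      one = path_class \<X> (\<lambda>_. x0)\<rparr>"

definition characters :: "'a topology \<Rightarrow> 'a \<Rightarrow> ((real \<Rightarrow> 'a) set \<Rightarrow> complex) set" where
  "characters \<X> x0 = hom (fundamental_group \<X> x0) (units_of complex_field)"


section \<open>Homology with coefficients in a rank one local system\<close>

text \<open>
  The local system \<open>\<complex>\<^sub>\<rho>\<close> on a path-connected space: all stalks are identified with \<open>\<complex>\<close> by
  means of chosen paths from the base point, and parallel transport along a path \<open>p\<close> is
  multiplication by the value of \<open>\<rho>\<close> on the loop obtained by closing up \<open>p\<close> with the chosen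
  paths.  The monodromy along a loop \<open>g\<close> at the base point is then \<open>\<rho> [g]\<close>.
  Another choice of paths gives an isomorphic local system.
\<close>

definition base_path :: "'a topology \<Rightarrow> 'a \<Rightarrow> 'a \<Rightarrow> real \<Rightarrow> 'a" where
  "base_path \<X> x0 x = (SOME g. pathin \<X> g \<and> g 0 = x0 \<and> g 1 = x)"

definition transport ::
    "'a topology \<Rightarrow> 'a \<Rightarrow> ((real \<Rightarrow> 'a) set \<Rightarrow> complex) \<Rightarrow> (real \<Rightarrow> 'a) \<Rightarrow> complex" where
  "transport \<X> x0 \<rho> p =
     \<rho> (path_class \<X> (path_join (base_path \<X> x0 (p 0))
                        (path_join p (path_rev (base_path \<X> x0 (p 1))))))"

definition complex_chains ::
    "nat \<Rightarrow> 'a topology \<Rightarrow> (complex, ((nat \<Rightarrow> real) \<Rightarrow> 'a) \<Rightarrow>\<^sub>0 complex) module" where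
  "complex_chains n \<X> =
     \<lparr>carrier = {c. Poly_Mapping.keys c \<subseteq> singular_simplex_set n \<X>},
      mult = undefined, one = undefined, zero = 0, add = (+),
      smult = (\<lambda>z. Poly_Mapping.map ((*) z))\<rparr>"

text \<open>The edge from the vertex 0 to the vertex 1 of a singular simplex.\<close>

definition initial_edge :: "((nat \<Rightarrow> real) \<Rightarrow> 'a) \<Rightarrow> real \<Rightarrow> 'a" where
  "initial_edge \<sigma> = (\<lambda>t. \<sigma> (\<lambda>j. if j = 0 then 1 - t else if j = 1 then t else 0))"

text \<open>
  The coefficient of a simplex lies in the stalk over its vertex 0.  The face opposite to that
  vertex starts at vertex 1, so there the coefficient is transported along the initial edge.
\<close>

definition twisted_boundary ::
    "((real \<Rightarrow> 'a) \<Rightarrow> complex) \<Rightarrow> nat \<Rightarrow>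
       (((nat \<Rightarrow> real) \<Rightarrow> 'a) \<Rightarrow>\<^sub>0 complex) \<Rightarrow> (((nat \<Rightarrow> real) \<Rightarrow> 'a) \<Rightarrow>\<^sub>0 complex)" where
  "twisted_boundary T n c =
     (if n = 0 then 0 else
        \<Sum>\<sigma>\<in>Poly_Mapping.keys c. \<Sum>i\<le>n.
          Poly_Mapping.single (singular_face n i \<sigma>)
            ((- 1) ^ i * (if i = 0 then T (initial_edge \<sigma>) else 1) * Poly_Mapping.lookup c \<sigma>))"

definition local_homology ::
    "nat \<Rightarrow> 'a topology \<Rightarrow> ((real \<Rightarrow> 'a) \<Rightarrow> complex) \<Rightarrow>
       (complex, (((nat \<Rightarrow> real) \<Rightarrow> 'a) \<Rightarrow>\<^sub>0 complex) set) module" where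
  "local_homology n \<X> T =
     subquotient (complex_chains n \<X>)
       {c \<in> carrier (complex_chains n \<X>). twisted_boundary T n c = 0}
       (twisted_boundary T (Suc n) ` carrier (complex_chains (Suc n) \<X>))"

definition characteristic_variety ::
    "nat \<Rightarrow> nat \<Rightarrow> 'a topology \<Rightarrow> 'a \<Rightarrow> ((real \<Rightarrow> 'a) set \<Rightarrow> complex) set" where
  "characteristic_variety i d \<X> x0 =
     {\<rho> \<in> characters \<X> x0. vdim (local_homology i \<X> (transport \<X> x0 \<rho>)) \<ge> enat d}"


section \<open>Singular cohomology, cup products and resonance\<close>

type_synonym 'a cochain = "((nat \<Rightarrow> real) \<Rightarrow> 'a) \<Rightarrow> complex"

definition cochains :: "nat \<Rightarrow> 'a topology \<Rightarrow> (complex, 'a cochain) module" where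
  "cochains n \<X> =
     \<lparr>carrier = {\<alpha>. \<forall>\<sigma>. \<not> singular_simplex n \<X> \<sigma> \<longrightarrow> \<alpha> \<sigma> = 0},
      mult = undefined, one = undefined,
      zero = (\<lambda>_. 0), add = (\<lambda>\<alpha> \<beta> \<sigma>. \<alpha> \<sigma> + \<beta> \<sigma>), smult = (\<lambda>z \<alpha> \<sigma>. z * \<alpha> \<sigma>)\<rparr>"

definition coboundary :: "nat \<Rightarrow> 'a topology \<Rightarrow> 'a cochain \<Rightarrow> 'a cochain" where
  "coboundary n \<X> \<alpha> =
     (\<lambda>\<sigma>. if singular_simplex (Suc n) \<X> \<sigma>
          then \<Sum>i\<le>Suc n. (- 1) ^ i * \<alpha> (singular_face (Suc n) i \<sigma>) else 0)"

definition cocycles :: "nat \<Rightarrow> 'a topology \<Rightarrow> 'a cochain set" where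
  "cocycles n \<X> = {\<alpha> \<in> carrier (cochains n \<X>). coboundary n \<X> \<alpha> = (\<lambda>_. 0)}"

definition coboundaries :: "nat \<Rightarrow> 'a topology \<Rightarrow> 'a cochain set" where
  "coboundaries n \<X> =
     (case n of 0 \<Rightarrow> {\<lambda>_. 0} | Suc m \<Rightarrow> coboundary m \<X> ` carrier (cochains m \<X>))"

definition cohomology :: "nat \<Rightarrow> 'a topology \<Rightarrow> (complex, 'a cochain set) module" where
  "cohomology n \<X> = subquotient (cochains n \<X>) (cocycles n \<X>) (coboundaries n \<X>)"

definition front_face :: "nat \<Rightarrow> ((nat \<Rightarrow> real) \<Rightarrow> 'a) \<Rightarrow> (nat \<Rightarrow> real) \<Rightarrow> 'a" where
  "front_face p \<sigma> = restrict \<sigma> (standard_simplex p)"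

text \<open>The face spanned by the vertices \<open>p, \<dots>, p + q\<close>.\<close>

definition back_face :: "nat \<Rightarrow> nat \<Rightarrow> ((nat \<Rightarrow> real) \<Rightarrow> 'a) \<Rightarrow> (nat \<Rightarrow> real) \<Rightarrow> 'a" where
  "back_face p q \<sigma> =
     restrict (\<lambda>x. \<sigma> (\<lambda>j. if j < p then 0 else x (j - p))) (standard_simplex q)"

definition cochain_cup ::
    "nat \<Rightarrow> nat \<Rightarrow> 'a topology \<Rightarrow> 'a cochain \<Rightarrow> 'a cochain \<Rightarrow> 'a cochain" where
  "cochain_cup p q \<X> \<alpha> \<beta> =
     (\<lambda>\<sigma>. if singular_simplex (p + q) \<X> \<sigma>
          then \<alpha> (front_face p \<sigma>) * \<beta> (back_face p q \<sigma>) else 0)"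

definition cup ::
    "nat \<Rightarrow> nat \<Rightarrow> 'a topology \<Rightarrow> 'a cochain set \<Rightarrow> 'a cochain set \<Rightarrow> 'a cochain set" where
  "cup p q \<X> a b =
     (\<Union>\<alpha>\<in>a. \<Union>\<beta>\<in>b. coboundaries (p + q) \<X> +>\<^bsub>cochains (p + q) \<X>\<^esub> cochain_cup p q \<X> \<alpha> \<beta>)"

text \<open>Degree \<open>i\<close> cohomology of the cochain complex \<open>(H\<^sup>\<bullet>(\<X>, \<complex>), u \<mapsto> a \<union> u)\<close>.\<close>

definition resonance_cohomology ::
    "nat \<Rightarrow> 'a topology \<Rightarrow> 'a cochain set \<Rightarrow> (complex, 'a cochain set set) module" where
  "resonance_cohomology i \<X> a =
     subquotient (cohomology i \<X>)
       {u \<in> carrier (cohomology i \<X>). cup 1 i \<X> a u = \<zero>\<^bsub>cohomology (Suc i) \<X>\<^esub>}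
       (case i of 0 \<Rightarrow> {\<zero>\<^bsub>cohomology 0 \<X>\<^esub>}
                | Suc j \<Rightarrow> cup 1 j \<X> a ` carrier (cohomology j \<X>))"

definition resonance_variety :: "nat \<Rightarrow> nat \<Rightarrow> 'a topology \<Rightarrow> 'a cochain set set" where
  "resonance_variety i d \<X> =
     {a \<in> carrier (cohomology 1 \<X>). vdim (resonance_cohomology i \<X> a) \<ge> enat d}"

end

theory Submission
  imports Defs
begin

text \<open>
  A functional on paths with values in a semigroup that is multiplicative on singular triangles
  behaves like a homomorphism on the fundamental groupoid, and two such functionals on the sets of
  an open cover that agree on the intersection can be glued (the easy half of van Kampen's theorem).
  The connected sum is covered by the two punctured summands, whose intersection is a simply
  connected punctured ball since the dimension is at least three.

  A degree one class in twisted homology is detected by a cocycle with values in the affine group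
  of the complex line whose linear part is the given character.  If the character is non-trivial on
  both summands, such a cocycle is glued from a twisted coboundary on one side and zero on the
  other; it does not vanish on the cycle \<open>(\<rho>(k) - 1) l - (\<rho>(l) - 1) k\<close> of loops \<open>l\<close>, \<open>k\<close> in the
  two summands.  If the character is trivial on one summand, an additive cocycle of that summand
  extends by zero.

  A cup product of degree one classes vanishes iff the two cocycles lift to a cocycle with values
  in the Heisenberg group, so this may be checked on the two summands separately.  A class \<open>a\<close>
  that restricts non-trivially to both summands is annihilated by its restriction to one of them;
  otherwise \<open>a\<close> is annihilated by every class of a summand on which it is trivial.
\<close>

section \<open>Cocycles on paths and the van Kampen principle\<close>

text \<open>Both invariants live in degree one, so they can be read off from functionals on paths,
  which are singular 1-cochains and representations of the fundamental groupoid at the same time.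
  Van Kampen's theorem is used in dual form, as a statement about such functionals with values in a
  fixed semigroup; free products and exact sequences do not occur. Four targets suffice: the
  additive and the multiplicative complex numbers, the Heisenberg group and the affine group.

  The obstacle is that cocycles on the two pieces have to agree exactly on the intersection, not
  just up to a coboundary. Simple connectivity provides a potential there, and the potential is used
  to normalise one of the two cocycles before gluing.

  The Betti numbers enter as complex cocycles with a non-zero period: an element of infinite order
  in integral homology is separated from the boundaries by a homomorphism to the complex numbers,
  and a loop with non-zero period is then found away from the centre of the disc.\<close>

definition tri :: "(real \<times> real) set" where
  "tri = {z. 0 \<le> fst z \<and> 0 \<le> snd z \<and> fst z + snd z \<le> 1}"

lemma tri_eq_hull: "tri = convex hull {(0,0),(1,0),(0,1)}"
proof -
  have "\<exists>u\<ge>0. u + a + b = 1" if "a + b \<le> 1" for a b :: real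
    using that by (intro exI[of _ "1 - a - b"]) auto
  then show ?thesis by (auto simp: tri_def convex_hull_3)
qed

lemma compact_tri: "compact tri" and convex_tri: "convex tri"
  unfolding tri_eq_hull by (auto intro: compact_convex_hull)

text \<open>With the vertices \<open>(0,0)\<close>, \<open>(1,0)\<close>, \<open>(0,1)\<close> of
  \<open>tri\<close> numbered 0, 1, 2, the second clause says that edge 01 times edge 12 is edge 02:
  a 1-cocycle on singular triangles with possibly non-commutative values. The first clause is there
  because paths are total functions on the reals whose values outside the unit interval carry no
  meaning.\<close>

definition path_cocycle ::
    "'a topology \<Rightarrow> ('g \<Rightarrow> 'g \<Rightarrow> 'g) \<Rightarrow> ((real \<Rightarrow> 'a) \<Rightarrow> 'g) \<Rightarrow> bool" where
  "path_cocycle \<X> m F \<longleftrightarrow>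
     (\<forall>p q. pathin \<X> p \<and> (\<forall>t\<in>{0..1}. p t = q t) \<longrightarrow> F p = F q) \<and>
     (\<forall>s. continuous_map (top_of_set tri) \<X> s \<longrightarrow>
        m (F (\<lambda>t. s (t, 0))) (F (\<lambda>t. s (1 - t, t))) = F (\<lambda>t. s (0, t)))"

lemma path_cocycle_cong:
  assumes "path_cocycle \<X> m F" "pathin \<X> p" "\<And>t. 0 \<le> t \<Longrightarrow> t \<le> 1 \<Longrightarrow> p t = q t"
  shows "F p = F q"
  using assms unfolding path_cocycle_def by auto

text \<open>An affine map carries \<open>tri\<close> to the triangle \<open>a\<close>,
  \<open>b\<close>, \<open>c\<close>, which may be degenerate. So \<open>s\<close> turns
  \<open>F\<close> into a function of pairs of points of \<open>D\<close> that composes along all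
  triples; the subdivision arguments work with such functions.\<close>

lemma path_cocycle_convex:
  fixes D :: "'v::real_normed_vector set"
  assumes F: "path_cocycle \<X> m F" and D: "convex D" and s: "continuous_map (top_of_set D) \<X> s"
    and abc: "a \<in> D" "b \<in> D" "c \<in> D"
  shows "m (F (s \<circ> linepath a b)) (F (s \<circ> linepath b c)) = F (s \<circ> linepath a c)"
proof -
  define r where "r = (\<lambda>z::real\<times>real. (1 - fst z - snd z) *\<^sub>R a + fst z *\<^sub>R b + snd z *\<^sub>R c)"
  have "r ` tri \<subseteq> D"
  proof
    fix y assume "y \<in> r ` tri"
    then obtain z where z: "z \<in> tri" "y = r z" by blast
    have "convex hull {a,b,c} \<subseteq> D"
      using D abc by (simp add: subset_hull)
    moreover have "r z \<in> convex hull {a,b,c}"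
      unfolding convex_hull_3 r_def
      by (rule CollectI, rule exI[of _ "1 - fst z - snd z"], rule exI[of _ "fst z"], rule exI[of _ "snd z"])
        (use z(1) in \<open>auto simp: tri_def\<close>)
    ultimately show "y \<in> D" using z by blast
  qed
  moreover have "continuous_on tri r"
    unfolding r_def by (intro continuous_intros)
  ultimately have "continuous_map (top_of_set tri) (top_of_set D) r"
    by auto
  then have *: "continuous_map (top_of_set tri) \<X> (s \<circ> r)"
    using s continuous_map_compose by blast
  have e: "(\<lambda>t. (s \<circ> r) (t, 0)) = s \<circ> linepath a b"
    "(\<lambda>t. (s \<circ> r) (1 - t, t)) = s \<circ> linepath b c"
    "(\<lambda>t. (s \<circ> r) (0, t)) = s \<circ> linepath a c"
    by (auto simp: r_def linepath_def algebra_simps intro!: ext)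
  show ?thesis
    using F * unfolding path_cocycle_def e[symmetric] by blast
qed

lemma pathin_linepath:
  assumes "convex D" "continuous_map (top_of_set D) \<X> s" "a \<in> D" "b \<in> D"
  shows "pathin \<X> (s \<circ> linepath a b)"
proof -
  have "linepath a b ` {0..1} \<subseteq> D"
    using assms by (metis convex_contains_segment linepath_image_01)
  then have "continuous_map (top_of_set {0..1}) (top_of_set D) (linepath a b)"
    by auto
  then show ?thesis
    unfolding pathin_def using assms(2) continuous_map_compose by blast
qed

lemma linepath_01 [simp]: "linepath (0::real) 1 = (\<lambda>t. t)"
  by (auto simp: linepath_def)

lemma path_cocycle_pullback:
  assumes "path_cocycle Y m F" "continuous_map \<X> Y f"
  shows "path_cocycle \<X> m (\<lambda>p. F (f \<circ> p))"
  unfolding path_cocycle_def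
proof (intro conjI allI impI; (elim conjE)?)
  fix p q assume "pathin \<X> p" "\<forall>t\<in>{0..1}. p t = q t"
  then show "F (f \<circ> p) = F (f \<circ> q)"
    using pathin_compose[OF _ assms(2)] by (auto intro!: path_cocycle_cong[OF assms(1)])
next
  fix s assume "continuous_map (top_of_set tri) \<X> s"
  then have "continuous_map (top_of_set tri) Y (f \<circ> s)"
    using assms(2) continuous_map_compose by blast
  then show "m (F (f \<circ> (\<lambda>t. s (t, 0)))) (F (f \<circ> (\<lambda>t. s (1 - t, t)))) = F (f \<circ> (\<lambda>t. s (0, t)))"
    using assms(1) unfolding path_cocycle_def by (auto simp: o_def)
qed

lemma path_cocycle_subtopology:
  assumes "path_cocycle \<X> m F"
  shows "path_cocycle (subtopology \<X> S) m F"
  using path_cocycle_pullback[OF assms continuous_map_from_subtopology[OF continuous_map_id], of S]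
  by simp

text \<open>The scale is doubled repeatedly: a pair of points receives the product over its
  midpoint. In the medial subdivision of a triangle all sides are halved, and the middle triangle
  trades the two small edges at \<open>b\<close> for two small edges at the midpoint of
  \<open>a\<close> and \<open>c\<close>. Boundedness of \<open>D\<close> ends the process after
  finitely many doublings.\<close>

lemma coherent_extension:
  fixes m :: "'g \<Rightarrow> 'g \<Rightarrow> 'g" and D :: "'v::real_normed_vector set"
  assumes m: "semigroup m" and D: "convex D" "bounded D" and e: "\<epsilon> > 0"
    and E0: "\<And>a b c. \<lbrakk>a \<in> D; b \<in> D; c \<in> D; dist a b < \<epsilon>; dist b c < \<epsilon>; dist a c < \<epsilon>\<rbrakk>
               \<Longrightarrow> m (E0 a b) (E0 b c) = E0 a c"
  obtains E where "\<And>a b c. \<lbrakk>a \<in> D; b \<in> D; c \<in> D\<rbrakk> \<Longrightarrow> m (E a b) (E b c) = E a c"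
    and "\<And>a b. \<lbrakk>a \<in> D; b \<in> D; dist a b < \<epsilon>\<rbrakk> \<Longrightarrow> E a b = E0 a b"
proof -
  interpret semigroup m by fact
  have mid: "midpoint a b \<in> D" if "a \<in> D" "b \<in> D" for a b
    using that D(1) by (metis closed_segment_subset midpoint_in_closed_segment subsetD)
  \<comment> \<open>Each extension must keep the values of \<open>E0\<close> below the original
    scale, so that the final function is still tied to the local data.\<close>
  have "\<exists>E. (\<forall>a\<in>D. \<forall>b\<in>D. \<forall>c\<in>D. dist a b < 2^n * \<epsilon> \<and> dist b c < 2^n * \<epsilon> \<and> dist a c < 2^n * \<epsilon>
               \<longrightarrow> m (E a b) (E b c) = E a c) \<and>
            (\<forall>a\<in>D. \<forall>b\<in>D. dist a b < \<epsilon> \<longrightarrow> E a b = E0 a b)" for n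
  proof (induction n)
    case 0
    show ?case using E0 by (intro exI[of _ E0]) auto
  next
    case (Suc n)
    then obtain E where E: "\<And>a b c. \<lbrakk>a \<in> D; b \<in> D; c \<in> D; dist a b < 2^n * \<epsilon>; dist b c < 2^n * \<epsilon>;
        dist a c < 2^n * \<epsilon>\<rbrakk> \<Longrightarrow> m (E a b) (E b c) = E a c"
      "\<And>a b. \<lbrakk>a \<in> D; b \<in> D; dist a b < \<epsilon>\<rbrakk> \<Longrightarrow> E a b = E0 a b" by blast
    define E' where "E' = (\<lambda>a b. m (E a (midpoint a b)) (E (midpoint a b) b))"
    have half: "dist a (midpoint a b) = dist a b / 2" "dist (midpoint a b) b = dist a b / 2" for a b :: 'v
      by (auto simp: dist_midpoint)
    have mm: "dist (midpoint a b) (midpoint a c) = dist b c / 2"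
      "dist (midpoint a b) (midpoint b c) = dist a c / 2"
      "dist (midpoint a c) (midpoint b c) = dist a b / 2" for a b c :: 'v
      by (simp_all add: midpoint_def dist_norm flip: scaleR_diff_right)
    show ?case
    proof (intro exI[of _ E'] conjI ballI impI)
      fix a b c assume D: "a \<in> D" "b \<in> D" "c \<in> D"
        and d: "dist a b < 2^Suc n * \<epsilon> \<and> dist b c < 2^Suc n * \<epsilon> \<and> dist a c < 2^Suc n * \<epsilon>"
      note M = mid[OF D(1,2)] mid[OF D(2,3)] mid[OF D(1,3)]
      let ?x = "midpoint a b" and ?y = "midpoint b c" and ?z = "midpoint a c"
      have 1: "m (E ?x b) (E b ?y) = E ?x ?y"
        using D M d by (intro E) (auto simp: half mm)
      have 2: "E ?x ?y = m (E ?x ?z) (E ?z ?y)"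
        using D M d by (intro E(1)[symmetric]) (auto simp: half mm)
      have 3: "m (E a ?x) (E ?x ?z) = E a ?z"
        using D M d by (intro E) (auto simp: half mm)
      have 4: "m (E ?z ?y) (E ?y c) = E ?z c"
        using D M d by (intro E) (auto simp: half mm)
      have "m (E' a b) (E' b c) = m (E a ?x) (m (m (E ?x b) (E b ?y)) (E ?y c))"
        by (simp add: E'_def assoc)
      also have "\<dots> = m (m (E a ?x) (E ?x ?z)) (m (E ?z ?y) (E ?y c))"
        unfolding 1 2 by (simp add: assoc)
      finally show "m (E' a b) (E' b c) = E' a c"
        unfolding 3 4 E'_def .
    next
      fix a b assume D: "a \<in> D" "b \<in> D" and d: "dist a b < \<epsilon>"
      have "\<epsilon> \<le> 2^n * \<epsilon>" using e by simp
      with d have "dist a b < 2^n * \<epsilon>" by linarith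
      moreover from this have "dist a b / 2 < 2^n * \<epsilon>"
        using zero_le_dist[of a b] by linarith
      ultimately have "E' a b = E a b"
        unfolding E'_def using D mid[OF D] by (intro E) (simp_all add: half)
      with E(2)[OF D d] show "E' a b = E0 a b" by simp
    qed
  qed
  note * = this
  obtain B where B: "\<And>a b. a \<in> D \<Longrightarrow> b \<in> D \<Longrightarrow> dist a b \<le> B"
    using D(2) bounded_two_points by metis
  obtain n where "B / \<epsilon> < 2 ^ n"
    using real_arch_pow[of 2 "B / \<epsilon>"] by auto
  then have "B < 2^n * \<epsilon>" using e by (simp add: field_simps)
  then have "\<And>a b. a \<in> D \<Longrightarrow> b \<in> D \<Longrightarrow> dist a b < 2^n * \<epsilon>" using B by fastforce
  with *[of n] that show ?thesis by metis
qed

text \<open>Both functions are determined on a pair by their values on its two halves, so agreement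
  passes from each scale to the double one without a cancellation law.\<close>

lemma coherent_unique:
  fixes m :: "'g \<Rightarrow> 'g \<Rightarrow> 'g" and D :: "'v::real_normed_vector set"
  assumes D: "convex D" and e: "\<epsilon> > 0"
    and E: "\<And>a b c. \<lbrakk>a \<in> D; b \<in> D; c \<in> D\<rbrakk> \<Longrightarrow> m (E a b) (E b c) = E a c"
    and E': "\<And>a b c. \<lbrakk>a \<in> D; b \<in> D; c \<in> D\<rbrakk> \<Longrightarrow> m (E' a b) (E' b c) = E' a c"
    and eq: "\<And>a b. \<lbrakk>a \<in> D; b \<in> D; dist a b < \<epsilon>\<rbrakk> \<Longrightarrow> E a b = E' a b"
    and ab: "a \<in> D" "b \<in> D"
  shows "E a b = E' a b"
proof -
  have mid: "midpoint a b \<in> D" if "a \<in> D" "b \<in> D" for a b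
    using that D by (metis closed_segment_subset midpoint_in_closed_segment subsetD)
  have *: "\<forall>a\<in>D. \<forall>b\<in>D. dist a b < 2^n * \<epsilon> \<longrightarrow> E a b = E' a b" for n
  proof (induction n)
    case 0
    show ?case using eq by auto
  next
    case (Suc n)
    show ?case
    proof (intro ballI impI)
      fix a b assume D: "a \<in> D" "b \<in> D" and d: "dist a b < 2 ^ Suc n * \<epsilon>"
      have "E a (midpoint a b) = E' a (midpoint a b)" "E (midpoint a b) b = E' (midpoint a b) b"
        using Suc D mid[OF D] d zero_le_dist[of a b] by (auto simp: dist_midpoint)
      then show "E a b = E' a b"
        using E[OF D(1) mid[OF D] D(2)] E'[OF D(1) mid[OF D] D(2)] by simp
    qed
  qed
  obtain n where "dist a b / \<epsilon> < 2 ^ n"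
    using real_arch_pow[of 2 "dist a b / \<epsilon>"] by auto
  then have "dist a b < 2^n * \<epsilon>" using e by (simp add: field_simps)
  with * ab show ?thesis by blast
qed

text \<open>A Lebesgue number for the preimages of \<open>U\<close> and \<open>V\<close>. Balls are
  convex, so the hull of three close points stays in the ball around one of them, and one number
  serves segments and triangles alike.\<close>

lemma cover_lebesgue:
  fixes D :: "'v::real_normed_vector set"
  assumes D: "compact D" "convex D" and s: "continuous_map (top_of_set D) \<X> s"
    and U: "openin \<X> U" "openin \<X> V" "topspace \<X> \<subseteq> U \<union> V"
  obtains \<epsilon> where "\<epsilon> > 0" and "\<And>a b c. \<lbrakk>a \<in> D; b \<in> D; c \<in> D; dist a b < \<epsilon>; dist b c < \<epsilon>; dist a c < \<epsilon>\<rbrakk>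
     \<Longrightarrow> s ` (convex hull {a,b,c}) \<subseteq> U \<or> s ` (convex hull {a,b,c}) \<subseteq> V"
proof -
  have "openin (top_of_set D) {x\<in>D. s x \<in> U}" "openin (top_of_set D) {x\<in>D. s x \<in> V}"
    using s U(1,2) by (auto simp: continuous_map_def)
  then obtain U' V' where U': "open U'" "{x\<in>D. s x \<in> U} = D \<inter> U'" "open V'" "{x\<in>D. s x \<in> V} = D \<inter> V'"
    unfolding openin_open by auto
  have "D \<subseteq> \<Union>{U',V'}"
    using U' U(3) s by (auto simp: continuous_map_def)
  then obtain e where e: "e > 0" "\<And>x. x \<in> D \<Longrightarrow> \<exists>G\<in>{U',V'}. ball x e \<subseteq> G"
    using Heine_Borel_lemma[OF D(1), of "{U',V'}"] U'(1,3) by auto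
  show ?thesis
  proof
    show "e > 0" by fact
    fix a b c assume *: "a \<in> D" "b \<in> D" "c \<in> D" "dist a b < e" "dist b c < e" "dist a c < e"
    have "convex hull {a,b,c} \<subseteq> D \<inter> ball a e"
      by (rule hull_minimal) (use * D e in \<open>auto simp: convex_Int\<close>)
    moreover from e(2)[OF \<open>a \<in> D\<close>] have "ball a e \<subseteq> U' \<or> ball a e \<subseteq> V'" by auto
    ultimately show "s ` (convex hull {a,b,c}) \<subseteq> U \<or> s ` (convex hull {a,b,c}) \<subseteq> V"
      using U'(2,4) by blast
  qed
qed

text \<open>Along a fixed path both functionals are coherent in the parameters, and they agree on
  intervals short enough to stay in one of the two sets.\<close>

lemma path_cocycle_unique:
  assumes F: "path_cocycle \<X> m F" and G: "path_cocycle \<X> m G"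
    and U: "openin \<X> U" "openin \<X> V" "topspace \<X> \<subseteq> U \<union> V"
    and eq: "\<And>p. \<lbrakk>pathin \<X> p; p ` {0..1} \<subseteq> U \<or> p ` {0..1} \<subseteq> V\<rbrakk> \<Longrightarrow> F p = G p"
    and p: "pathin \<X> p"
  shows "F p = G p"
proof -
  have c: "continuous_map (top_of_set {0..1}) \<X> p" using p by (simp add: pathin_def)
  obtain e where e: "e > 0" "\<And>a b c. \<lbrakk>a \<in> {0..1}; b \<in> {0..1}; c \<in> {0..1}; dist a b < e; dist b c < e; dist a c < e\<rbrakk>
     \<Longrightarrow> p ` (convex hull {a,b,c}) \<subseteq> U \<or> p ` (convex hull {a,b,c}) \<subseteq> V"
    using cover_lebesgue[OF compact_Icc convex_real_interval(5) c U] by metis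
  have "F (p \<circ> linepath 0 1) = G (p \<circ> linepath 0 1)"
  proof (rule coherent_unique[where E = "\<lambda>a b. F (p \<circ> linepath a b)" and E' = "\<lambda>a b. G (p \<circ> linepath a b)" and D = "{0..1}"])
    fix a b :: real assume ab: "a \<in> {0..1}" "b \<in> {0..1}" "dist a b < e"
    have "(p \<circ> linepath a b) ` {0..1} = p ` closed_segment a b"
      by (metis image_comp linepath_image_01)
    moreover have "p ` closed_segment a b \<subseteq> U \<or> p ` closed_segment a b \<subseteq> V"
      using e(2)[of a b b] ab e(1) by (simp add: segment_convex_hull)
    ultimately show "F (p \<circ> linepath a b) = G (p \<circ> linepath a b)"
      using ab by (intro eq pathin_linepath[OF _ c]) auto
  next
    fix a b c :: real assume abc: "a \<in> {0..1}" "b \<in> {0..1}" "c \<in> {0..1}"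
    show "m (F (p \<circ> linepath a b)) (F (p \<circ> linepath b c)) = F (p \<circ> linepath a c)"
      by (rule path_cocycle_convex[OF F _ c]) (use abc in auto)
    show "m (G (p \<circ> linepath a b)) (G (p \<circ> linepath b c)) = G (p \<circ> linepath a c)"
      by (rule path_cocycle_convex[OF G _ c]) (use abc in auto)
  qed (use e(1) in auto)
  then show ?thesis by (simp add: o_def)
qed

text \<open>A coherent function of two path parameters is forced by its values on short intervals,
  where it must be \<open>F\<close> or \<open>G\<close>; the glued functional is its value from 0 to
  1. The triangle relation comes from one coherent function on a whole triangle, restricted to the
  three edges.\<close>

lemma path_cocycle_glue:
  fixes m :: "'g \<Rightarrow> 'g \<Rightarrow> 'g"
  assumes m: "semigroup m"
    and F: "path_cocycle (subtopology \<X> U) m F" and G: "path_cocycle (subtopology \<X> V) m G"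
    and U: "openin \<X> U" "openin \<X> V" "topspace \<X> \<subseteq> U \<union> V"
    and eq: "\<And>p. \<lbrakk>pathin \<X> p; p ` {0..1} \<subseteq> U; p ` {0..1} \<subseteq> V\<rbrakk> \<Longrightarrow> F p = G p"
  obtains H where "path_cocycle \<X> m H"
    and "\<And>p. \<lbrakk>pathin \<X> p; p ` {0..1} \<subseteq> U\<rbrakk> \<Longrightarrow> H p = F p"
    and "\<And>p. \<lbrakk>pathin \<X> p; p ` {0..1} \<subseteq> V\<rbrakk> \<Longrightarrow> H p = G p"
proof -
  \<comment> \<open>Paths inside both sets take the value of \<open>F\<close>, which agrees with
    that of \<open>G\<close> by \<open>eq\<close>; \<open>undefined\<close> is reached only by paths
    contained in neither set.\<close>
  define E0 where "E0 = (\<lambda>p. if p ` {0..1} \<subseteq> U then F p else if p ` {0..1} \<subseteq> V then G p else undefined)"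
  define coh :: "(real \<Rightarrow> real \<Rightarrow> 'g) \<Rightarrow> bool" where
    "coh E \<longleftrightarrow> (\<forall>a\<in>{0..1}. \<forall>b\<in>{0..1}. \<forall>c\<in>{0..1}. m (E a b) (E b c) = E a c)" for E
  define loc :: "(real \<Rightarrow> 'a) \<Rightarrow> (real \<Rightarrow> real \<Rightarrow> 'g) \<Rightarrow> bool" where
    "loc p E \<longleftrightarrow> (\<exists>e>0. \<forall>a\<in>{0..1}. \<forall>b\<in>{0..1}. dist a b < e \<longrightarrow> E a b = E0 (p \<circ> linepath a b))" for p E
  have EV: "E0 p = G p" if "pathin \<X> p" "p ` {0..1} \<subseteq> V" for p
    using that eq by (auto simp: E0_def)
  have seg: "(s \<circ> linepath a b) ` {0..1} = s ` closed_segment a b" for s :: "'v::real_normed_vector \<Rightarrow> 'a" and a b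
    by (metis image_comp linepath_image_01)
  \<comment> \<open>A small triangle lies over one of the two sets, where \<open>F\<close> or
    \<open>G\<close> satisfies the relation; \<open>coherent_extension\<close> spreads it over all
    of \<open>D\<close>.\<close>
  have dev: "\<exists>E e. (\<forall>a\<in>D. \<forall>b\<in>D. \<forall>c\<in>D. m (E a b) (E b c) = E a c) \<and> e > 0 \<and>
      (\<forall>a\<in>D. \<forall>b\<in>D. dist a b < e \<longrightarrow> E a b = E0 (s \<circ> linepath a b))"
    if D: "compact D" "convex D" and s: "continuous_map (top_of_set D) \<X> s"
    for D and s :: "'v::real_normed_vector \<Rightarrow> 'a"
  proof -
    obtain e where e: "e > 0" "\<And>a b c. \<lbrakk>a \<in> D; b \<in> D; c \<in> D; dist a b < e; dist b c < e; dist a c < e\<rbrakk>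
       \<Longrightarrow> s ` (convex hull {a,b,c}) \<subseteq> U \<or> s ` (convex hull {a,b,c}) \<subseteq> V"
      using cover_lebesgue[OF D s U] by metis
    have "m (E0 (s \<circ> linepath a b)) (E0 (s \<circ> linepath b c)) = E0 (s \<circ> linepath a c)"
      if *: "a \<in> D" "b \<in> D" "c \<in> D" "dist a b < e" "dist b c < e" "dist a c < e" for a b c
    proof -
      let ?H = "convex hull {a,b,c}"
      have HD: "?H \<subseteq> D" using * D by (simp add: subset_hull)
      have sub: "closed_segment a b \<subseteq> ?H" "closed_segment b c \<subseteq> ?H" "closed_segment a c \<subseteq> ?H"
        by (simp_all add: segment_convex_hull hull_mono)
      have abc: "a \<in> ?H" "b \<in> ?H" "c \<in> ?H" by (auto intro: hull_inc)
      have sH: "continuous_map (top_of_set ?H) \<X> s"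
        using continuous_map_from_subtopology_mono[OF s HD] .
      consider "s ` ?H \<subseteq> U" | "s ` ?H \<subseteq> V" using e(2)[OF *] by blast
      then show ?thesis
      proof cases
        case 1
        then have "continuous_map (top_of_set ?H) (subtopology \<X> U) s"
          using sH by (simp add: continuous_map_in_subtopology image_subset_iff_funcset)
        from path_cocycle_convex[OF F convex_convex_hull this abc]
        moreover have "E0 (s \<circ> linepath x y) = F (s \<circ> linepath x y)" if "closed_segment x y \<subseteq> ?H" for x y
          unfolding E0_def seg using order_trans[OF image_mono[OF that] 1] by simp
        ultimately show ?thesis using sub by simp
      next
        case 2
        then have "continuous_map (top_of_set ?H) (subtopology \<X> V) s"
          using sH by (simp add: continuous_map_in_subtopology image_subset_iff_funcset)
        from path_cocycle_convex[OF G convex_convex_hull this abc]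
        moreover have "E0 (s \<circ> linepath x y) = G (s \<circ> linepath x y)"
          if "x \<in> ?H" "y \<in> ?H" "closed_segment x y \<subseteq> ?H" for x y
          using order_trans[OF image_mono[OF that(3)] 2] pathin_linepath[OF convex_convex_hull sH that(1,2)]
          by (intro EV) (simp_all only: seg)
        ultimately show ?thesis using sub abc by simp
      qed
    qed
    note local = this
    obtain E where "\<And>a b c. \<lbrakk>a \<in> D; b \<in> D; c \<in> D\<rbrakk> \<Longrightarrow> m (E a b) (E b c) = E a c"
      "\<And>a b. \<lbrakk>a \<in> D; b \<in> D; dist a b < e\<rbrakk> \<Longrightarrow> E a b = E0 (s \<circ> linepath a b)"
      by (rule coherent_extension[OF m D(2) compact_imp_bounded[OF D(1)] e(1), of "\<lambda>a b. E0 (s \<circ> linepath a b)"])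
        (use local in blast)+
    with e(1) show ?thesis by (intro exI[of _ E] exI[of _ e]) simp
  qed
  \<comment> \<open>The choice is immaterial: two coherent functions with the same short-range
    values coincide by \<open>coherent_unique\<close>.\<close>
  define H where "H = (\<lambda>p. (SOME E. coh E \<and> loc p E) 0 1)"
  have H: "H p = E 0 1" if p: "pathin \<X> p" and cE: "coh E" and lE: "loc p E" for p E
  proof -
    define E' where "E' = (SOME E. coh E \<and> loc p E)"
    have E': "coh E'" "loc p E'"
      using someI[of "\<lambda>E. coh E \<and> loc p E", folded E'_def] cE lE by blast+
    obtain e where e: "e > 0" "\<And>a b. \<lbrakk>a\<in>{0..1}; b\<in>{0..1}; dist a b < e\<rbrakk> \<Longrightarrow> E a b = E0 (p \<circ> linepath a b)"
      using lE unfolding loc_def by blast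
    obtain e' where e': "e' > 0" "\<And>a b. \<lbrakk>a\<in>{0..1}; b\<in>{0..1}; dist a b < e'\<rbrakk> \<Longrightarrow> E' a b = E0 (p \<circ> linepath a b)"
      using E'(2) unfolding loc_def by blast
    have "E' 0 1 = E 0 1"
      by (rule coherent_unique[where D = "{0..1}" and \<epsilon> = "min e e'" and m = m])
        (use cE E'(1) e e' in \<open>auto simp: coh_def\<close>)
    then show ?thesis by (simp add: H_def E'_def)
  qed
  have line: "linepath a b \<circ> linepath x y = linepath (linepath a b x) (linepath a b y)"
    for a b :: "'v::real_normed_vector" and x y :: real
    by (auto simp: linepath_def algebra_simps intro!: ext)
  show ?thesis
  proof
    show HF: "H p = F p" if p: "pathin \<X> p" "p ` {0..1} \<subseteq> U" for p
    proof -
      have pU: "continuous_map (top_of_set {0..1}) (subtopology \<X> U) p"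
        using p by (auto simp: pathin_def continuous_map_in_subtopology)
      have "coh (\<lambda>a b. F (p \<circ> linepath a b))"
        unfolding coh_def by (intro ballI path_cocycle_convex[OF F _ pU]) auto
      moreover have "loc p (\<lambda>a b. F (p \<circ> linepath a b))"
      proof -
        have "p ` closed_segment a b \<subseteq> U" if "a \<in> {0..1}" "b \<in> {0..1}" for a b
          using p(2) that closed_segment_subset[of a "{0..1}" b] by auto
        then show ?thesis unfolding loc_def E0_def seg by (intro exI[of _ 1]) auto
      qed
      ultimately have "H p = F (p \<circ> linepath 0 1)" using H[OF p(1)] by simp
      then show ?thesis by (simp add: o_def)
    qed
    show "H p = G p" if p: "pathin \<X> p" "p ` {0..1} \<subseteq> V" for p
    proof -
      have pX: "continuous_map (top_of_set {0..1}) \<X> p" using p by (simp add: pathin_def)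
      have pU: "continuous_map (top_of_set {0..1}) (subtopology \<X> V) p"
        using p by (auto simp: pathin_def continuous_map_in_subtopology)
      have "coh (\<lambda>a b. G (p \<circ> linepath a b))"
        unfolding coh_def by (intro ballI path_cocycle_convex[OF G _ pU]) auto
      moreover have "loc p (\<lambda>a b. G (p \<circ> linepath a b))"
      proof -
        have "p ` closed_segment a b \<subseteq> V" if "a \<in> {0..1}" "b \<in> {0..1}" for a b
          using p(2) that closed_segment_subset[of a "{0..1}" b] by auto
        then have "E0 (p \<circ> linepath a b) = G (p \<circ> linepath a b)" if "a \<in> {0..1}" "b \<in> {0..1}" for a b
          using that by (intro EV pathin_linepath[OF _ pX]) (simp_all only: seg convex_real_interval)
        then show ?thesis unfolding loc_def by (intro exI[of _ 1]) auto
      qed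
      ultimately have "H p = G (p \<circ> linepath 0 1)" using H[OF p(1)] by simp
      then show ?thesis by (simp add: o_def)
    qed
    show "path_cocycle \<X> m H"
      unfolding path_cocycle_def
    proof (intro conjI allI impI; (elim conjE)?)
      fix p q :: "real \<Rightarrow> 'a" assume p: "pathin \<X> p" and pq: "\<forall>t\<in>{0..1}. p t = q t"
      have q: "pathin \<X> q" using p pq unfolding pathin_def
        by (metis continuous_map_eq topspace_euclidean_subtopology)
      \<comment> \<open>The branch taken by \<open>E0\<close> is also decided by values on the unit
        interval. Hence \<open>p\<close> and \<open>q\<close> admit the same functions
        \<open>E\<close>, and the choice operator returns the same one for both.\<close>
      have "E0 (q \<circ> linepath a b) = E0 (p \<circ> linepath a b)" if ab: "a \<in> {0..1}" "b \<in> {0..1}" for a b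
      proof -
        have lab: "linepath a b t \<in> {0..1}" if "t \<in> {0..1}" for t
          using closed_segment_subset[of a "{0..1}" b] ab that
          by (metis convex_real_interval(5) imageI linepath_image_01 subsetD)
        then have e: "(p \<circ> linepath a b) t = (q \<circ> linepath a b) t" if "t \<in> {0..1}" for t
          using pq that by auto
        then have i: "(q \<circ> linepath a b) ` {0..1} = (p \<circ> linepath a b) ` {0..1}"
          by (intro image_cong) auto
        have pp: "pathin \<X> (p \<circ> linepath a b)"
          using p ab by (intro pathin_linepath[of "{0..1}"]) (auto simp: pathin_def)
        show ?thesis
        proof (cases "(p \<circ> linepath a b) ` {0..1} \<subseteq> U")
          case True
          then have "F (p \<circ> linepath a b) = F (q \<circ> linepath a b)"
            using pp e by (intro path_cocycle_cong[OF F]) (auto simp: pathin_subtopology)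
          with True i show ?thesis by (simp add: E0_def)
        next
          case False
          show ?thesis
          proof (cases "(p \<circ> linepath a b) ` {0..1} \<subseteq> V")
            case True
            then have "G (p \<circ> linepath a b) = G (q \<circ> linepath a b)"
              using pp e by (intro path_cocycle_cong[OF G]) (auto simp: pathin_subtopology)
            with False i show ?thesis by (simp add: E0_def)
          next
            case False
            with \<open>\<not> (p \<circ> linepath a b) ` {0..1} \<subseteq> U\<close> i show ?thesis by (simp add: E0_def)
          qed
        qed
      qed
      then have "loc q E = loc p E" for E by (simp add: loc_def)
      then show "H p = H q" by (simp add: H_def)
    next
      fix s :: "real \<times> real \<Rightarrow> 'a" assume s: "continuous_map (top_of_set tri) \<X> s"
      note D = compact_tri convex_tri
      obtain E e where E: "\<And>a b c. \<lbrakk>a\<in>tri; b\<in>tri; c\<in>tri\<rbrakk> \<Longrightarrow> m (E a b) (E b c) = E a c" "e > 0"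
        "\<And>a b. \<lbrakk>a\<in>tri; b\<in>tri; dist a b < e\<rbrakk> \<Longrightarrow> E a b = E0 (s \<circ> linepath a b)"
        using dev[OF D s] by metis
      have *: "H (s \<circ> linepath a b) = E a b" if ab: "a \<in> tri" "b \<in> tri" for a b
      proof -
        let ?l = "linepath a b"
        have l: "?l t \<in> tri" if "t \<in> {0..1}" for t
          using closed_segment_subset[OF ab D(2)] that by (metis imageI linepath_image_01 subsetD)
        have "coh (\<lambda>x y. E (?l x) (?l y))" unfolding coh_def using E(1) l by simp
        moreover have "loc (s \<circ> ?l) (\<lambda>x y. E (?l x) (?l y))"
        proof -
          have di: "dist (?l x) (?l y) = dist x y * dist a b" for x y
          proof -
            have "?l x - ?l y = (x - y) *\<^sub>R (b - a)" by (simp add: linepath_def algebra_simps)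
            then show ?thesis by (simp add: dist_norm norm_minus_commute)
          qed
          \<comment> \<open>The edge stretches distances by the factor \<open>dist a b\<close>, so
            the scale \<open>e\<close> is divided accordingly; the added 1 covers the degenerate
            edge \<open>a = b\<close>.\<close>
          have "E (?l x) (?l y) = E0 (s \<circ> ?l \<circ> linepath x y)"
            if "x \<in> {0..1}" "y \<in> {0..1}" "dist x y < e / (dist a b + 1)" for x y
          proof -
            have "dist x y * dist a b \<le> dist x y * (dist a b + 1)" by (simp add: mult_left_mono)
            also have "\<dots> < e" using that(3) by (simp add: field_simps add_pos_nonneg)
            finally show ?thesis using E(3)[OF l l, of x y] that by (simp add: di o_assoc[symmetric] line)
          qed
          moreover have "e / (dist a b + 1) > 0" using E(2) by (simp add: add_nonneg_pos)
          ultimately show ?thesis unfolding loc_def by blast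
        qed
        ultimately have "H (s \<circ> ?l) = E (?l 0) (?l 1)"
          using H[OF pathin_linepath[OF D(2) s ab]] by simp
        then show ?thesis by (simp add: linepath_0' linepath_1')
      qed
      have e: "(\<lambda>t. s (t, 0)) = s \<circ> linepath (0,0) (1,0)"
        "(\<lambda>t. s (1 - t, t)) = s \<circ> linepath (1,0) (0,1)"
        "(\<lambda>t. s (0, t)) = s \<circ> linepath (0,0) (0,1)"
        by (auto simp: linepath_def intro!: ext)
      have t: "(0,0) \<in> tri" "(1,0) \<in> tri" "(0,1) \<in> tri" by (auto simp: tri_def)
      show "m (H (\<lambda>t. s (t, 0))) (H (\<lambda>t. s (1 - t, t))) = H (\<lambda>t. s (0, t))"
        unfolding e using * E(1) t by simp
    qed
  qed
qed

section \<open>Concatenation, homotopy invariance and potentials\<close>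

lemma pathin_compose_left:
  assumes "pathin \<X> p" "continuous_on {0..1} f" "f ` {0..1} \<subseteq> {0..1}"
  shows "pathin \<X> (p \<circ> f)"
  using assms continuous_map_compose[of "top_of_set {0..1}" "top_of_set {0..1}" f \<X> p]
  unfolding pathin_def by auto

lemma pathin_start: "pathin \<X> p \<Longrightarrow> p 0 \<in> topspace \<X>"
  and pathin_end: "pathin \<X> p \<Longrightarrow> p 1 \<in> topspace \<X>"
  by (auto simp: pathin_def continuous_map_def)

lemma pathin_path_rev: "pathin \<X> p \<Longrightarrow> pathin \<X> (path_rev p)"
  using pathin_compose_left[of \<X> p "\<lambda>t. 1 - t", OF _ continuous_on_diff[OF continuous_on_const continuous_on_id]]
  by (auto simp: path_rev_def o_def)

lemma pathin_path_join:
  assumes p: "pathin \<X> p" and q: "pathin \<X> q" and pq: "p 1 = q 0"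
  shows "pathin \<X> (path_join p q)"
  unfolding pathin_def path_join_def
proof (rule continuous_map_cases_le)
  have 1: "continuous_map (top_of_set {0..1/2}) \<X> (p \<circ> (\<lambda>t. 2 * t))"
    by (rule continuous_map_compose[where X' = "top_of_set {0..1}"])
      (use p in \<open>auto simp: pathin_def intro!: continuous_intros\<close>)
  have 2: "continuous_map (top_of_set {1/2..1}) \<X> (q \<circ> (\<lambda>t. 2 * t - 1))"
    by (rule continuous_map_compose[where X' = "top_of_set {0..1}"])
      (use q in \<open>auto simp: pathin_def intro!: continuous_intros\<close>)
  have "{x \<in> topspace (top_of_set {0..1::real}). x \<le> 1/2} = {0..1/2}"
    "{x \<in> topspace (top_of_set {0..1::real}). 1/2 \<le> x} = {1/2..1}" by auto
  with 1 2 show "continuous_map (subtopology (top_of_set {0..1}) {x \<in> topspace (top_of_set {0..1}). x \<le> 1/2}) \<X> (\<lambda>t. p (2 * t))"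
    "continuous_map (subtopology (top_of_set {0..1}) {x \<in> topspace (top_of_set {0..1}). 1/2 \<le> x}) \<X> (\<lambda>t. q (2 * t - 1))"
    by (simp_all add: subtopology_subtopology o_def Int_absorb1)
next
  fix x :: real assume "x = 1/2"
  then have "2 * x = 1" by simp
  then show "p (2 * x) = q (2 * x - 1)" using pq by simp
qed auto

lemma path_join_ends [simp]: "path_join p q 0 = p 0" "path_join p q 1 = q 1"
  by (auto simp: path_join_def)

lemma path_rev_ends [simp]: "path_rev p 0 = p 1" "path_rev p 1 = p 0"
  by (auto simp: path_rev_def)

text \<open>The parameters 0, 1/2 and 1 of the joined path form a degenerate triangle on the
  line.\<close>

lemma path_cocycle_join:
  assumes F: "path_cocycle \<X> m F" and p: "pathin \<X> p" and q: "pathin \<X> q" and pq: "p 1 = q 0"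
  shows "m (F p) (F q) = F (path_join p q)"
proof -
  let ?r = "path_join p q"
  have r: "continuous_map (top_of_set {0..1}) \<X> ?r"
    using pathin_path_join[OF p q pq] by (simp add: pathin_def)
  have "m (F (?r \<circ> linepath 0 (1/2))) (F (?r \<circ> linepath (1/2) 1)) = F (?r \<circ> linepath 0 1)"
    by (rule path_cocycle_convex[OF F _ r]) auto
  moreover have "F (?r \<circ> linepath 0 (1/2)) = F p"
    by (rule path_cocycle_cong[OF F pathin_linepath[OF _ r]]) (auto simp: linepath_def path_join_def)
  moreover have "F (?r \<circ> linepath (1/2) 1) = F q"
    by (rule path_cocycle_cong[OF F pathin_linepath[OF _ r]])
      (use pq in \<open>auto simp: linepath_def path_join_def field_simps\<close>)
  ultimately show ?thesis by (simp add: o_def)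
qed

text \<open>Both boundary routes of the homotopy square are compared with its diagonal. No unit
  element is available for the two constant sides; instead a degenerate triangle shows that a
  constant side acts trivially on the edge next to it.\<close>

lemma path_cocycle_homotopic:
  assumes F: "path_cocycle \<X> m F"
    and h: "homotopic_with (\<lambda>r. r 0 = p 0 \<and> r 1 = p 1) (top_of_set {0..1}) \<X> p q"
  shows "F p = F q"
proof -
  obtain h :: "real \<times> real \<Rightarrow> 'a" where H: "continuous_map (prod_topology (top_of_set {0..1}) (top_of_set {0..1})) \<X> h \<and>
      (\<forall>x. h (0, x) = p x) \<and> (\<forall>x. h (1, x) = q x) \<and> (\<forall>t\<in>{0..1}. h (t, 0) = p 0 \<and> h (t, 1) = p 1)"
    using h unfolding homotopic_with_def by blast
  then have hc: "continuous_map (prod_topology (top_of_set {0..1}) (top_of_set {0..1})) \<X> h"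
    and h0: "\<And>x. h (0, x) = p x" and h1: "\<And>x. h (1, x) = q x"
    and he: "\<And>t. t \<in> {0..1} \<Longrightarrow> h (t, 0) = p 0 \<and> h (t, 1) = p 1"
    by blast+
  define D :: "(real \<times> real) set" where "D = {0..1} \<times> {0..1}"
  have hD: "continuous_map (top_of_set D) \<X> h"
    using hc by (simp add: D_def prod_topology_subtopology_eu)
  have D: "convex D" by (simp add: D_def convex_Times)
  define E where "E a b = F (h \<circ> linepath a b)" for a b
  have coh: "m (E a b) (E b c) = E a c" if "a \<in> D" "b \<in> D" "c \<in> D" for a b c
    unfolding E_def by (rule path_cocycle_convex[OF F D hD that])
  have in': "(0,0) \<in> D" "(0,1) \<in> D" "(1,0) \<in> D" "(1,1) \<in> D" by (auto simp: D_def)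
  have "E (0,1) (1,1) = E (0,1) (0,1)"
    unfolding E_def using he h0
    by (intro path_cocycle_cong[OF F pathin_linepath[OF D hD]]) (auto simp: in' linepath_def)
  with coh[OF in'(1,2,4)] coh[OF in'(1,2,2)] have 1: "E (0,0) (1,1) = E (0,0) (0,1)" by simp
  have "E (0,0) (1,0) = E (1,0) (1,0)"
    unfolding E_def using he he[of 1] h0 h1
    by (intro path_cocycle_cong[OF F pathin_linepath[OF D hD]]) (auto simp: in' linepath_def)
  with coh[OF in'(1,3,4)] coh[OF in'(3,3,4)] have 2: "E (0,0) (1,1) = E (1,0) (1,1)" by simp
  have "E (0,0) (0,1) = F p" "E (1,0) (1,1) = F q"
    unfolding E_def by (simp_all add: o_def linepath_def h0 h1)
  with 1 2 show ?thesis by simp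
qed

text \<open>Fixed connecting paths to \<open>x0\<close> complete \<open>p\<close> and
  \<open>q\<close> to loops with the same value. Cancellation is assumed for the values that occur,
  so that one lemma covers sums of complex numbers and products of non-zero ones.\<close>

lemma path_cocycle_same_ends:
  assumes F: "path_cocycle \<X> m F" and con: "path_connected_space \<X>"
    and x0: "x0 \<in> topspace \<X>" and loops: "\<And>l. \<lbrakk>pathin \<X> l; l 0 = x0; l 1 = x0\<rbrakk> \<Longrightarrow> F l = e"
    and cancel: "\<And>a b p q. \<lbrakk>pathin \<X> a; pathin \<X> b; pathin \<X> p; pathin \<X> q;
        m (m (F a) (F p)) (F b) = m (m (F a) (F q)) (F b)\<rbrakk> \<Longrightarrow> F p = F q"
    and p: "pathin \<X> p" and q: "pathin \<X> q" and pq: "p 0 = q 0" "p 1 = q 1"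
  shows "F p = F q"
proof -
  have top: "p 0 \<in> topspace \<X>" "p 1 \<in> topspace \<X>"
    using p by (auto intro: pathin_start pathin_end)
  obtain a where a: "pathin \<X> a" "a 0 = x0" "a 1 = p 0"
    using con x0 top unfolding path_connected_space_def by blast
  obtain b where b: "pathin \<X> b" "b 0 = p 1" "b 1 = x0"
    using con x0 top unfolding path_connected_space_def by blast
  have "m (m (F a) (F r)) (F b) = e" if r: "pathin \<X> r" "r 0 = p 0" "r 1 = p 1" for r
  proof -
    have ar: "pathin \<X> (path_join a r)" "m (F a) (F r) = F (path_join a r)"
      using a r by (auto intro: pathin_path_join path_cocycle_join[OF F])
    have "m (F (path_join a r)) (F b) = F (path_join (path_join a r) b)"
      using ar b r by (auto intro: path_cocycle_join[OF F])
    also have "\<dots> = e"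
      using ar a b r by (intro loops pathin_path_join) auto
    finally show ?thesis using ar by simp
  qed
  then show ?thesis
    using cancel[OF a(1) b(1) p q] p q pq by simp
qed

text \<open>The potential at a point is the value of \<open>F\<close> on a chosen path from
  \<open>x0\<close>. Stating the relation as a product instead of a quotient avoids inverses in the
  target.\<close>

lemma path_cocycle_potential:
  assumes F: "path_cocycle \<X> m F" and con: "path_connected_space \<X>"
    and x0: "x0 \<in> topspace \<X>"
    and same: "\<And>p q. \<lbrakk>pathin \<X> p; pathin \<X> q; p 0 = q 0; p 1 = q 1\<rbrakk> \<Longrightarrow> F p = F q"
  shows "\<exists>b. (\<forall>x\<in>topspace \<X>. pathin \<X> (b x)) \<and>
      (\<forall>p. pathin \<X> p \<longrightarrow> m (F (b (p 0))) (F p) = F (b (p 1)))"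
proof -
  have "\<exists>b. \<forall>x\<in>topspace \<X>. pathin \<X> (b x) \<and> b x 0 = x0 \<and> b x 1 = x"
    by (rule bchoice) (use con x0 in \<open>auto simp: path_connected_space_def\<close>)
  then obtain b where b: "\<And>x. x \<in> topspace \<X> \<Longrightarrow> pathin \<X> (b x) \<and> b x 0 = x0 \<and> b x 1 = x" by auto
  show ?thesis
  proof (intro exI[of _ b] conjI ballI allI impI)
    fix p assume p: "pathin \<X> p"
    then have top: "p 0 \<in> topspace \<X>" "p 1 \<in> topspace \<X>"
      by (auto simp: pathin_def continuous_map_def)
    have "m (F (b (p 0))) (F p) = F (path_join (b (p 0)) p)"
      using p b[OF top(1)] by (auto intro: path_cocycle_join[OF F])
    also have "\<dots> = F (b (p 1))"
      using p b[OF top(1)] b[OF top(2)] by (intro same pathin_path_join) auto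
    finally show "m (F (b (p 0))) (F p) = F (b (p 1))" .
  qed (use b in auto)
qed

text \<open>This dichotomy drives the case distinction for resonance: on a piece, a class either has
  a non-zero period or is a coboundary.\<close>

lemma additive_loop_or_potential:
  fixes F :: "(real \<Rightarrow> 'a) \<Rightarrow> complex"
  assumes F: "path_cocycle \<X> (+) F" and con: "path_connected_space \<X>"
  obtains l where "pathin \<X> l" "l 0 = l 1" "F l \<noteq> 0"
  | f where "\<And>p. pathin \<X> p \<Longrightarrow> F p = f (p 1) - f (p 0)"
proof (cases "\<exists>l. pathin \<X> l \<and> l 0 = l 1 \<and> F l \<noteq> 0")
  case False
  show ?thesis
  proof (cases "topspace \<X> = {}")
    case True
    then show ?thesis by (intro that(2)[of "\<lambda>_. 0"]) (auto dest: pathin_start)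
  next
    case ne: False
    then obtain x0 where x0: "x0 \<in> topspace \<X>" by blast
    have "F p = F q" if "pathin \<X> p" "pathin \<X> q" "p 0 = q 0" "p 1 = q 1" for p q
      by (rule path_cocycle_same_ends[OF F con x0 _ _ that, of 0]) (use False in auto)
    from path_cocycle_potential[OF F con x0 this]
    obtain b where b: "\<And>p. pathin \<X> p \<Longrightarrow> F (b (p 0)) + F p = F (b (p 1))" by blast
    show ?thesis
      by (rule that(2)[of "\<lambda>x. F (b x)"]) (simp add: algebra_simps flip: b)
  qed
qed (use that in blast)

text \<open>Here the loop has to start at the given \<open>x0\<close>: loops from the two pieces are
  later combined into one twisted cycle and need a common base point.\<close>

lemma multiplicative_loop_or_potential:
  fixes T :: "(real \<Rightarrow> 'a) \<Rightarrow> complex"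
  assumes T: "path_cocycle \<X> (*) T" and nz: "\<And>p. pathin \<X> p \<Longrightarrow> T p \<noteq> 0"
    and con: "path_connected_space \<X>" and x0: "x0 \<in> topspace \<X>"
  obtains l where "pathin \<X> l" "l 0 = x0" "l 1 = x0" "T l \<noteq> 1"
  | f where "\<And>x. x \<in> topspace \<X> \<Longrightarrow> f x \<noteq> 0" "\<And>p. pathin \<X> p \<Longrightarrow> f (p 0) * T p = f (p 1)"
proof (cases "\<exists>l. pathin \<X> l \<and> l 0 = x0 \<and> l 1 = x0 \<and> T l \<noteq> 1")
  case False
  have "T p = T q" if "pathin \<X> p" "pathin \<X> q" "p 0 = q 0" "p 1 = q 1" for p q
    by (rule path_cocycle_same_ends[OF T con x0 _ _ that, of 1]) (use False nz in auto)
  from path_cocycle_potential[OF T con x0 this]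
  obtain b where "\<And>x. x \<in> topspace \<X> \<Longrightarrow> pathin \<X> (b x)"
    "\<And>p. pathin \<X> p \<Longrightarrow> T (b (p 0)) * T p = T (b (p 1))" by blast
  then show ?thesis using that(2)[of "\<lambda>x. T (b x)"] nz by blast
qed (use that in blast)

text \<open>Upper unitriangular 3 by 3 matrices: the first two coordinates are the entries next to
  the diagonal, the third is the corner.\<close>

definition heisenberg :: "complex \<times> complex \<times> complex \<Rightarrow> complex \<times> complex \<times> complex \<Rightarrow> complex \<times> complex \<times> complex" where
  "heisenberg x y =
     (fst x + fst y, fst (snd x) + fst (snd y), snd (snd x) + snd (snd y) + fst x * fst (snd y))"

text \<open>The pair \<open>x\<close> stands for the map sending \<open>z\<close> to
  \<open>fst x * z + snd x\<close>, and the product is composition of maps.\<close>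

definition affine_mult :: "complex \<times> complex \<Rightarrow> complex \<times> complex \<Rightarrow> complex \<times> complex" where
  "affine_mult x y = (fst x * fst y, snd x + fst x * snd y)"

lemma semigroup_heisenberg: "semigroup heisenberg"
  by unfold_locales (simp add: heisenberg_def algebra_simps)

lemma semigroup_affine_mult: "semigroup affine_mult"
  by unfold_locales (simp add: affine_mult_def algebra_simps)

lemma edges_pathin:
  assumes "continuous_map (top_of_set tri) \<X> s"
  shows "pathin \<X> (\<lambda>t. s (t, 0))" "pathin \<X> (\<lambda>t. s (1 - t, t))" "pathin \<X> (\<lambda>t. s (0, t))"
proof -
  have *: "pathin \<X> (s \<circ> f)" if "continuous_on {0..1} f" "f ` {0..1} \<subseteq> tri" for f :: "real \<Rightarrow> real \<times> real"
    unfolding pathin_def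
    by (rule continuous_map_compose[OF _ assms]) (use that in auto)
  show "pathin \<X> (\<lambda>t. s (t, 0))" "pathin \<X> (\<lambda>t. s (1 - t, t))" "pathin \<X> (\<lambda>t. s (0, t))"
    by (rule *[unfolded o_def]; auto simp: tri_def intro!: continuous_intros)+
qed

lemma path_cocycle_hom:
  assumes "path_cocycle \<X> m F" and "\<And>x y. f (m x y) = n (f x) (f y)"
  shows "path_cocycle \<X> n (\<lambda>p. f (F p))"
  unfolding path_cocycle_def
proof (intro conjI allI impI; (elim conjE)?)
  fix p q assume "pathin \<X> p" "\<forall>t\<in>{0..1}. p t = q t"
  then have "F p = F q" by (intro path_cocycle_cong[OF assms(1)]) auto
  then show "f (F p) = f (F q)" by simp
next
  fix s assume "continuous_map (top_of_set tri) \<X> s"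
  then have "m (F (\<lambda>t. s (t, 0))) (F (\<lambda>t. s (1 - t, t))) = F (\<lambda>t. s (0, t))"
    using assms(1) unfolding path_cocycle_def by blast
  then show "n (f (F (\<lambda>t. s (t, 0)))) (f (F (\<lambda>t. s (1 - t, t)))) = f (F (\<lambda>t. s (0, t)))"
    by (metis assms(2))
qed

text \<open>The third coordinate obeys C(02) = C(01) + C(12) + A(01) B(12), which says that the
  coboundary of -C is the cup product of A and B.\<close>

definition cup_exact :: "'a topology \<Rightarrow> ((real \<Rightarrow> 'a) \<Rightarrow> complex) \<Rightarrow> ((real \<Rightarrow> 'a) \<Rightarrow> complex) \<Rightarrow> bool" where
  "cup_exact \<X> A B \<longleftrightarrow> (\<exists>C. path_cocycle \<X> heisenberg (\<lambda>p. (A p, B p, C p)))"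

lemma path_cocycle_tri:
  assumes "path_cocycle \<X> m F" "continuous_map (top_of_set tri) \<X> s"
  shows "F (\<lambda>t. s (0, t)) = m (F (\<lambda>t. s (t, 0))) (F (\<lambda>t. s (1 - t, t)))"
  using assms unfolding path_cocycle_def by auto

text \<open>The hypothesis on \<open>C\<close> speaks of arbitrary paths with the end points of a
  triangle, so that explicit formulas in potentials and cocycle values can be checked by algebra
  alone.\<close>

lemma cup_exactI:
  assumes A: "path_cocycle \<X> (+) A" and B: "path_cocycle \<X> (+) B"
    and cong: "\<And>p q. \<lbrakk>pathin \<X> p; \<forall>t\<in>{0..1}. p t = q t; A p = A q; B p = B q\<rbrakk> \<Longrightarrow> C p = C q"
    and C: "\<And>a b c. \<lbrakk>pathin \<X> a; pathin \<X> b; pathin \<X> c; a 1 = b 0; c 0 = a 0; c 1 = b 1;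
       A c = A a + A b; B c = B a + B b\<rbrakk> \<Longrightarrow> C c = C a + C b + A a * B b"
  shows "cup_exact \<X> A B"
  unfolding cup_exact_def
proof (intro exI[of _ C])
  show "path_cocycle \<X> heisenberg (\<lambda>p. (A p, B p, C p))"
    unfolding path_cocycle_def
  proof (intro conjI allI impI; (elim conjE)?)
    fix p q assume *: "pathin \<X> p" "\<forall>t\<in>{0..1}. p t = q t"
    then have "A p = A q" "B p = B q"
      by (auto intro: path_cocycle_cong[OF A] path_cocycle_cong[OF B])
    with cong[OF *] show "(A p, B p, C p) = (A q, B q, C q)" by auto
  next
    fix s assume s: "continuous_map (top_of_set tri) \<X> s"
    have "A (\<lambda>t. s (0, t)) = A (\<lambda>t. s (t, 0)) + A (\<lambda>t. s (1 - t, t))"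
      "B (\<lambda>t. s (0, t)) = B (\<lambda>t. s (t, 0)) + B (\<lambda>t. s (1 - t, t))"
      using path_cocycle_tri[OF A s] path_cocycle_tri[OF B s] .
    with C[of "\<lambda>t. s (t, 0)" "\<lambda>t. s (1 - t, t)" "\<lambda>t. s (0, t)"] edges_pathin[OF s]
    show "heisenberg (A (\<lambda>t. s (t, 0)), B (\<lambda>t. s (t, 0)), C (\<lambda>t. s (t, 0)))
       (A (\<lambda>t. s (1 - t, t)), B (\<lambda>t. s (1 - t, t)), C (\<lambda>t. s (1 - t, t))) =
       (A (\<lambda>t. s (0, t)), B (\<lambda>t. s (0, t)), C (\<lambda>t. s (0, t)))"
      by (simp add: heisenberg_def)
  qed
qed

lemma cup_exactE:
  assumes "cup_exact \<X> A B"
  obtains C where "\<And>p q. \<lbrakk>pathin \<X> p; \<forall>t\<in>{0..1}. p t = q t\<rbrakk> \<Longrightarrow> C p = C q"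
    and "\<And>s. continuous_map (top_of_set tri) \<X> s \<Longrightarrow>
      C (\<lambda>t. s (0, t)) = C (\<lambda>t. s (t, 0)) + C (\<lambda>t. s (1 - t, t)) + A (\<lambda>t. s (t, 0)) * B (\<lambda>t. s (1 - t, t))"
proof -
  obtain C where C: "path_cocycle \<X> heisenberg (\<lambda>p. (A p, B p, C p))"
    using assms unfolding cup_exact_def by blast
  show ?thesis
  proof
    show "C p = C q" if "pathin \<X> p" "\<forall>t\<in>{0..1}. p t = q t" for p q
      using path_cocycle_cong[OF C that(1), of q] that(2) by auto
    show "C (\<lambda>t. s (0, t)) = C (\<lambda>t. s (t, 0)) + C (\<lambda>t. s (1 - t, t)) + A (\<lambda>t. s (t, 0)) * B (\<lambda>t. s (1 - t, t))"
      if "continuous_map (top_of_set tri) \<X> s" for s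
      using path_cocycle_tri[OF C that] by (simp add: heisenberg_def)
  qed
qed

section \<open>Additive cocycles and coboundaries\<close>

lemma path_cocycle_delta: "path_cocycle \<X> (+) (\<lambda>p. f (p 1) - f (p 0) :: complex)"
  by (auto simp: path_cocycle_def)

lemma path_cocycle_add:
  fixes F G :: "(real \<Rightarrow> 'a) \<Rightarrow> complex"
  assumes "path_cocycle \<X> (+) F" "path_cocycle \<X> (+) G"
  shows "path_cocycle \<X> (+) (\<lambda>p. F p + G p)"
  unfolding path_cocycle_def
proof (intro conjI allI impI; (elim conjE)?)
  fix p q assume "pathin \<X> p" "\<forall>t\<in>{0..1}. p t = q t"
  then show "F p + G p = F q + G q"
    using path_cocycle_cong[OF assms(1)] path_cocycle_cong[OF assms(2)] by (metis atLeastAtMost_iff)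
qed (simp add: path_cocycle_tri[OF assms(1)] path_cocycle_tri[OF assms(2)])

lemma path_cocycle_cmult:
  fixes F :: "(real \<Rightarrow> 'a) \<Rightarrow> complex"
  assumes "path_cocycle \<X> (+) F"
  shows "path_cocycle \<X> (+) (\<lambda>p. c * F p)"
  using path_cocycle_hom[OF assms, of "\<lambda>x. c * x" "(+)"] by (simp add: algebra_simps)

lemma path_cocycle_diff_delta:
  fixes F :: "(real \<Rightarrow> 'a) \<Rightarrow> complex"
  assumes "path_cocycle \<X> (+) F"
  shows "path_cocycle \<X> (+) (\<lambda>p. F p - (f (p 1) - f (p 0)))"
  using path_cocycle_add[OF assms path_cocycle_cmult[OF path_cocycle_delta, of \<X> "-1" f]]
  by (simp add: algebra_simps)

text \<open>Values on functions that are not paths in \<open>\<X>\<close> never enter either clause,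
  so they may be changed freely.\<close>

lemma path_cocycle_eq:
  assumes F: "path_cocycle \<X> m F" and eq: "\<And>p. pathin \<X> p \<Longrightarrow> G p = F p"
  shows "path_cocycle \<X> m G"
  unfolding path_cocycle_def
proof (intro conjI allI impI; (elim conjE)?)
  fix p q assume p: "pathin \<X> p" and pq: "\<forall>t\<in>{0..1}. p t = q t"
  then have "pathin \<X> q" unfolding pathin_def
    by (metis continuous_map_eq topspace_euclidean_subtopology)
  then show "G p = G q" using p pq eq path_cocycle_cong[OF F p, of q] by simp
next
  fix s assume s: "continuous_map (top_of_set tri) \<X> s"
  show "m (G (\<lambda>t. s (t, 0))) (G (\<lambda>t. s (1 - t, t))) = G (\<lambda>t. s (0, t))"
    using path_cocycle_tri[OF F s] eq edges_pathin[OF s] by simp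
qed

section \<open>Unions with simply connected intersection\<close>

text \<open>\<open>simply\<close> is simple connectivity of the intersection in the form that
  \<open>path_cocycle_homotopic\<close> consumes. \<open>loopU\<close> and \<open>loopV\<close> are
  what is left of the Betti number hypotheses: a class of each piece with a non-zero period. All
  assumptions are symmetric in the two pieces, so every result may be used with their roles
  exchanged.\<close>

locale two_piece_cover =
  fixes \<X> :: "'a topology" and U V :: "'a set"
  assumes openU: "openin \<X> U" and openV: "openin \<X> V" and cover: "topspace \<X> \<subseteq> U \<union> V"
    and conU: "path_connected_space (subtopology \<X> U)"
    and conV: "path_connected_space (subtopology \<X> V)"
    and conN: "path_connected_space (subtopology \<X> (U \<inter> V))"
    and neN: "U \<inter> V \<noteq> {}"
    and simply: "\<And>p q. \<lbrakk>pathin (subtopology \<X> (U \<inter> V)) p; pathin (subtopology \<X> (U \<inter> V)) q; p 0 = q 0; p 1 = q 1\<rbrakk>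
       \<Longrightarrow> homotopic_with (\<lambda>r. r 0 = p 0 \<and> r 1 = p 1) (top_of_set {0..1}) (subtopology \<X> (U \<inter> V)) p q"
    and loopU: "\<exists>(\<phi> :: _ \<Rightarrow> complex) l. path_cocycle (subtopology \<X> U) (+) \<phi> \<and>
        pathin (subtopology \<X> U) l \<and> l 0 = l 1 \<and> \<phi> l \<noteq> 0"
    and loopV: "\<exists>(\<phi> :: _ \<Rightarrow> complex) l. path_cocycle (subtopology \<X> V) (+) \<phi> \<and>
        pathin (subtopology \<X> V) l \<and> l 0 = l 1 \<and> \<phi> l \<noteq> 0"
begin

lemma swapped: "two_piece_cover \<X> V U"
  using openU openV cover conU conV conN neN simply loopU loopV
  by unfold_locales (simp_all add: Int_commute Un_commute)

lemma topspaceN: "topspace (subtopology \<X> (U \<inter> V)) = U \<inter> V"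
  using openU openV openin_subset by fastforce

lemma restrictU: "path_cocycle \<X> m F \<Longrightarrow> path_cocycle (subtopology \<X> U) m F"
  by (rule path_cocycle_subtopology)

lemma restrictV: "path_cocycle \<X> m F \<Longrightarrow> path_cocycle (subtopology \<X> V) m F"
  by (rule path_cocycle_subtopology)

lemma restrictN: "path_cocycle (subtopology \<X> U) m F \<Longrightarrow> path_cocycle (subtopology \<X> (U \<inter> V)) m F"
  using path_cocycle_subtopology[of "subtopology \<X> U" m F V] by (simp add: subtopology_subtopology)

lemma pathinN: "pathin (subtopology \<X> (U \<inter> V)) p \<longleftrightarrow> pathin \<X> p \<and> p ` {0..1} \<subseteq> U \<and> p ` {0..1} \<subseteq> V"
  by (auto simp: pathin_subtopology)

lemma pathinU: "pathin (subtopology \<X> U) p \<longleftrightarrow> pathin \<X> p \<and> p ` {0..1} \<subseteq> U"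
  by (auto simp: pathin_subtopology)

lemma pathinV: "pathin (subtopology \<X> V) p \<longleftrightarrow> pathin \<X> p \<and> p ` {0..1} \<subseteq> V"
  by (auto simp: pathin_subtopology)

lemma same_endsN:
  assumes "path_cocycle (subtopology \<X> (U \<inter> V)) m F"
    and "pathin (subtopology \<X> (U \<inter> V)) p" "pathin (subtopology \<X> (U \<inter> V)) q" "p 0 = q 0" "p 1 = q 1"
  shows "F p = F q"
  using path_cocycle_homotopic[OF assms(1) simply[OF assms(2-)]] .

lemma additive_potentialN:
  fixes F :: "(real \<Rightarrow> 'a) \<Rightarrow> complex"
  assumes F: "path_cocycle (subtopology \<X> (U \<inter> V)) (+) F"
  obtains f where "\<And>p. pathin (subtopology \<X> (U \<inter> V)) p \<Longrightarrow> F p = f (p 1) - f (p 0)"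
proof -
  obtain n0 where n0: "n0 \<in> topspace (subtopology \<X> (U \<inter> V))" using neN topspaceN by blast
  from path_cocycle_potential[OF F conN n0 same_endsN[OF F]]
  obtain b where b: "\<And>p. pathin (subtopology \<X> (U \<inter> V)) p \<Longrightarrow> F (b (p 0)) + F p = F (b (p 1))" by blast
  show ?thesis
    by (rule that[of "\<lambda>x. F (b x)"]) (simp add: algebra_simps flip: b)
qed

lemma multiplicative_potentialN:
  fixes T :: "(real \<Rightarrow> 'a) \<Rightarrow> complex"
  assumes T: "path_cocycle (subtopology \<X> (U \<inter> V)) (*) T"
    and nz: "\<And>p. pathin (subtopology \<X> (U \<inter> V)) p \<Longrightarrow> T p \<noteq> 0"
  obtains f where "\<And>x. x \<in> U \<inter> V \<Longrightarrow> f x \<noteq> 0"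
    and "\<And>p. pathin (subtopology \<X> (U \<inter> V)) p \<Longrightarrow> f (p 0) * T p = f (p 1)"
proof -
  obtain n0 where n0: "n0 \<in> topspace (subtopology \<X> (U \<inter> V))" using neN topspaceN by blast
  from path_cocycle_potential[OF T conN n0 same_endsN[OF T]]
  obtain b where "\<And>x. x \<in> topspace (subtopology \<X> (U \<inter> V)) \<Longrightarrow> pathin (subtopology \<X> (U \<inter> V)) (b x)"
    "\<And>p. pathin (subtopology \<X> (U \<inter> V)) p \<Longrightarrow> T (b (p 0)) * T p = T (b (p 1))" by blast
  then show ?thesis using that[of "\<lambda>x. T (b x)"] nz topspaceN by metis
qed

text \<open>On the intersection the class is the coboundary of some \<open>f\<close>. Subtracting
  this coboundary makes it vanish there, so it can be glued to zero, while periods over loops in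
  \<open>U\<close> do not change.\<close>

lemma extend_from_U:
  fixes \<phi> :: "(real \<Rightarrow> 'a) \<Rightarrow> complex"
  assumes \<phi>: "path_cocycle (subtopology \<X> U) (+) \<phi>"
  obtains B f where "path_cocycle \<X> (+) B"
    and "\<And>p. pathin (subtopology \<X> U) p \<Longrightarrow> B p = \<phi> p - (f (p 1) - f (p 0))"
    and "\<And>p. pathin (subtopology \<X> V) p \<Longrightarrow> B p = 0"
proof -
  obtain f where f: "\<And>p. pathin (subtopology \<X> (U \<inter> V)) p \<Longrightarrow> \<phi> p = f (p 1) - f (p 0)"
    using additive_potentialN[OF restrictN[OF \<phi>]] by blast
  obtain B where "path_cocycle \<X> (+) B"
    "\<And>p. \<lbrakk>pathin \<X> p; p ` {0..1} \<subseteq> U\<rbrakk> \<Longrightarrow> B p = \<phi> p - (f (p 1) - f (p 0))"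
    "\<And>p. \<lbrakk>pathin \<X> p; p ` {0..1} \<subseteq> V\<rbrakk> \<Longrightarrow> B p = 0"
  proof (rule path_cocycle_glue[OF add.semigroup_axioms path_cocycle_diff_delta[OF \<phi>, of f] _ openU openV cover])
    show "path_cocycle (subtopology \<X> V) (+) (\<lambda>p. 0::complex)" by (auto simp: path_cocycle_def)
  qed (use f pathinN in auto)
  then show ?thesis using that[of B f] pathinU pathinV by auto
qed

text \<open>Two lifts of the same pair \<open>A\<close>, \<open>B\<close> differ by an additive
  cocycle in the central coordinate. On the intersection that cocycle has a potential, and
  correcting one lift by its coboundary preserves the Heisenberg law because only the centre is
  touched.\<close>

lemma cup_exact_glue:
  assumes A: "path_cocycle \<X> (+) A" and B: "path_cocycle \<X> (+) B"
    and CU: "cup_exact (subtopology \<X> U) A B" and CV: "cup_exact (subtopology \<X> V) A B"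
  shows "cup_exact \<X> A B"
proof -
  obtain C1 where C1: "path_cocycle (subtopology \<X> U) heisenberg (\<lambda>p. (A p, B p, C1 p))"
    using CU unfolding cup_exact_def by blast
  obtain C2 where C2: "path_cocycle (subtopology \<X> V) heisenberg (\<lambda>p. (A p, B p, C2 p))"
    using CV unfolding cup_exact_def by blast
  interpret sw: two_piece_cover \<X> V U by (rule swapped)
  have N1: "path_cocycle (subtopology \<X> (U \<inter> V)) heisenberg (\<lambda>p. (A p, B p, C1 p))"
    by (rule restrictN[OF C1])
  have N2: "path_cocycle (subtopology \<X> (U \<inter> V)) heisenberg (\<lambda>p. (A p, B p, C2 p))"
    using sw.restrictN[OF C2] by (simp add: Int_commute)
  have "path_cocycle (subtopology \<X> (U \<inter> V)) (+) (\<lambda>p. C1 p - C2 p)"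
    unfolding path_cocycle_def
  proof (intro conjI allI impI; (elim conjE)?)
    fix p q assume *: "pathin (subtopology \<X> (U \<inter> V)) p" "\<forall>t\<in>{0..1}. p t = q t"
    then show "C1 p - C2 p = C1 q - C2 q"
      using path_cocycle_cong[OF N1 *(1), of q] path_cocycle_cong[OF N2 *(1), of q] by auto
  next
    fix s assume s: "continuous_map (top_of_set tri) (subtopology \<X> (U \<inter> V)) s"
    show "C1 (\<lambda>t. s (t, 0)) - C2 (\<lambda>t. s (t, 0)) + (C1 (\<lambda>t. s (1 - t, t)) - C2 (\<lambda>t. s (1 - t, t))) =
       C1 (\<lambda>t. s (0, t)) - C2 (\<lambda>t. s (0, t))"
      using path_cocycle_tri[OF N1 s] path_cocycle_tri[OF N2 s] by (simp add: heisenberg_def)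
  qed
  then obtain f where f: "\<And>p. pathin (subtopology \<X> (U \<inter> V)) p \<Longrightarrow> C1 p - C2 p = f (p 1) - f (p 0)"
    using additive_potentialN by blast
  define C1' where "C1' p = C1 p - (f (p 1) - f (p 0))" for p
  have C1': "path_cocycle (subtopology \<X> U) heisenberg (\<lambda>p. (A p, B p, C1' p))"
    unfolding path_cocycle_def
  proof (intro conjI allI impI; (elim conjE)?)
    fix p q assume *: "pathin (subtopology \<X> U) p" "\<forall>t\<in>{0..1}. p t = q t"
    then show "(A p, B p, C1' p) = (A q, B q, C1' q)"
      using path_cocycle_cong[OF C1 *(1), of q] by (auto simp: C1'_def)
  next
    fix s assume s: "continuous_map (top_of_set tri) (subtopology \<X> U) s"
    show "heisenberg (A (\<lambda>t. s (t, 0)), B (\<lambda>t. s (t, 0)), C1' (\<lambda>t. s (t, 0)))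
       (A (\<lambda>t. s (1 - t, t)), B (\<lambda>t. s (1 - t, t)), C1' (\<lambda>t. s (1 - t, t))) =
       (A (\<lambda>t. s (0, t)), B (\<lambda>t. s (0, t)), C1' (\<lambda>t. s (0, t)))"
      using path_cocycle_tri[OF C1 s] by (simp add: heisenberg_def C1'_def)
  qed
  obtain H where H: "path_cocycle \<X> heisenberg H"
    and HU: "\<And>p. \<lbrakk>pathin \<X> p; p ` {0..1} \<subseteq> U\<rbrakk> \<Longrightarrow> H p = (A p, B p, C1' p)"
    and HV: "\<And>p. \<lbrakk>pathin \<X> p; p ` {0..1} \<subseteq> V\<rbrakk> \<Longrightarrow> H p = (A p, B p, C2 p)"
  proof (rule path_cocycle_glue[OF semigroup_heisenberg C1' C2 openU openV cover])
    fix p assume "pathin \<X> p" "p ` {0..1} \<subseteq> U" "p ` {0..1} \<subseteq> V"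
    then have "C1' p = C2 p" using f[of p] by (auto simp: C1'_def pathinN algebra_simps)
    then show "(A p, B p, C1' p) = (A p, B p, C2 p)" by simp
  qed auto
  \<comment> \<open>Gluing gives the first two coordinates only on paths inside one piece;
    uniqueness identifies them with \<open>A\<close> and \<open>B\<close> on all paths.\<close>
  have HA: "path_cocycle \<X> (+) (\<lambda>p. fst (H p))"
    by (rule path_cocycle_hom[OF H]) (simp add: heisenberg_def)
  have HB: "path_cocycle \<X> (+) (\<lambda>p. fst (snd (H p)))"
    by (rule path_cocycle_hom[OF H]) (simp add: heisenberg_def)
  have A': "fst (H p) = A p" if "pathin \<X> p" for p
    by (rule path_cocycle_unique[OF HA A openU openV cover _ that]) (use HU HV in auto)
  have B': "fst (snd (H p)) = B p" if "pathin \<X> p" for p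
    by (rule path_cocycle_unique[OF HB B openU openV cover _ that]) (use HU HV in auto)
  have "H p = (A p, B p, snd (snd (H p)))" if "pathin \<X> p" for p
    using A'[OF that] B'[OF that] by (simp add: prod_eq_iff)
  then show ?thesis
    unfolding cup_exact_def
    by (intro exI[of _ "\<lambda>p. snd (snd (H p))"] path_cocycle_eq[OF H]) simp
qed

text \<open>A class of \<open>U\<close> extended by zero does the job. Over \<open>V\<close> the
  product is zero; over \<open>U\<close>, where \<open>A\<close> is the coboundary of
  \<open>f\<close>, it is the coboundary of \<open>f\<close> times \<open>B\<close>. The loop
  \<open>l\<close> rules out multiples of \<open>A\<close>: there \<open>A\<close> vanishes while
  \<open>B\<close> keeps the period of \<open>\<phi>\<close>.\<close>

lemma resonance_partner_if_exact_on_U: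
  assumes A: "path_cocycle \<X> (+) A"
    and f: "\<And>p. pathin (subtopology \<X> U) p \<Longrightarrow> A p = f (p 1) - f (p 0)"
  shows "\<exists>B. path_cocycle \<X> (+) B \<and> cup_exact \<X> A B \<and>
    (\<forall>c f. \<exists>p. pathin \<X> p \<and> B p \<noteq> c * A p + (f (p 1) - f (p 0)))"
proof -
  obtain \<phi> :: "(real \<Rightarrow> 'a) \<Rightarrow> complex" and l where \<phi>: "path_cocycle (subtopology \<X> U) (+) \<phi>"
    and l: "pathin (subtopology \<X> U) l" "l 0 = l 1" "\<phi> l \<noteq> 0"
    using loopU by blast
  obtain B g where B: "path_cocycle \<X> (+) B"
    and BU: "\<And>p. pathin (subtopology \<X> U) p \<Longrightarrow> B p = \<phi> p - (g (p 1) - g (p 0))"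
    and BV: "\<And>p. pathin (subtopology \<X> V) p \<Longrightarrow> B p = 0"
    using extend_from_U[OF \<phi>] by blast
  have "cup_exact (subtopology \<X> U) A B"
  proof (rule cup_exactI[OF restrictU[OF A] restrictU[OF B], of "\<lambda>p. - (f (p 0) * B p)"])
    show "- (f (c 0) * B c) = - (f (a 0) * B a) + - (f (b 0) * B b) + A a * B b"
      if "pathin (subtopology \<X> U) a" "a 1 = b 0" "c 0 = a 0" "B c = B a + B b" for a b c
    proof -
      have "A a = f (b 0) - f (a 0)" using f[OF that(1)] that(2) by simp
      with that show ?thesis by (simp add: ring_distribs)
    qed
  qed auto
  moreover have "cup_exact (subtopology \<X> V) A B"
    by (rule cup_exactI[OF restrictV[OF A] restrictV[OF B], of "\<lambda>p. 0"]) (auto simp: BV)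
  ultimately have "cup_exact \<X> A B" by (rule cup_exact_glue[OF A B])
  moreover have "B l \<noteq> c * A l + (h (l 1) - h (l 0))" for c h
    using BU[OF l(1)] f[OF l(1)] l by simp
  moreover have "pathin \<X> l" using l(1) pathinU by blast
  ultimately show ?thesis using B by blast
qed

text \<open>The last clause says that the class of \<open>B\<close> is no multiple of the class of
  \<open>A\<close>, that is, not in the image of the differential from degree zero.\<close>

theorem resonance_partner:
  assumes A: "path_cocycle \<X> (+) A"
  shows "\<exists>B. path_cocycle \<X> (+) B \<and> cup_exact \<X> A B \<and>
    (\<forall>c f. \<exists>p. pathin \<X> p \<and> B p \<noteq> c * A p + (f (p 1) - f (p 0)))"
proof -
  interpret sw: two_piece_cover \<X> V U by (rule swapped)
  show ?thesis
  proof (rule additive_loop_or_potential[OF restrictU[OF A] conU])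
    fix f assume "\<And>p. pathin (subtopology \<X> U) p \<Longrightarrow> A p = f (p 1) - f (p 0)"
    then show ?thesis by (rule resonance_partner_if_exact_on_U[OF A])
  next
    fix l assume l: "pathin (subtopology \<X> U) l" "l 0 = l 1" "A l \<noteq> 0"
    show ?thesis
    proof (rule additive_loop_or_potential[OF restrictV[OF A] conV])
      fix f assume "\<And>p. pathin (subtopology \<X> V) p \<Longrightarrow> A p = f (p 1) - f (p 0)"
      then show ?thesis by (rule sw.resonance_partner_if_exact_on_U[OF A])
    next
      fix k assume k: "pathin (subtopology \<X> V) k" "k 0 = k 1" "A k \<noteq> 0"
      obtain B f where B: "path_cocycle \<X> (+) B"
        and BU: "\<And>p. pathin (subtopology \<X> U) p \<Longrightarrow> B p = A p - (f (p 1) - f (p 0))"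
        and BV: "\<And>p. pathin (subtopology \<X> V) p \<Longrightarrow> B p = 0"
        using extend_from_U[OF restrictU[OF A]] by blast
      \<comment> \<open>On \<open>U\<close> the cocycle \<open>B\<close> is \<open>A\<close> minus
        the coboundary of \<open>f\<close>. The term \<open>(A p)\<^sup>2 / 2\<close> accounts for
        the product of \<open>A\<close> with itself, the term \<open>A p * f (p 1)\<close> for its
        product with the coboundary.\<close>
      have "cup_exact (subtopology \<X> U) A B"
      proof (rule cup_exactI[OF restrictU[OF A] restrictU[OF B], of "\<lambda>p. (A p)\<^sup>2 / 2 - A p * f (p 1)"])
        show "(A c)\<^sup>2 / 2 - A c * f (c 1) = ((A a)\<^sup>2 / 2 - A a * f (a 1)) + ((A b)\<^sup>2 / 2 - A b * f (b 1)) + A a * B b"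
          if "pathin (subtopology \<X> U) b" "a 1 = b 0" "c 1 = b 1" "A c = A a + A b" for a b c
        proof -
          have Bb: "B b = A b - (f (c 1) - f (a 1))" using BU[OF that(1)] that(2,3) by simp
          show ?thesis
            unfolding Bb that(4) that(3)[symmetric] by (simp add: field_simps power2_eq_square)
        qed
      qed auto
      moreover have "cup_exact (subtopology \<X> V) A B"
        by (rule cup_exactI[OF restrictV[OF A] restrictV[OF B], of "\<lambda>p. 0"]) (auto simp: BV)
      ultimately have "cup_exact \<X> A B" by (rule cup_exact_glue[OF A B])
      \<comment> \<open>On the loop \<open>k\<close> the cocycle \<open>B\<close> vanishes but
        \<open>A\<close> does not, which excludes every \<open>c\<close> other than 0; the value 0
        is excluded by the loop \<open>l\<close>.\<close>
      moreover have "\<exists>p. pathin \<X> p \<and> B p \<noteq> c * A p + (h (p 1) - h (p 0))" for c h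
      proof (cases "c = 0")
        case True
        then have "B l \<noteq> c * A l + (h (l 1) - h (l 0))" using BU[OF l(1)] l by simp
        then show ?thesis using l(1) pathinU by blast
      next
        case False
        then have "B k \<noteq> c * A k + (h (k 1) - h (k 0))" using BV[OF k(1)] k by simp
        then show ?thesis using k(1) pathinV by blast
      qed
      ultimately show ?thesis using B by blast
    qed
  qed
qed

text \<open>Zero is a twisted cocycle on \<open>V\<close> for every linear part, so the pairs
  \<open>(T p, 0)\<close> can be used there. After gluing, uniqueness recovers \<open>T\<close> as
  the linear part on all paths.\<close>

lemma affine_extend_from_U:
  assumes T: "path_cocycle \<X> (*) T"
    and \<psi>: "path_cocycle (subtopology \<X> U) affine_mult (\<lambda>p. (T p, \<psi> p))"
    and N: "\<And>p. pathin (subtopology \<X> (U \<inter> V)) p \<Longrightarrow> \<psi> p = 0"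
  obtains \<psi>' where "path_cocycle \<X> affine_mult (\<lambda>p. (T p, \<psi>' p))"
    and "\<And>p. pathin (subtopology \<X> U) p \<Longrightarrow> \<psi>' p = \<psi> p"
    and "\<And>p. pathin (subtopology \<X> V) p \<Longrightarrow> \<psi>' p = 0"
proof -
  have V: "path_cocycle (subtopology \<X> V) affine_mult (\<lambda>p. (T p, 0))"
    by (rule path_cocycle_hom[OF restrictV[OF T], of "\<lambda>x. (x, 0)"]) (simp add: affine_mult_def)
  obtain H where H: "path_cocycle \<X> affine_mult H"
    and HU: "\<And>p. \<lbrakk>pathin \<X> p; p ` {0..1} \<subseteq> U\<rbrakk> \<Longrightarrow> H p = (T p, \<psi> p)"
    and HV: "\<And>p. \<lbrakk>pathin \<X> p; p ` {0..1} \<subseteq> V\<rbrakk> \<Longrightarrow> H p = (T p, 0)"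
    by (rule path_cocycle_glue[OF semigroup_affine_mult \<psi> V openU openV cover]) (use N pathinN in auto)
  have HT: "path_cocycle \<X> (*) (\<lambda>p. fst (H p))"
    by (rule path_cocycle_hom[OF H]) (simp add: affine_mult_def)
  have "fst (H p) = T p" if "pathin \<X> p" for p
    by (rule path_cocycle_unique[OF HT T openU openV cover _ that]) (use HU HV in auto)
  then have "path_cocycle \<X> affine_mult (\<lambda>p. (T p, snd (H p)))"
    by (intro path_cocycle_eq[OF H]) (simp add: prod_eq_iff)
  then show ?thesis
    by (rule that) (use HU HV pathinU pathinV in auto)
qed

text \<open>For loops at a common base point the twisted boundary of \<open>c\<close> times
  \<open>l\<close> plus \<open>d\<close> times \<open>k\<close> is
  \<open>c * (T l - 1) + d * (T k - 1)\<close> times that point. The equation thus describes a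
  twisted cycle, and the inequality says that \<open>\<psi>\<close> does not vanish on it.\<close>

definition detects_class :: "((real \<Rightarrow> 'a) \<Rightarrow> complex) \<Rightarrow> ((real \<Rightarrow> 'a) \<Rightarrow> complex) \<Rightarrow> bool" where
  "detects_class T \<psi> \<longleftrightarrow> (\<exists>l k c d. pathin \<X> l \<and> pathin \<X> k \<and> l 1 = l 0 \<and> k 0 = l 0 \<and> k 1 = l 0 \<and>
     c * (T l - 1) + d * (T k - 1) = 0 \<and> c * \<psi> l + d * \<psi> k \<noteq> 0)"

text \<open>The function \<open>f\<close> trivialises the local system on \<open>U\<close>, so
  twisted cocycles there correspond to additive ones; division by \<open>f (p 0)\<close> moves the
  value to the stalk over the start of the path. Since \<open>T l = 1\<close>, the loop
  \<open>l\<close> is a twisted cycle by itself.\<close>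

lemma affine_class_if_potential_on_U:
  assumes T: "path_cocycle \<X> (*) T"
    and f0: "\<And>x. x \<in> U \<Longrightarrow> f x \<noteq> 0"
    and f: "\<And>p. pathin (subtopology \<X> U) p \<Longrightarrow> f (p 0) * T p = f (p 1)"
  shows "\<exists>\<psi>. path_cocycle \<X> affine_mult (\<lambda>p. (T p, \<psi> p)) \<and> detects_class T \<psi>"
proof -
  obtain \<phi> :: "(real \<Rightarrow> 'a) \<Rightarrow> complex" and l where \<phi>: "path_cocycle (subtopology \<X> U) (+) \<phi>"
    and l: "pathin (subtopology \<X> U) l" "l 0 = l 1" "\<phi> l \<noteq> 0"
    using loopU by blast
  obtain B g where B: "path_cocycle \<X> (+) B"
    and BU: "\<And>p. pathin (subtopology \<X> U) p \<Longrightarrow> B p = \<phi> p - (g (p 1) - g (p 0))"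
    and BV: "\<And>p. pathin (subtopology \<X> V) p \<Longrightarrow> B p = 0"
    using extend_from_U[OF \<phi>] by blast
  have pU: "p 0 \<in> U" "p 1 \<in> U" if "pathin (subtopology \<X> U) p" for p
    using that by (auto simp: pathinU)
  have TU: "T p = f (p 1) / f (p 0)" if "pathin (subtopology \<X> U) p" for p
    using f[OF that] f0[OF pU(1)[OF that]] by (simp add: field_simps)
  have "path_cocycle (subtopology \<X> U) affine_mult (\<lambda>p. (T p, B p / f (p 0)))"
    unfolding path_cocycle_def
  proof (intro conjI allI impI; (elim conjE)?)
    fix p q assume *: "pathin (subtopology \<X> U) p" "\<forall>t\<in>{0..1}. p t = q t"
    then show "(T p, B p / f (p 0)) = (T q, B q / f (q 0))"
      using path_cocycle_cong[OF restrictU[OF T] *(1), of q] path_cocycle_cong[OF restrictU[OF B] *(1), of q]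
      by auto
  next
    fix s assume s: "continuous_map (top_of_set tri) (subtopology \<X> U) s"
    note e = edges_pathin[OF s]
    show "affine_mult (T (\<lambda>t. s (t, 0)), B (\<lambda>t. s (t, 0)) / f (s (0, 0)))
       (T (\<lambda>t. s (1 - t, t)), B (\<lambda>t. s (1 - t, t)) / f (s (1 - 0, 0))) =
       (T (\<lambda>t. s (0, t)), B (\<lambda>t. s (0, t)) / f (s (0, 0)))"
      using path_cocycle_tri[OF restrictU[OF T] s] path_cocycle_tri[OF restrictU[OF B] s]
        TU[OF e(1)] f0[OF pU(1)[OF e(1)]] f0[OF pU(2)[OF e(1)]]
      by (simp add: affine_mult_def add_divide_distrib)
  qed
  then obtain \<psi> where \<psi>: "path_cocycle \<X> affine_mult (\<lambda>p. (T p, \<psi> p))"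
    and \<psi>U: "\<And>p. pathin (subtopology \<X> U) p \<Longrightarrow> \<psi> p = B p / f (p 0)"
    by (rule affine_extend_from_U[OF T]) (use BV pathinV pathinN in auto)
  have "\<psi> l \<noteq> 0" using \<psi>U[OF l(1)] BU[OF l(1)] l f0 pU[OF l(1)] by auto
  moreover have "T l = 1" using TU[OF l(1)] l(2) f0 pU[OF l(1)] by auto
  ultimately have "detects_class T \<psi>"
    unfolding detects_class_def using l pathinU
    by (intro exI[of _ l] exI[of _ 1] exI[of _ 0]) auto
  with \<psi> show ?thesis by blast
qed

theorem affine_class:
  assumes T: "path_cocycle \<X> (*) T" and nz: "\<And>p. pathin \<X> p \<Longrightarrow> T p \<noteq> 0"
  shows "\<exists>\<psi>. path_cocycle \<X> affine_mult (\<lambda>p. (T p, \<psi> p)) \<and> detects_class T \<psi>"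
proof -
  interpret sw: two_piece_cover \<X> V U by (rule swapped)
  have topU: "topspace (subtopology \<X> U) = U" "topspace (subtopology \<X> V) = V"
    using openU openV openin_subset by fastforce+
  obtain n0 where n0: "n0 \<in> U" "n0 \<in> V" using neN by blast
  show ?thesis
  proof (rule multiplicative_loop_or_potential[OF restrictU[OF T] _ conU, unfolded topU, OF _ n0(1)])
    show "T p \<noteq> 0" if "pathin (subtopology \<X> U) p" for p using nz that pathinU by blast
    fix f assume "\<And>x. x \<in> U \<Longrightarrow> f x \<noteq> 0" "\<And>p. pathin (subtopology \<X> U) p \<Longrightarrow> f (p 0) * T p = f (p 1)"
    then show ?thesis by (rule affine_class_if_potential_on_U[OF T])
  next
    fix l assume l: "pathin (subtopology \<X> U) l" "l 0 = n0" "l 1 = n0" "T l \<noteq> 1"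
    show ?thesis
    proof (rule multiplicative_loop_or_potential[OF restrictV[OF T] _ conV, unfolded topU, OF _ n0(2)])
      show "T p \<noteq> 0" if "pathin (subtopology \<X> V) p" for p using nz that pathinV by blast
      fix f assume "\<And>x. x \<in> V \<Longrightarrow> f x \<noteq> 0" "\<And>p. pathin (subtopology \<X> V) p \<Longrightarrow> f (p 0) * T p = f (p 1)"
      then show ?thesis
        using sw.affine_class_if_potential_on_U[OF T]
        unfolding detects_class_def sw.detects_class_def by blast
    next
      fix k assume k: "pathin (subtopology \<X> V) k" "k 0 = n0" "k 1 = n0" "T k \<noteq> 1"
      obtain f where f0: "\<And>x. x \<in> U \<inter> V \<Longrightarrow> f x \<noteq> 0"
        and f: "\<And>p. pathin (subtopology \<X> (U \<inter> V)) p \<Longrightarrow> f (p 0) * T p = f (p 1)"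
        using multiplicative_potentialN[OF restrictN[OF restrictU[OF T]]] nz pathinN by blast
      \<comment> \<open>This is the twisted coboundary of the 0-cochain \<open>1 / f\<close>. It
        satisfies the affine law for any function \<open>f\<close>, also outside the intersection
        where \<open>f\<close> is arbitrary, and the relation between \<open>f\<close> and
        \<open>T\<close> makes it vanish on the intersection.\<close>
      have "path_cocycle (subtopology \<X> U) affine_mult (\<lambda>p. (T p, T p / f (p 1) - 1 / f (p 0)))"
        unfolding path_cocycle_def
      proof (intro conjI allI impI; (elim conjE)?)
        fix p q assume *: "pathin (subtopology \<X> U) p" "\<forall>t\<in>{0..1}. p t = q t"
        then show "(T p, T p / f (p 1) - 1 / f (p 0)) = (T q, T q / f (q 1) - 1 / f (q 0))"
          using path_cocycle_cong[OF restrictU[OF T] *(1), of q] by auto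
      next
        fix s assume s: "continuous_map (top_of_set tri) (subtopology \<X> U) s"
        show "affine_mult (T (\<lambda>t. s (t, 0)), T (\<lambda>t. s (t, 0)) / f (s (1, 0)) - 1 / f (s (0, 0)))
           (T (\<lambda>t. s (1 - t, t)), T (\<lambda>t. s (1 - t, t)) / f (s (1 - 1, 1)) - 1 / f (s (1 - 0, 0))) =
           (T (\<lambda>t. s (0, t)), T (\<lambda>t. s (0, t)) / f (s (0, 1)) - 1 / f (s (0, 0)))"
          using path_cocycle_tri[OF restrictU[OF T] s] by (simp add: affine_mult_def algebra_simps)
      qed
      then obtain \<psi> where \<psi>: "path_cocycle \<X> affine_mult (\<lambda>p. (T p, \<psi> p))"
        and \<psi>U: "\<And>p. pathin (subtopology \<X> U) p \<Longrightarrow> \<psi> p = T p / f (p 1) - 1 / f (p 0)"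
        and \<psi>V: "\<And>p. pathin (subtopology \<X> V) p \<Longrightarrow> \<psi> p = 0"
      proof (rule affine_extend_from_U[OF T])
        fix p assume p: "pathin (subtopology \<X> (U \<inter> V)) p"
        then have "f (p 0) \<noteq> 0" "f (p 1) \<noteq> 0" by (auto intro!: f0 simp: pathin_subtopology)
        with f[OF p] show "T p / f (p 1) - 1 / f (p 0) = 0" by (auto simp: field_simps)
      qed auto
      have "f n0 \<noteq> 0" using f0 n0 by blast
      moreover have "\<psi> l = (T l - 1) / f n0" "\<psi> k = 0"
        using \<psi>U[OF l(1)] l \<psi>V[OF k(1)] by (simp_all add: diff_divide_distrib)
      \<comment> \<open>The left-hand side is \<open>(T k - 1) * (T l - 1) / f n0\<close>.\<close>
      ultimately have "(T k - 1) * \<psi> l + (1 - T l) * \<psi> k \<noteq> 0"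
        using l(4) k(4) by simp
      moreover have "(T k - 1) * (T l - 1) + (1 - T l) * (T k - 1) = 0"
        by (simp add: algebra_simps)
      ultimately have "detects_class T \<psi>"
        unfolding detects_class_def using l(1-3) k(1-3) pathinU pathinV by blast
      with \<psi> show ?thesis by blast
    qed
  qed
qed

end

section \<open>Subquotients of complex vector spaces\<close>

lemma complex_field_simps [simp]:
  "carrier complex_field = UNIV" "x \<oplus>\<^bsub>complex_field\<^esub> y = x + y" "x \<otimes>\<^bsub>complex_field\<^esub> y = x * y"
  "\<zero>\<^bsub>complex_field\<^esub> = 0" "\<one>\<^bsub>complex_field\<^esub> = 1"
  by (simp_all add: ring_of_type_algebra_def)

lemma cring_complex_field: "cring complex_field"
  by (rule cring_from_type_algebra)

lemma vdim_ge_1: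
  assumes Q: "module complex_field Q" and x: "x \<in> carrier Q" "x \<noteq> \<zero>\<^bsub>Q\<^esub>"
  shows "vdim Q \<ge> enat 1"
proof -
  interpret module complex_field Q by fact
  have "\<not> lin_dep {x}"
  proof
    assume "lin_dep {x}"
    then obtain A a v where A: "A \<subseteq> {x}" "lincomb a A = \<zero>\<^bsub>Q\<^esub>" "v \<in> A" "a v \<noteq> 0"
      unfolding lin_dep_def by auto
    then have eq: "A = {x}" "v = x" by auto
    with A(2) have "a x \<odot>\<^bsub>Q\<^esub> x = \<zero>\<^bsub>Q\<^esub>"
      using x(1) by (simp add: lincomb_def)
    then have "inverse (a x) \<odot>\<^bsub>Q\<^esub> (a x \<odot>\<^bsub>Q\<^esub> x) = \<zero>\<^bsub>Q\<^esub>"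
      by simp
    then have "(inverse (a x) * a x) \<odot>\<^bsub>Q\<^esub> x = \<zero>\<^bsub>Q\<^esub>"
      using smult_assoc1[of "inverse (a x)" "a x" x] x(1) by simp
    then show False using A(4) eq x smult_one[OF x(1)] by simp
  qed
  then have "enat (card {x}) \<in> {enat (card S) | S. finite S \<and> S \<subseteq> carrier Q \<and> \<not> lin_dep S}"
    using x(1) by blast
  then show ?thesis unfolding vdim_def by (auto intro: Sup_upper)
qed

definition linear_subspace :: "(complex, 'v, 'z) module_scheme \<Rightarrow> 'v set \<Rightarrow> bool" where
  "linear_subspace V Z \<longleftrightarrow> Z \<subseteq> carrier V \<and> \<zero>\<^bsub>V\<^esub> \<in> Z \<and>
     (\<forall>x\<in>Z. \<forall>y\<in>Z. x \<oplus>\<^bsub>V\<^esub> y \<in> Z) \<and> (\<forall>c. \<forall>x\<in>Z. c \<odot>\<^bsub>V\<^esub> x \<in> Z)"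

text \<open>Local homology, cohomology and resonance cohomology are all subquotients of this shape.
  The last one is a subquotient of a subquotient, which is why the construction has to be shown to
  be a module again.\<close>

locale subquotient_space = module complex_field V for V :: "(complex, 'v) module" (structure) +
  fixes Z B :: "'v set"
  assumes Z: "linear_subspace V Z" and B: "linear_subspace V B" and BZ: "B \<subseteq> Z"
begin

lemma Zin: "Z \<subseteq> carrier V" "\<zero> \<in> Z" "x \<in> Z \<Longrightarrow> y \<in> Z \<Longrightarrow> x \<oplus> y \<in> Z" "x \<in> Z \<Longrightarrow> c \<odot> x \<in> Z"
  using Z unfolding linear_subspace_def by auto

lemma Bin: "B \<subseteq> carrier V" "\<zero> \<in> B" "x \<in> B \<Longrightarrow> y \<in> B \<Longrightarrow> x \<oplus> y \<in> B" "x \<in> B \<Longrightarrow> c \<odot> x \<in> B"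
  using B unfolding linear_subspace_def by auto

lemma uminus_smult: "x \<in> carrier V \<Longrightarrow> \<ominus> x = (-1) \<odot> x"
proof -
  assume x: "x \<in> carrier V"
  have "(-1) \<odot> x \<oplus> x = (-1) \<odot> x \<oplus> 1 \<odot> x"
    using smult_one[OF x] by simp
  also have "\<dots> = (-1 + 1) \<odot> x"
    using smult_l_distr[of "-1" 1 x] x by simp
  also have "\<dots> = \<zero>"
    using smult_l_null[OF x] by simp
  finally show ?thesis using x by (metis UNIV_I complex_field_simps(1) minus_equality smult_closed)
qed

lemma coset_eq: "B +> x = {b \<oplus> x | b. b \<in> B}"
  by (auto simp: a_r_coset_def')

lemma coset_absorb:
  assumes "b \<in> B" "x \<in> carrier V"
  shows "B +> (b \<oplus> x) = B +> x"
proof -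
  have b: "b \<in> carrier V" "\<ominus> b \<in> B" using assms Bin by (auto simp: uminus_smult)
  have "b' \<oplus> (b \<oplus> x) \<in> B +> x" if "b' \<in> B" for b'
    unfolding coset_eq using that assms Bin b
    by (intro CollectI exI[of _ "b' \<oplus> b"]) (auto simp: a_assoc subset_iff)
  moreover have "b' \<oplus> x \<in> B +> (b \<oplus> x)" if "b' \<in> B" for b'
  proof -
    have "b' \<oplus> x = (b' \<oplus> \<ominus> b) \<oplus> (b \<oplus> x)"
      using that assms Bin b by (auto simp: a_assoc subset_iff l_neg r_neg1)
    then show ?thesis unfolding coset_eq using that Bin(3)[OF that b(2)] by blast
  qed
  ultimately show ?thesis unfolding coset_eq by blast
qed

lemma coset_zero: "B +> \<zero> = B"
proof -
  have "b \<oplus> \<zero> = b" if "b \<in> B" for b using that Bin(1) by auto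
  then show ?thesis unfolding coset_eq by auto metis
qed

lemma in_coset: "x \<in> carrier V \<Longrightarrow> x \<in> B +> x"
  unfolding coset_eq using Bin(2) by force

lemma coset_eq_iff:
  assumes x: "x \<in> carrier V" and y: "y \<in> carrier V"
  shows "B +> x = B +> y \<longleftrightarrow> (\<exists>b\<in>B. x = b \<oplus> y)"
  using coset_absorb[OF _ y] in_coset[OF x] by (auto simp: coset_eq[of y])

lemma coset_eq_zero_iff: "x \<in> carrier V \<Longrightarrow> B +> x = B \<longleftrightarrow> x \<in> B"
  using coset_eq_iff[of x \<zero>] Bin(1) by (auto simp: coset_zero subset_iff)

lemma coset_add:
  assumes x: "x \<in> carrier V" and y: "y \<in> carrier V"
  shows "(B +> x) <+> (B +> y) = B +> (x \<oplus> y)"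
proof -
  have "(b \<oplus> x) \<oplus> (b' \<oplus> y) \<in> B +> (x \<oplus> y)" if "b \<in> B" "b' \<in> B" for b b'
  proof -
    have "b \<in> carrier V" "b' \<in> carrier V" using that Bin(1) by auto
    then have "(b \<oplus> x) \<oplus> (b' \<oplus> y) = (b \<oplus> b') \<oplus> (x \<oplus> y)" using x y by (simp add: a_ac)
    then show ?thesis unfolding coset_eq using Bin(3)[OF that] by blast
  qed
  moreover have "b \<oplus> (x \<oplus> y) \<in> (B +> x) <+> (B +> y)" if "b \<in> B" for b
  proof -
    have "b \<oplus> (x \<oplus> y) = (b \<oplus> x) \<oplus> y" using that Bin(1) x y by (auto simp: a_assoc)
    then show ?thesis unfolding set_add_def' using that in_coset[OF y] coset_eq[of x] by blast
  qed
  ultimately show ?thesis by (auto simp: set_add_def' coset_eq)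
qed

text \<open>Scalar multiplication of the quotient is defined as a union over all representatives;
  all members of that union are the same coset.\<close>

lemma coset_smult:
  assumes x: "x \<in> carrier V"
  shows "(\<Union>v\<in>B +> x. B +> (c \<odot> v)) = B +> (c \<odot> x)"
proof -
  have "B +> (c \<odot> v) = B +> (c \<odot> x)" if v: "v \<in> B +> x" for v
  proof -
    obtain b where b: "b \<in> B" "v = b \<oplus> x" using v by (auto simp: coset_eq)
    have "c \<odot> v = c \<odot> b \<oplus> c \<odot> x" using b Bin(1) x by (auto simp: smult_r_distr)
    then show ?thesis using coset_absorb[OF Bin(4)[OF b(1)]] x by simp
  qed
  then show ?thesis using in_coset[OF x] by blast
qed

abbreviation Q where "Q \<equiv> subquotient V Z B"

lemma Q_simps:
  "carrier Q = (\<lambda>x. B +> x) ` Z" "\<zero>\<^bsub>Q\<^esub> = B"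
  by (auto simp: subquotient_def quotient_module_def A_RCOSETS_def' a_r_coset_def')

lemma Q_add: "x \<in> Z \<Longrightarrow> y \<in> Z \<Longrightarrow> (B +> x) \<oplus>\<^bsub>Q\<^esub> (B +> y) = B +> (x \<oplus> y)"
  using coset_add[of x y] Zin(1) by (auto simp: subquotient_def quotient_module_def set_add_def' subset_iff)

lemma Q_smult: "x \<in> Z \<Longrightarrow> c \<odot>\<^bsub>Q\<^esub> (B +> x) = B +> (c \<odot> x)"
  using coset_smult[of x c] Zin(1) by (auto simp: subquotient_def quotient_module_def a_r_coset_def' subset_iff)

lemma module_Q: "module complex_field Q"
proof (rule moduleI)
  have ZV: "x \<in> carrier V" if "x \<in> Z" for x using that Zin(1) by auto
  show "abelian_group Q"
  proof (rule abelian_groupI)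
    show "\<exists>y\<in>carrier Q. y \<oplus>\<^bsub>Q\<^esub> x = \<zero>\<^bsub>Q\<^esub>" if x: "x \<in> carrier Q" for x
    proof -
      obtain z where z: "z \<in> Z" "x = B +> z" using x unfolding Q_simps by blast
      have n: "\<ominus> z \<in> Z" using z ZV Zin(4) by (simp add: uminus_smult)
      have "(B +> \<ominus> z) \<oplus>\<^bsub>Q\<^esub> x = B +> \<zero>"
        using z n ZV by (simp add: Q_add l_neg)
      then show ?thesis using n by (auto simp: Q_simps coset_zero)
    qed
    show "\<zero>\<^bsub>Q\<^esub> \<in> carrier Q" using Zin(2) coset_zero by (auto simp: Q_simps intro!: image_eqI[of _ _ \<zero>])
    show "\<zero>\<^bsub>Q\<^esub> \<oplus>\<^bsub>Q\<^esub> x = x" if x: "x \<in> carrier Q" for x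
    proof -
      obtain z where z: "z \<in> Z" "x = B +> z" using x unfolding Q_simps by blast
      have "(B +> \<zero>) \<oplus>\<^bsub>Q\<^esub> x = x" using z Zin(2) ZV by (simp add: Q_add)
      then show ?thesis by (simp add: Q_simps coset_zero)
    qed
  qed (use Zin(3) ZV in \<open>auto simp: Q_simps(1) Q_add a_ac\<close>)
qed (use Zin(3,4) Zin(1) cring_complex_field smult_l_distr smult_r_distr smult_assoc1 smult_one
      in \<open>auto simp: Q_simps(1) Q_add Q_smult subset_iff\<close>)

lemma vdim_ge_1_if:
  assumes "z \<in> Z" "z \<notin> B"
  shows "vdim Q \<ge> enat 1"
proof (rule vdim_ge_1[OF module_Q])
  show "B +> z \<in> carrier Q" using assms by (simp add: Q_simps)
  show "B +> z \<noteq> \<zero>\<^bsub>Q\<^esub>" using assms Zin(1) coset_eq_zero_iff by (auto simp: Q_simps)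
qed

end

section \<open>Cochains and chains as complex modules\<close>

lemma module_cochains: "module complex_field (cochains n \<X>)"
proof (rule moduleI)
  show "abelian_group (cochains n \<X>)"
  proof (rule abelian_groupI)
    show "\<exists>y\<in>carrier (cochains n \<X>). y \<oplus>\<^bsub>cochains n \<X>\<^esub> x = \<zero>\<^bsub>cochains n \<X>\<^esub>"
      if "x \<in> carrier (cochains n \<X>)" for x
      using that by (intro bexI[of _ "\<lambda>\<sigma>. - x \<sigma>"]) (auto simp: cochains_def)
  qed (auto simp: cochains_def)
qed (auto simp: cochains_def cring_complex_field algebra_simps intro!: ext)

lemma lookup_map_times [simp]:
  "Poly_Mapping.lookup (Poly_Mapping.map ((*) z) c) k = z * Poly_Mapping.lookup c k" for z :: complex
  by (simp add: Poly_Mapping.map.rep_eq when_def)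

lemma keys_map_times: "Poly_Mapping.keys (Poly_Mapping.map ((*) z) c) \<subseteq> Poly_Mapping.keys c" for z :: complex
  by (auto simp: in_keys_iff)

lemma module_complex_chains: "module complex_field (complex_chains n \<X>)"
proof (rule moduleI)
  show "abelian_group (complex_chains n \<X>)"
  proof (rule abelian_groupI)
    show "\<exists>y\<in>carrier (complex_chains n \<X>). y \<oplus>\<^bsub>complex_chains n \<X>\<^esub> x = \<zero>\<^bsub>complex_chains n \<X>\<^esub>"
      if "x \<in> carrier (complex_chains n \<X>)" for x
      using that by (intro bexI[of _ "- x"]) (auto simp: complex_chains_def)
  qed (auto simp: complex_chains_def algebra_simps dest!: keys_add[THEN subsetD])
next
  show "a \<odot>\<^bsub>complex_chains n \<X>\<^esub> x \<in> carrier (complex_chains n \<X>)"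
    if "x \<in> carrier (complex_chains n \<X>)" for a x
    using that keys_map_times[of a x] by (auto simp: complex_chains_def)
qed (auto simp: complex_chains_def cring_complex_field algebra_simps lookup_add intro!: poly_mapping_eqI)

section \<open>Singular simplices of dimension at most two\<close>

definition point_simplex :: "'a \<Rightarrow> (nat \<Rightarrow> real) \<Rightarrow> 'a" where
  "point_simplex x = restrict (\<lambda>_. x) (standard_simplex 0)"

text \<open>Vertex 0 is the start and vertex 1 the end of the path. Singular simplices are
  extensional functions of barycentric coordinates, so the restriction makes this inverse to
  \<open>initial_edge\<close> up to values outside the unit interval.\<close>

definition path_simplex :: "(real \<Rightarrow> 'a) \<Rightarrow> (nat \<Rightarrow> real) \<Rightarrow> 'a" where
  "path_simplex p = restrict (\<lambda>v. p (v 1)) (standard_simplex 1)"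

definition tri_simplex :: "(real \<times> real \<Rightarrow> 'a) \<Rightarrow> (nat \<Rightarrow> real) \<Rightarrow> 'a" where
  "tri_simplex s = restrict (\<lambda>v. s (v 1, v 2)) (standard_simplex 2)"

lemma standard_simplex_1: "v \<in> standard_simplex 1 \<longleftrightarrow>
    0 \<le> v 1 \<and> v 1 \<le> 1 \<and> v = (\<lambda>j. if j = 0 then 1 - v 1 else if j = 1 then v 1 else 0)"
proof
  assume v: "v \<in> standard_simplex 1"
  then have "v 0 + v 1 = 1" "\<forall>i>1. v i = 0" "0 \<le> v 1" "v 1 \<le> 1"
    by (auto simp: standard_simplex_def)
  then show "0 \<le> v 1 \<and> v 1 \<le> 1 \<and> v = (\<lambda>j. if j = 0 then 1 - v 1 else if j = 1 then v 1 else 0)"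
    by (auto intro!: ext simp: algebra_simps)
next
  assume *: "0 \<le> v 1 \<and> v 1 \<le> 1 \<and> v = (\<lambda>j. if j = 0 then 1 - v 1 else if j = 1 then v 1 else 0)"
  then obtain t where t: "0 \<le> t" "t \<le> 1" "v = (\<lambda>j. if j = 0 then 1 - t else if j = 1 then t else 0)" by blast
  show "v \<in> standard_simplex 1" unfolding t(3) using t(1,2) by (auto simp: standard_simplex_def)
qed

lemma standard_simplex_2: "v \<in> standard_simplex 2 \<longleftrightarrow>
    (v 1, v 2) \<in> tri \<and> v = (\<lambda>j. if j = 0 then 1 - v 1 - v 2 else if j = 1 then v 1 else if j = 2 then v 2 else 0)"
proof
  assume v: "v \<in> standard_simplex 2"
  then have "v 0 + v 1 + v 2 = 1" "\<forall>i>2. v i = 0" "\<forall>i. 0 \<le> v i"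
    by (auto simp: standard_simplex_def numeral_2_eq_2)
  moreover from this have "v 0 = 1 - v 1 - v 2" "v 1 + v 2 \<le> 1"
    using spec[OF \<open>\<forall>i. 0 \<le> v i\<close>, of 0] by linarith+
  moreover from \<open>\<forall>i>2. v i = 0\<close> have "v j = 0" if "j \<noteq> 0" "j \<noteq> 1" "j \<noteq> 2" for j
    using that by (metis One_nat_def less_2_cases_iff linorder_neqE_nat)
  ultimately show "(v 1, v 2) \<in> tri \<and> v = (\<lambda>j. if j = 0 then 1 - v 1 - v 2 else if j = 1 then v 1 else if j = 2 then v 2 else 0)"
    by (auto simp: tri_def fun_eq_iff eq_diff_eq)
next
  assume *: "(v 1, v 2) \<in> tri \<and> v = (\<lambda>j. if j = 0 then 1 - v 1 - v 2 else if j = 1 then v 1 else if j = 2 then v 2 else 0)"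
  then obtain a b where t: "(a, b) \<in> tri" "v = (\<lambda>j. if j = 0 then 1 - a - b else if j = 1 then a else if j = 2 then b else 0)" by blast
  show "v \<in> standard_simplex 2" unfolding t(2) using t(1) by (auto simp: standard_simplex_def tri_def numeral_2_eq_2)
qed

lemma path_simplex_eqI: "(\<And>t. 0 \<le> t \<Longrightarrow> t \<le> 1 \<Longrightarrow> p t = q t) \<Longrightarrow> path_simplex p = path_simplex q"
  by (auto simp: path_simplex_def standard_simplex_1 simp del: One_nat_def intro!: restrict_ext)

lemma continuous_map_powertop_coord:
  "continuous_map (subtopology (powertop_real UNIV) S) euclideanreal (\<lambda>v. v i)"
  by (rule continuous_map_from_subtopology) (use continuous_map_product_projection[of i UNIV "\<lambda>_. euclideanreal"] in simp)

lemma singular_simplex_path_simplex: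
  assumes "pathin \<X> p" shows "singular_simplex 1 \<X> (path_simplex p)"
proof -
  have "continuous_map (subtopology (powertop_real UNIV) (standard_simplex 1)) (top_of_set {0..1}) (\<lambda>v. v 1)"
    by (auto simp: continuous_map_in_subtopology continuous_map_powertop_coord standard_simplex_def)
  from continuous_map_compose[OF this, of \<X> p]
  have "continuous_map (subtopology (powertop_real UNIV) (standard_simplex 1)) \<X> (\<lambda>v. p (v 1))"
    using assms by (simp add: pathin_def o_def)
  then show ?thesis
    by (auto simp: singular_simplex_def path_simplex_def elim: continuous_map_eq)
qed

lemma pathin_initial_edge:
  assumes "singular_simplex n \<X> \<sigma>" "n \<ge> 1" shows "pathin \<X> (initial_edge \<sigma>)"
proof -
  have "(\<lambda>j::nat. if j = 0 then 1 - t else if j = 1 then t else 0) \<in> standard_simplex n"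
    if "0 \<le> t" "t \<le> 1" for t :: real
    using that standard_simplex_mono[OF assms(2)] by (auto simp: standard_simplex_1 simp del: One_nat_def)
  moreover have "continuous_map (top_of_set {0..1}) euclideanreal (\<lambda>t. if j = 0 then 1 - t else if j = 1 then t else 0)"
    for j :: nat
    by (cases "j = 0"; cases "j = 1") (auto intro!: continuous_intros)
  ultimately have "continuous_map (top_of_set {0..1}) (subtopology (powertop_real UNIV) (standard_simplex n))
     (\<lambda>t j. if j = 0 then 1 - t else if j = 1 then t else 0)"
    by (auto simp: continuous_map_in_subtopology continuous_map_componentwise_UNIV)
  from continuous_map_compose[OF this, of \<X> \<sigma>] show ?thesis
    using assms(1) by (simp add: pathin_def initial_edge_def o_def singular_simplex_def)
qed

lemma initial_edge_path_simplex: "0 \<le> t \<Longrightarrow> t \<le> 1 \<Longrightarrow> initial_edge (path_simplex p) t = p t"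
  by (auto simp: initial_edge_def path_simplex_def standard_simplex_1 simp del: One_nat_def)

lemma path_simplex_initial_edge:
  assumes "singular_simplex 1 \<X> \<sigma>" shows "path_simplex (initial_edge \<sigma>) = \<sigma>"
proof
  fix v
  show "path_simplex (initial_edge \<sigma>) v = \<sigma> v"
  proof (cases "v \<in> standard_simplex 1")
    case True
    then show ?thesis
      using standard_simplex_1[of v] by (simp add: path_simplex_def initial_edge_def)
  next
    case False
    then show ?thesis
      using assms by (simp add: path_simplex_def singular_simplex_def extensional_def)
  qed
qed

lemma singular_simplex_1E:
  assumes "singular_simplex 1 \<X> \<sigma>"
  obtains p where "pathin \<X> p" "\<sigma> = path_simplex p"
  using pathin_initial_edge[OF assms] path_simplex_initial_edge[OF assms] by force

lemma singular_simplex_tri_simplex: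
  assumes "continuous_map (top_of_set tri) \<X> s" shows "singular_simplex 2 \<X> (tri_simplex s)"
proof -
  have "continuous_map (subtopology (powertop_real UNIV) (standard_simplex 2)) (prod_topology euclideanreal euclideanreal) (\<lambda>v. (v 1, v 2))"
    unfolding continuous_map_pairwise by (simp add: o_def continuous_map_powertop_coord)
  then have "continuous_map (subtopology (powertop_real UNIV) (standard_simplex 2)) (top_of_set tri) (\<lambda>v. (v 1, v 2))"
    by (auto simp: continuous_map_in_subtopology standard_simplex_2)
  from continuous_map_compose[OF this assms]
  have "continuous_map (subtopology (powertop_real UNIV) (standard_simplex 2)) \<X> (\<lambda>v. s (v 1, v 2))"
    by (simp add: o_def)
  then show ?thesis
    by (auto simp: singular_simplex_def tri_simplex_def elim: continuous_map_eq)
qed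

lemma singular_simplex_2E:
  assumes \<sigma>: "singular_simplex 2 \<X> \<sigma>"
  obtains s where "continuous_map (top_of_set tri) \<X> s" "\<sigma> = tri_simplex s"
proof
  let ?g = "\<lambda>z (j::nat). if j = 0 then 1 - fst z - snd z else if j = 1 then fst z else if j = 2 then snd z else (0::real)"
  have "continuous_map (top_of_set tri) euclideanreal (\<lambda>z. ?g z j)" for j
    by (cases "j = 0"; cases "j = 1"; cases "j = 2") (auto intro!: continuous_intros)
  moreover have "?g z \<in> standard_simplex 2" if "z \<in> tri" for z
    using that by (simp add: standard_simplex_2)
  ultimately have "continuous_map (top_of_set tri) (subtopology (powertop_real UNIV) (standard_simplex 2)) ?g"
    by (auto simp: continuous_map_in_subtopology continuous_map_componentwise_UNIV)
  from continuous_map_compose[OF this, of \<X> \<sigma>] \<sigma>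
  show "continuous_map (top_of_set tri) \<X> (\<sigma> \<circ> ?g)" by (simp add: singular_simplex_def)
  show "\<sigma> = tri_simplex (\<sigma> \<circ> ?g)"
  proof
    fix v
    show "\<sigma> v = tri_simplex (\<sigma> \<circ> ?g) v"
    proof (cases "v \<in> standard_simplex 2")
      case True
      then have "v = ?g (v 1, v 2)" using standard_simplex_2[of v] unfolding fst_conv snd_conv by blast
      then have "\<sigma> v = \<sigma> (?g (v 1, v 2))" by (rule arg_cong)
      with True show ?thesis by (simp add: tri_simplex_def del: One_nat_def)
    next
      case False
      then show ?thesis
        using \<sigma> by (simp add: tri_simplex_def singular_simplex_def extensional_def)
    qed
  qed
qed

section \<open>Faces of low-dimensional simplices\<close>

lemma singular_simplex_point_simplex: "x \<in> topspace \<X> \<Longrightarrow> singular_simplex 0 \<X> (point_simplex x)"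
  by (auto simp: singular_simplex_def point_simplex_def elim: continuous_map_eq[rotated])

lemma face_path_simplex:
  "singular_face 1 0 (path_simplex p) = point_simplex (p 1)"
  "singular_face 1 1 (path_simplex p) = point_simplex (p 0)"
proof -
  have *: "simplical_face k v \<in> standard_simplex 1" "v 0 = 1"
    if "k \<le> 1" "v \<in> standard_simplex 0" for k and v :: "nat \<Rightarrow> real"
    using that simplical_face_in_standard_simplex[of 1 k v] by (auto simp: standard_simplex_0)
  show "singular_face 1 0 (path_simplex p) = point_simplex (p 1)"
    "singular_face 1 1 (path_simplex p) = point_simplex (p 0)"
    using *(1)[of 0] *(1)[of 1] *(2)[of 0]
    by (auto simp: fun_eq_iff singular_face_def point_simplex_def path_simplex_def simplical_face_def restrict_def
        intro!: arg_cong[of _ _ p])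
qed

text \<open>Face \<open>i\<close> omits vertex \<open>i\<close>, and the coordinates
  \<open>(v 1, v 2)\<close> place the vertices 0, 1, 2 at \<open>(0,0)\<close>,
  \<open>(1,0)\<close>, \<open>(0,1)\<close>.\<close>

lemma face_tri_simplex:
  "singular_face 2 0 (tri_simplex s) = path_simplex (\<lambda>t. s (1 - t, t))"
  "singular_face 2 1 (tri_simplex s) = path_simplex (\<lambda>t. s (0, t))"
  "singular_face 2 2 (tri_simplex s) = path_simplex (\<lambda>t. s (t, 0))"
proof -
  have f: "simplical_face k v \<in> standard_simplex 2" if "k \<le> 2" "v \<in> standard_simplex 1" for k and v :: "nat \<Rightarrow> real"
    using simplical_face_in_standard_simplex[of 2 k v] that by simp
  have v0: "v 0 = 1 - v 1" "v 2 = 0" if "v \<in> standard_simplex 1" for v :: "nat \<Rightarrow> real"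
    using that standard_simplex_1[of v] by (metis, simp add: standard_simplex_def)
  show "singular_face 2 0 (tri_simplex s) = path_simplex (\<lambda>t. s (1 - t, t))"
    "singular_face 2 1 (tri_simplex s) = path_simplex (\<lambda>t. s (0, t))"
    "singular_face 2 2 (tri_simplex s) = path_simplex (\<lambda>t. s (t, 0))"
    unfolding singular_face_def path_simplex_def
    by (auto simp: f tri_simplex_def v0 intro!: restrict_ext) (auto simp: simplical_face_def v0)
qed

text \<open>For two factors of degree one the Alexander-Whitney faces are the ordinary faces 2 and
  0.\<close>

lemma front_back_tri_simplex:
  "front_face 1 (tri_simplex s) = path_simplex (\<lambda>t. s (t, 0))"
  "back_face 1 1 (tri_simplex s) = path_simplex (\<lambda>t. s (1 - t, t))"
proof -
  have "front_face 1 (tri_simplex s) = singular_face 2 2 (tri_simplex s)"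
    "back_face 1 1 (tri_simplex s) = singular_face 2 0 (tri_simplex s)"
    by (auto simp: front_face_def back_face_def singular_face_def simplical_face_def o_def
        standard_simplex_def intro!: restrict_ext arg_cong[of _ _ "tri_simplex s"] ext)
  then show "front_face 1 (tri_simplex s) = path_simplex (\<lambda>t. s (t, 0))"
    "back_face 1 1 (tri_simplex s) = path_simplex (\<lambda>t. s (1 - t, t))"
    by (simp_all add: face_tri_simplex)
qed

lemma front_back_path_simplex:
  "front_face 1 (path_simplex p) = path_simplex p"
  "back_face 1 0 (path_simplex p) = point_simplex (p 1)"
proof -
  have "back_face 1 0 (path_simplex p) = singular_face 1 0 (path_simplex p)"
    by (auto simp: back_face_def singular_face_def simplical_face_def
        intro!: restrict_ext arg_cong[of _ _ "path_simplex p"] ext)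
  then show "back_face 1 0 (path_simplex p) = point_simplex (p 1)"
    by (simp only: face_path_simplex)
qed (simp add: front_face_def path_simplex_def)

lemma initial_edge_tri_simplex: "0 \<le> t \<Longrightarrow> t \<le> 1 \<Longrightarrow> initial_edge (tri_simplex s) t = s (t, 0)"
  by (auto simp: initial_edge_def tri_simplex_def standard_simplex_2 tri_def)

section \<open>Resonance\<close>

lemma coboundary_1_tri:
  "continuous_map (top_of_set tri) \<X> s \<Longrightarrow> coboundary 1 \<X> \<alpha> (tri_simplex s) =
     \<alpha> (path_simplex (\<lambda>t. s (1 - t, t))) - \<alpha> (path_simplex (\<lambda>t. s (0, t))) + \<alpha> (path_simplex (\<lambda>t. s (t, 0)))"
  using singular_simplex_tri_simplex[of \<X> s] face_tri_simplex[of s]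
  by (simp add: coboundary_def numeral_2_eq_2)

lemma coboundary_0_path:
  "pathin \<X> p \<Longrightarrow> coboundary 0 \<X> \<alpha> (path_simplex p) = \<alpha> (point_simplex (p 1)) - \<alpha> (point_simplex (p 0))"
  using singular_simplex_path_simplex[of \<X> p] face_path_simplex[of p]
  by (simp add: coboundary_def)

text \<open>Every singular 2-simplex is a \<open>tri_simplex\<close>, and its three faces give the
  triangle relation. The congruence clause is automatic, since \<open>path_simplex\<close> sees only
  the unit interval.\<close>

lemma cocycles_1_iff:
  "\<alpha> \<in> cocycles 1 \<X> \<longleftrightarrow> \<alpha> \<in> carrier (cochains 1 \<X>) \<and> path_cocycle \<X> (+) (\<lambda>p. \<alpha> (path_simplex p))"
proof -
  have cong: "\<alpha> (path_simplex p) = \<alpha> (path_simplex q)" if "\<forall>t\<in>{0..1}. p t = q t" for p q :: "real \<Rightarrow> 'a"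
    using path_simplex_eqI[of p q] that by simp
  have "coboundary 1 \<X> \<alpha> = (\<lambda>_. 0) \<longleftrightarrow>
      (\<forall>s. continuous_map (top_of_set tri) \<X> s \<longrightarrow> coboundary 1 \<X> \<alpha> (tri_simplex s) = 0)"
  proof (safe intro!: ext)
    fix \<sigma> assume *: "\<forall>s. continuous_map (top_of_set tri) \<X> s \<longrightarrow> coboundary 1 \<X> \<alpha> (tri_simplex s) = 0"
    show "coboundary 1 \<X> \<alpha> \<sigma> = 0"
    proof (cases "singular_simplex 2 \<X> \<sigma>")
      case True
      then show ?thesis using * by (metis singular_simplex_2E)
    qed (simp add: coboundary_def numeral_2_eq_2)
  qed auto
  also have "\<dots> \<longleftrightarrow> path_cocycle \<X> (+) (\<lambda>p. \<alpha> (path_simplex p))"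
    unfolding path_cocycle_def using cong by (auto simp: coboundary_1_tri algebra_simps simp del: One_nat_def)
  finally show ?thesis by (auto simp: cocycles_def)
qed

text \<open>The way back from functionals on paths to singular cochains, for functionals that depend
  only on the unit interval.\<close>

definition path_cochain :: "'a topology \<Rightarrow> ((real \<Rightarrow> 'a) \<Rightarrow> complex) \<Rightarrow> 'a cochain" where
  "path_cochain \<X> F = (\<lambda>\<sigma>. if singular_simplex 1 \<X> \<sigma> then F (initial_edge \<sigma>) else 0)"

lemma path_cochain_in: "path_cochain \<X> F \<in> carrier (cochains 1 \<X>)"
  by (auto simp: path_cochain_def cochains_def)

lemma path_cochain_path:
  assumes "pathin \<X> p" and "\<And>q. \<forall>t\<in>{0..1}. p t = q t \<Longrightarrow> F p = F q"
  shows "path_cochain \<X> F (path_simplex p) = F p"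
  using assms(2)[of "initial_edge (path_simplex p)"] singular_simplex_path_simplex[OF assms(1)]
    initial_edge_path_simplex[of _ p]
  by (auto simp: path_cochain_def)

lemma cochain_1_eqI:
  assumes "\<alpha> \<in> carrier (cochains 1 \<X>)" "\<beta> \<in> carrier (cochains 1 \<X>)"
    and "\<And>p. pathin \<X> p \<Longrightarrow> \<alpha> (path_simplex p) = \<beta> (path_simplex p)"
  shows "\<alpha> = \<beta>"
proof
  fix \<sigma> show "\<alpha> \<sigma> = \<beta> \<sigma>"
  proof (cases "singular_simplex 1 \<X> \<sigma>")
    case True
    then show ?thesis using assms(3) by (metis singular_simplex_1E)
  qed (use assms(1,2) in \<open>auto simp: cochains_def\<close>)
qed

lemma path_cochain_cocycle:
  assumes "path_cocycle \<X> (+) F"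
  shows "path_cochain \<X> F \<in> cocycles 1 \<X>" and "\<And>p. pathin \<X> p \<Longrightarrow> path_cochain \<X> F (path_simplex p) = F p"
proof -
  show 1: "path_cochain \<X> F (path_simplex p) = F p" if "pathin \<X> p" for p
    using path_cocycle_cong[OF assms that] by (intro path_cochain_path[OF that]) auto
  show "path_cochain \<X> F \<in> cocycles 1 \<X>"
    unfolding cocycles_1_iff by (intro conjI path_cochain_in path_cocycle_eq[OF assms 1])
qed

lemma coboundaries_1_iff:
  "\<alpha> \<in> coboundaries 1 \<X> \<longleftrightarrow> \<alpha> \<in> carrier (cochains 1 \<X>) \<and>
     (\<exists>f. \<forall>p. pathin \<X> p \<longrightarrow> \<alpha> (path_simplex p) = f (p 1) - f (p 0))"
proof
  assume "\<alpha> \<in> coboundaries 1 \<X>"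
  then obtain g where "\<alpha> = coboundary 0 \<X> g" by (auto simp: coboundaries_def)
  then show "\<alpha> \<in> carrier (cochains 1 \<X>) \<and> (\<exists>f. \<forall>p. pathin \<X> p \<longrightarrow> \<alpha> (path_simplex p) = f (p 1) - f (p 0))"
    by (auto simp: coboundary_0_path intro!: exI[of _ "\<lambda>x. g (point_simplex x)"])
      (simp add: cochains_def coboundary_def)
next
  assume *: "\<alpha> \<in> carrier (cochains 1 \<X>) \<and> (\<exists>f. \<forall>p. pathin \<X> p \<longrightarrow> \<alpha> (path_simplex p) = f (p 1) - f (p 0))"
  then obtain f where f: "\<And>p. pathin \<X> p \<Longrightarrow> \<alpha> (path_simplex p) = f (p 1) - f (p 0)" by blast
  \<comment> \<open>The point of a 0-simplex is its value at the only vertex of the standard simplex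
    of dimension zero.\<close>
  define g where "g = (\<lambda>\<sigma>. if singular_simplex 0 \<X> \<sigma> then f (\<sigma> (\<lambda>j. if j = 0 then 1 else 0)) else 0)"
  have g: "g \<in> carrier (cochains 0 \<X>)" by (auto simp: g_def cochains_def)
  have gp: "g (point_simplex x) = f x" if "x \<in> topspace \<X>" for x
    using singular_simplex_point_simplex[OF that] by (simp add: g_def point_simplex_def standard_simplex_0)
  have "\<alpha> = coboundary 0 \<X> g"
  proof (rule cochain_1_eqI)
    show "\<alpha> (path_simplex p) = coboundary 0 \<X> g (path_simplex p)" if "pathin \<X> p" for p
      using that f pathin_start[OF that] pathin_end[OF that] by (simp add: coboundary_0_path gp)
  qed (use * in \<open>auto simp: cochains_def coboundary_def\<close>)
  with g show "\<alpha> \<in> coboundaries 1 \<X>" by (auto simp: coboundaries_def)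
qed

lemma coboundary_add: "coboundary n \<X> (\<lambda>\<sigma>. \<alpha> \<sigma> + \<beta> \<sigma>) = (\<lambda>\<sigma>. coboundary n \<X> \<alpha> \<sigma> + coboundary n \<X> \<beta> \<sigma>)"
  by (auto simp: coboundary_def algebra_simps sum.distrib)

lemma coboundary_cmult: "coboundary n \<X> (\<lambda>\<sigma>. c * \<alpha> \<sigma>) = (\<lambda>\<sigma>. c * coboundary n \<X> \<alpha> \<sigma>)"
  by (auto simp: coboundary_def algebra_simps sum_distrib_left)

lemma coboundary_0: "coboundary n \<X> (\<lambda>\<sigma>. 0) = (\<lambda>\<sigma>. 0)"
  by (auto simp: coboundary_def)

lemma subspace_cocycles: "linear_subspace (cochains n \<X>) (cocycles n \<X>)"
  by (auto simp: linear_subspace_def cocycles_def cochains_def coboundary_add coboundary_cmult coboundary_0)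

lemma subspace_coboundaries: "linear_subspace (cochains n \<X>) (coboundaries n \<X>)"
proof (cases n)
  case 0
  then show ?thesis by (auto simp: linear_subspace_def coboundaries_def cochains_def)
next
  case (Suc m)
  have "coboundary m \<X> \<alpha> \<in> carrier (cochains n \<X>)" for \<alpha>
    by (auto simp: cochains_def coboundary_def Suc)
  moreover have "(\<lambda>\<sigma>. coboundary m \<X> \<alpha> \<sigma> + coboundary m \<X> \<beta> \<sigma>) \<in> coboundary m \<X> ` carrier (cochains m \<X>)"
    if "\<alpha> \<in> carrier (cochains m \<X>)" "\<beta> \<in> carrier (cochains m \<X>)" for \<alpha> \<beta>
    unfolding coboundary_add[symmetric] using that by (intro imageI) (auto simp: cochains_def)
  moreover have "(\<lambda>\<sigma>. c * coboundary m \<X> \<alpha> \<sigma>) \<in> coboundary m \<X> ` carrier (cochains m \<X>)"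
    if "\<alpha> \<in> carrier (cochains m \<X>)" for \<alpha> c
    unfolding coboundary_cmult[symmetric] using that by (intro imageI) (auto simp: cochains_def)
  moreover have "(\<lambda>\<sigma>. 0) \<in> coboundary m \<X> ` carrier (cochains m \<X>)"
    using coboundary_0[of m \<X>] by (intro image_eqI[of _ _ "\<lambda>\<sigma>. 0"]) (auto simp: cochains_def)
  ultimately show ?thesis
    using Suc by (auto simp: linear_subspace_def coboundaries_def) (auto simp: cochains_def)
qed

lemma subquotient_H1: "subquotient_space (cochains 1 \<X>) (cocycles 1 \<X>) (coboundaries 1 \<X>)"
proof -
  have "coboundaries 1 \<X> \<subseteq> cocycles 1 \<X>"
  proof
    fix \<alpha> assume "\<alpha> \<in> coboundaries 1 \<X>"
    then obtain f where "\<alpha> \<in> carrier (cochains 1 \<X>)" "\<And>p. pathin \<X> p \<Longrightarrow> \<alpha> (path_simplex p) = f (p 1) - f (p 0)"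
      unfolding coboundaries_1_iff by blast
    moreover from this(2) have "path_cocycle \<X> (+) (\<lambda>p. \<alpha> (path_simplex p))"
      by (rule path_cocycle_eq[OF path_cocycle_delta])
    ultimately show "\<alpha> \<in> cocycles 1 \<X>"
      unfolding cocycles_1_iff by blast
  qed
  then show ?thesis
    by (intro subquotient_space.intro subquotient_space_axioms.intro module_cochains subspace_cocycles subspace_coboundaries)
qed

lemma cup_exact_coboundary:
  assumes "cup_exact \<X> (\<lambda>p. \<alpha> (path_simplex p)) (\<lambda>p. \<beta> (path_simplex p))"
  shows "cochain_cup 1 1 \<X> \<alpha> \<beta> \<in> coboundaries 2 \<X>"
proof -
  obtain C where cong: "\<And>p q. \<lbrakk>pathin \<X> p; \<forall>t\<in>{0..1}. p t = q t\<rbrakk> \<Longrightarrow> C p = C q"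
    and C: "\<And>s. continuous_map (top_of_set tri) \<X> s \<Longrightarrow>
      C (\<lambda>t. s (0, t)) = C (\<lambda>t. s (t, 0)) + C (\<lambda>t. s (1 - t, t)) +
        \<alpha> (path_simplex (\<lambda>t. s (t, 0))) * \<beta> (path_simplex (\<lambda>t. s (1 - t, t)))"
    using cup_exactE[OF assms] by blast
  \<comment> \<open>The sign comes from the coboundary \<gamma>(12) - \<gamma>(02) + \<gamma>(01)
    compared with the Heisenberg law, where C(02) stands alone on one side.\<close>
  define \<gamma> where "\<gamma> = path_cochain \<X> (\<lambda>p. - C p)"
  have \<gamma>: "\<gamma> (path_simplex p) = - C p" if "pathin \<X> p" for p
    unfolding \<gamma>_def using cong[OF that] by (subst path_cochain_path[OF that]) auto
  have "cochain_cup 1 1 \<X> \<alpha> \<beta> = coboundary 1 \<X> \<gamma>"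
  proof
    fix \<sigma> show "cochain_cup 1 1 \<X> \<alpha> \<beta> \<sigma> = coboundary 1 \<X> \<gamma> \<sigma>"
    proof (cases "singular_simplex 2 \<X> \<sigma>")
      case True
      then obtain s where s: "continuous_map (top_of_set tri) \<X> s" "\<sigma> = tri_simplex s"
        by (rule singular_simplex_2E)
      have "cochain_cup 1 1 \<X> \<alpha> \<beta> \<sigma> = \<alpha> (path_simplex (\<lambda>t. s (t, 0))) * \<beta> (path_simplex (\<lambda>t. s (1 - t, t)))"
        using True front_back_tri_simplex[of s] s(2) by (simp add: cochain_cup_def numeral_2_eq_2)
      also have "\<dots> = coboundary 1 \<X> \<gamma> \<sigma>"
        using C[OF s(1)] edges_pathin[OF s(1)] by (simp add: s(2) coboundary_1_tri[OF s(1)] \<gamma> del: One_nat_def)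
      finally show ?thesis .
    qed (simp add: cochain_cup_def coboundary_def numeral_2_eq_2)
  qed
  moreover have "\<gamma> \<in> carrier (cochains 1 \<X>)" by (simp only: \<gamma>_def path_cochain_in)
  ultimately show ?thesis by (auto simp: coboundaries_def numeral_2_eq_2)
qed

text \<open>This serves two purposes: with \<open>c = 0\<close> it shows that products do not depend
  on the representative of the second factor, and with \<open>f\<close> zero that the multiples of a
  class are annihilated by it. The square is halved because the cross term of the square of a sum
  occurs twice.\<close>

lemma cup_exact_delta:
  assumes A: "path_cocycle \<X> (+) A" and B: "\<And>p. pathin \<X> p \<Longrightarrow> B p = c * A p + (f (p 1) - f (p 0))"
  shows "cup_exact \<X> A B"
proof (rule cup_exactI[OF A, where C = "\<lambda>p. c * ((A p)\<^sup>2 / 2) + A p * f (p 1)"])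
  show "path_cocycle \<X> (+) B"
    by (rule path_cocycle_eq[OF path_cocycle_add[OF path_cocycle_cmult[OF A] path_cocycle_delta] B])
  show "c * ((A r)\<^sup>2 / 2) + A r * f (r 1) = (c * ((A p)\<^sup>2 / 2) + A p * f (p 1)) + (c * ((A q)\<^sup>2 / 2) + A q * f (q 1)) + A p * B q"
    if "pathin \<X> q" "p 1 = q 0" "r 1 = q 1" "A r = A p + A q" for p q r
    unfolding B[OF that(1)] that(2)[symmetric] that(3,4)
    by (simp add: field_simps power2_eq_square)
qed auto

lemma cochain_cup_add:
  "cochain_cup p q \<X> \<alpha> (\<lambda>\<sigma>. \<beta> \<sigma> + \<gamma> \<sigma>) = (\<lambda>\<sigma>. cochain_cup p q \<X> \<alpha> \<beta> \<sigma> + cochain_cup p q \<X> \<alpha> \<gamma> \<sigma>)"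
  "cochain_cup p q \<X> (\<lambda>\<sigma>. \<alpha> \<sigma> + \<delta> \<sigma>) \<beta> = (\<lambda>\<sigma>. cochain_cup p q \<X> \<alpha> \<beta> \<sigma> + cochain_cup p q \<X> \<delta> \<beta> \<sigma>)"
  by (auto simp: cochain_cup_def algebra_simps)

lemma cochain_cup_cmult:
  "cochain_cup p q \<X> \<alpha> (\<lambda>\<sigma>. c * \<beta> \<sigma>) = (\<lambda>\<sigma>. c * cochain_cup p q \<X> \<alpha> \<beta> \<sigma>)"
  by (auto simp: cochain_cup_def)

lemma cochain_cup_delta_right:
  assumes "\<alpha> \<in> cocycles 1 \<X>" "\<beta> \<in> coboundaries 1 \<X>"
  shows "cochain_cup 1 1 \<X> \<alpha> \<beta> \<in> coboundaries 2 \<X>"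
proof -
  obtain f where f: "\<And>p. pathin \<X> p \<Longrightarrow> \<beta> (path_simplex p) = f (p 1) - f (p 0)"
    using assms(2) unfolding coboundaries_1_iff by blast
  show ?thesis
    by (intro cup_exact_coboundary cup_exact_delta[where c = 0 and f = f])
      (use assms(1) f cocycles_1_iff in auto)
qed

text \<open>Leibniz rule: as \<open>\<beta>\<close> is closed, the product is the coboundary of
  \<open>f\<close> times \<open>\<beta>\<close>. The sign in \<open>C\<close> is the one built into
  \<open>cup_exact\<close>.\<close>

lemma cochain_cup_delta_left:
  assumes "\<alpha> \<in> coboundaries 1 \<X>" "\<beta> \<in> cocycles 1 \<X>"
  shows "cochain_cup 1 1 \<X> \<alpha> \<beta> \<in> coboundaries 2 \<X>"
proof -
  interpret subquotient_space "cochains 1 \<X>" "cocycles 1 \<X>" "coboundaries 1 \<X>"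
    by (rule subquotient_H1)
  obtain f where f: "\<And>p. pathin \<X> p \<Longrightarrow> \<alpha> (path_simplex p) = f (p 1) - f (p 0)"
    using assms(1) unfolding coboundaries_1_iff by blast
  have \<alpha>: "path_cocycle \<X> (+) (\<lambda>p. \<alpha> (path_simplex p))" "path_cocycle \<X> (+) (\<lambda>p. \<beta> (path_simplex p))"
    using assms BZ cocycles_1_iff by blast+
  show ?thesis
  proof (intro cup_exact_coboundary cup_exactI[OF \<alpha>, where C = "\<lambda>p. - (f (p 0) * \<beta> (path_simplex p))"])
    show "- (f (r 0) * \<beta> (path_simplex r)) = - (f (p 0) * \<beta> (path_simplex p)) + - (f (q 0) * \<beta> (path_simplex q))
        + \<alpha> (path_simplex p) * \<beta> (path_simplex q)"
      if "pathin \<X> p" "p 1 = q 0" "r 0 = p 0" "\<beta> (path_simplex r) = \<beta> (path_simplex p) + \<beta> (path_simplex q)" for p q r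
      unfolding f[OF that(1)] that(2-) by (simp add: algebra_simps)
  qed auto
qed

lemma cochains_ops:
  "\<alpha> \<oplus>\<^bsub>cochains n \<X>\<^esub> \<beta> = (\<lambda>\<sigma>. \<alpha> \<sigma> + \<beta> \<sigma>)" "c \<odot>\<^bsub>cochains n \<X>\<^esub> \<alpha> = (\<lambda>\<sigma>. c * \<alpha> \<sigma>)"
  "\<zero>\<^bsub>cochains n \<X>\<^esub> = (\<lambda>_. 0)"
  by (simp_all add: cochains_def)

section \<open>Cup products on the first cohomology\<close>

context
  fixes \<X> :: "'a topology"
  assumes con: "path_connected_space \<X>"
begin

declare One_nat_def [simp del]

interpretation H1: subquotient_space "cochains 1 \<X>" "cocycles 1 \<X>" "coboundaries 1 \<X>"
  by (rule subquotient_H1)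

interpretation H1m: module complex_field "cohomology 1 \<X>"
  unfolding cohomology_def by (rule H1.module_Q)

abbreviation cls :: "'a cochain \<Rightarrow> 'a cochain set" where
  "cls \<alpha> \<equiv> coboundaries 1 \<X> +>\<^bsub>cochains 1 \<X>\<^esub> \<alpha>"

lemma carrier_H1: "carrier (cohomology 1 \<X>) = cls ` cocycles 1 \<X>"
  unfolding cohomology_def by (rule H1.Q_simps)

lemma in_cls_iff: "\<beta> \<in> cls \<alpha> \<longleftrightarrow> (\<exists>b\<in>coboundaries 1 \<X>. \<beta> = (\<lambda>\<sigma>. b \<sigma> + \<alpha> \<sigma>))"
  unfolding H1.coset_eq by (auto simp: cochains_ops)

lemma cls_add:
  "\<alpha> \<in> cocycles 1 \<X> \<Longrightarrow> \<beta> \<in> cocycles 1 \<X> \<Longrightarrow>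
    cls \<alpha> \<oplus>\<^bsub>cohomology 1 \<X>\<^esub> cls \<beta> = cls (\<lambda>\<sigma>. \<alpha> \<sigma> + \<beta> \<sigma>)"
  using H1.Q_add[of \<alpha> \<beta>] unfolding cohomology_def cochains_ops .

lemma cls_smult:
  "\<alpha> \<in> cocycles 1 \<X> \<Longrightarrow> c \<odot>\<^bsub>cohomology 1 \<X>\<^esub> cls \<alpha> = cls (\<lambda>\<sigma>. c * \<alpha> \<sigma>)"
  using H1.Q_smult[of \<alpha> c] unfolding cohomology_def cochains_ops .

lemma zero_H1: "\<zero>\<^bsub>cohomology 1 \<X>\<^esub> = coboundaries 1 \<X>"
  unfolding cohomology_def by (rule H1.Q_simps)

lemma zero_H2: "\<zero>\<^bsub>cohomology 2 \<X>\<^esub> = coboundaries 2 \<X>"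
  by (simp add: cohomology_def subquotient_def quotient_module_def)

text \<open>\<open>cup\<close> is a union of cosets over all representatives of both classes. A
  change of representatives alters the product by a coboundary, so if one product is exact, all
  these cosets are the zero class.\<close>

lemma cup_zero_iff:
  assumes \<alpha>: "\<alpha> \<in> cocycles 1 \<X>" and \<beta>: "\<beta> \<in> cocycles 1 \<X>"
  shows "cup 1 1 \<X> (cls \<alpha>) (cls \<beta>) = coboundaries 2 \<X> \<longleftrightarrow> cochain_cup 1 1 \<X> \<alpha> \<beta> \<in> coboundaries 2 \<X>"
proof -
  have B2: "x \<in> coboundaries 2 \<X> \<Longrightarrow> y \<in> coboundaries 2 \<X> \<Longrightarrow> (\<lambda>\<sigma>. x \<sigma> + y \<sigma>) \<in> coboundaries 2 \<X>"
    "x \<in> coboundaries 2 \<X> \<Longrightarrow> (\<lambda>\<sigma>. c * x \<sigma>) \<in> coboundaries 2 \<X>" "(\<lambda>\<sigma>. 0) \<in> coboundaries 2 \<X>" for x y c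
    using subspace_coboundaries[of 2 \<X>] unfolding linear_subspace_def cochains_ops by auto
  let ?coset = "\<lambda>x. coboundaries 2 \<X> +>\<^bsub>cochains 2 \<X>\<^esub> x"
  have coset: "?coset x = {\<lambda>\<sigma>. b \<sigma> + x \<sigma> | b. b \<in> coboundaries 2 \<X>}" for x
    unfolding a_r_coset_def' cochains_ops by auto
  have self: "\<alpha> \<in> cls \<alpha>" "\<beta> \<in> cls \<beta>"
    using \<alpha> \<beta> H1.Zin(1) by (auto intro: H1.in_coset)
  have cup: "cup 1 1 \<X> (cls \<alpha>) (cls \<beta>) = (\<Union>\<alpha>'\<in>cls \<alpha>. \<Union>\<beta>'\<in>cls \<beta>. ?coset (cochain_cup 1 1 \<X> \<alpha>' \<beta>'))"
    by (simp add: cup_def numeral_2_eq_2 One_nat_def)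
  show ?thesis
  proof
    assume "cup 1 1 \<X> (cls \<alpha>) (cls \<beta>) = coboundaries 2 \<X>"
    then have "?coset (cochain_cup 1 1 \<X> \<alpha> \<beta>) \<subseteq> coboundaries 2 \<X>" using self cup by blast
    moreover have "cochain_cup 1 1 \<X> \<alpha> \<beta> \<in> ?coset (cochain_cup 1 1 \<X> \<alpha> \<beta>)"
      unfolding coset using B2(3) by (intro CollectI exI[of _ "\<lambda>_. 0"]) simp
    ultimately show "cochain_cup 1 1 \<X> \<alpha> \<beta> \<in> coboundaries 2 \<X>" by blast
  next
    assume *: "cochain_cup 1 1 \<X> \<alpha> \<beta> \<in> coboundaries 2 \<X>"
    have "?coset (cochain_cup 1 1 \<X> \<alpha>' \<beta>') = coboundaries 2 \<X>" if in\<alpha>: "\<alpha>' \<in> cls \<alpha>" and in\<beta>: "\<beta>' \<in> cls \<beta>" for \<alpha>' \<beta>'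
    proof -
      obtain a where a: "a \<in> coboundaries 1 \<X>" "\<alpha>' = (\<lambda>\<sigma>. a \<sigma> + \<alpha> \<sigma>)"
        using in\<alpha> unfolding in_cls_iff by blast
      obtain b where b: "b \<in> coboundaries 1 \<X>" "\<beta>' = (\<lambda>\<sigma>. b \<sigma> + \<beta> \<sigma>)"
        using in\<beta> unfolding in_cls_iff by blast
      have "\<beta>' \<in> cocycles 1 \<X>"
        using H1.Zin(3)[of b \<beta>] b \<beta> H1.BZ unfolding cochains_ops by auto
      then have "cochain_cup 1 1 \<X> a \<beta>' \<in> coboundaries 2 \<X>"
        by (rule cochain_cup_delta_left[OF a(1)])
      moreover have "cochain_cup 1 1 \<X> \<alpha> \<beta>' \<in> coboundaries 2 \<X>"
        unfolding b(2) cochain_cup_add by (rule B2(1)[OF cochain_cup_delta_right[OF \<alpha> b(1)] *])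
      ultimately have in2: "cochain_cup 1 1 \<X> \<alpha>' \<beta>' \<in> coboundaries 2 \<X>"
        unfolding a(2) cochain_cup_add by (rule B2(1))
      show ?thesis
      proof
        show "?coset (cochain_cup 1 1 \<X> \<alpha>' \<beta>') \<subseteq> coboundaries 2 \<X>"
          unfolding coset using B2(1)[OF _ in2] by blast
        show "coboundaries 2 \<X> \<subseteq> ?coset (cochain_cup 1 1 \<X> \<alpha>' \<beta>')"
        proof
          fix x assume x: "x \<in> coboundaries 2 \<X>"
          show "x \<in> ?coset (cochain_cup 1 1 \<X> \<alpha>' \<beta>')"
            unfolding coset using B2(1)[OF x B2(2)[OF in2, of "-1"]]
            by (intro CollectI exI[of _ "\<lambda>\<sigma>. x \<sigma> + -1 * cochain_cup 1 1 \<X> \<alpha>' \<beta>' \<sigma>"]) auto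
        qed
      qed
    qed
    with self show "cup 1 1 \<X> (cls \<alpha>) (cls \<beta>) = coboundaries 2 \<X>"
      unfolding cup by blast
  qed
qed

text \<open>On a path-connected space a cocycle of degree zero is a constant \<open>c\<close>, and
  multiplying by it scales the class. The image of the differential is therefore the line spanned by
  the class of \<open>\<alpha>\<close>.\<close>

lemma cup_1_0:
  assumes \<alpha>: "\<alpha> \<in> cocycles 1 \<X>"
  shows "cup 1 0 \<X> (cls \<alpha>) ` carrier (cohomology 0 \<X>) = range (\<lambda>c. cls (\<lambda>\<sigma>. c * \<alpha> \<sigma>))"
proof -
  \<comment> \<open>Zero is the only coboundary in degree zero, so the cosets are
    singletons.\<close>
  have H0: "carrier (cohomology 0 \<X>) = (\<lambda>z. {z}) ` cocycles 0 \<X>"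
    by (auto simp: cohomology_def subquotient_def quotient_module_def A_RCOSETS_def' a_r_coset_def' coboundaries_def cochains_def)
  have cup: "cup 1 0 \<X> (cls \<alpha>) {z} = cls (\<lambda>\<sigma>. c * \<alpha> \<sigma>)"
    if z: "\<And>x. x \<in> topspace \<X> \<Longrightarrow> z (point_simplex x) = c" for z c
  proof -
    have "cochain_cup 1 0 \<X> \<alpha>' z = (\<lambda>\<sigma>. c * \<alpha>' \<sigma>)" if "\<alpha>' \<in> carrier (cochains 1 \<X>)" for \<alpha>'
    proof (rule cochain_1_eqI)
      fix p assume p: "pathin \<X> p"
      then show "cochain_cup 1 0 \<X> \<alpha>' z (path_simplex p) = c * \<alpha>' (path_simplex p)"
        using singular_simplex_path_simplex[OF p] front_back_path_simplex[of p] z[OF pathin_end[OF p]]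
        by (simp add: cochain_cup_def)
    qed (use that in \<open>auto simp: cochains_def cochain_cup_def\<close>)
    moreover have "cls \<alpha> \<subseteq> carrier (cochains 1 \<X>)"
      unfolding H1.coset_eq using \<alpha> H1.Bin(1) H1.Zin(1) by auto
    ultimately have *: "cochain_cup 1 0 \<X> \<alpha>' z = (\<lambda>\<sigma>. c * \<alpha>' \<sigma>)" if "\<alpha>' \<in> cls \<alpha>" for \<alpha>'
      using that by blast
    have "cup 1 0 \<X> (cls \<alpha>) {z} = (\<Union>\<alpha>'\<in>cls \<alpha>. cls (\<lambda>\<sigma>. c * \<alpha>' \<sigma>))"
      by (simp add: cup_def * cong: SUP_cong)
    also have "\<dots> = cls (\<lambda>\<sigma>. c * \<alpha> \<sigma>)"
      using H1.coset_smult[of \<alpha> c] \<alpha> H1.Zin(1) unfolding cochains_ops by blast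
    finally show ?thesis .
  qed
  show ?thesis
  proof (intro equalityI subsetI)
    fix u assume "u \<in> cup 1 0 \<X> (cls \<alpha>) ` carrier (cohomology 0 \<X>)"
    then obtain z where z: "z \<in> cocycles 0 \<X>" "u = cup 1 0 \<X> (cls \<alpha>) {z}" using H0 by auto
    have "\<exists>c. \<forall>x\<in>topspace \<X>. z (point_simplex x) = c"
    proof (cases "topspace \<X> = {}")
      case False
      then obtain x0 where x0: "x0 \<in> topspace \<X>" by blast
      have "z (point_simplex x) = z (point_simplex x0)" if x: "x \<in> topspace \<X>" for x
      proof -
        obtain p where p: "pathin \<X> p" "p 0 = x0" "p 1 = x"
          using con x0 x unfolding path_connected_space_def by blast
        have "coboundary 0 \<X> z (path_simplex p) = 0" using z(1) by (simp add: cocycles_def)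
        then show ?thesis using coboundary_0_path[OF p(1), of z] p by simp
      qed
      then show ?thesis by blast
    qed auto
    then obtain c where "\<And>x. x \<in> topspace \<X> \<Longrightarrow> z (point_simplex x) = c" by blast
    from cup[of z c, OF this] z(2) show "u \<in> range (\<lambda>c. cls (\<lambda>\<sigma>. c * \<alpha> \<sigma>))" by blast
  next
    fix u assume "u \<in> range (\<lambda>c. cls (\<lambda>\<sigma>. c * \<alpha> \<sigma>))"
    then obtain c where u: "u = cls (\<lambda>\<sigma>. c * \<alpha> \<sigma>)" by blast
    define z where "z = (\<lambda>\<sigma>. if singular_simplex 0 \<X> \<sigma> then c else 0)"
    have zc: "z (point_simplex x) = c" if "x \<in> topspace \<X>" for x
      using singular_simplex_point_simplex[OF that] by (simp add: z_def)
    have "coboundary 0 \<X> z = (\<lambda>_. 0)"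
    proof (rule cochain_1_eqI[of _ \<X>])
      show "coboundary 0 \<X> z (path_simplex p) = 0" if "pathin \<X> p" for p
        using that zc pathin_start[OF that] pathin_end[OF that] by (simp add: coboundary_0_path)
    qed (auto simp: cochains_def coboundary_def One_nat_def)
    then have "z \<in> cocycles 0 \<X>" by (auto simp: cocycles_def cochains_def z_def)
    then show "u \<in> cup 1 0 \<X> (cls \<alpha>) ` carrier (cohomology 0 \<X>)"
      unfolding u H0 using cup[of z c, OF zc] by (intro image_eqI[of _ _ "{z}"]) auto
  qed
qed

text \<open>The line spanned by \<open>a\<close> lies in the kernel of the differential and is
  exactly its incoming image; the partner provides a class in the kernel but off that line.\<close>

theorem resonance_variety_eqI:
  assumes partner: "\<And>A. path_cocycle \<X> (+) A \<Longrightarrow> \<exists>B. path_cocycle \<X> (+) B \<and> cup_exact \<X> A B \<and>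
    (\<forall>c f. \<exists>p. pathin \<X> p \<and> B p \<noteq> c * A p + (f (p 1) - f (p 0)))"
  shows "resonance_variety 1 1 \<X> = carrier (cohomology 1 \<X>)"
proof -
  have "vdim (resonance_cohomology 1 \<X> a) \<ge> enat 1" if a: "a \<in> carrier (cohomology 1 \<X>)" for a
  proof -
    obtain \<alpha> where \<alpha>: "\<alpha> \<in> cocycles 1 \<X>" "a = cls \<alpha>" using a carrier_H1 by auto
    define Z where "Z = {u \<in> carrier (cohomology 1 \<X>). cup 1 1 \<X> a u = \<zero>\<^bsub>cohomology 2 \<X>\<^esub>}"
    define B where "B = cup 1 0 \<X> a ` carrier (cohomology 0 \<X>)"
    have Zcls: "cls \<beta> \<in> Z \<longleftrightarrow> cochain_cup 1 1 \<X> \<alpha> \<beta> \<in> coboundaries 2 \<X>" if "\<beta> \<in> cocycles 1 \<X>" for \<beta>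
      using that cup_zero_iff[OF \<alpha>(1) that] by (auto simp: Z_def carrier_H1 zero_H2 \<alpha>(2))
    have ZE: "\<exists>\<beta>\<in>cocycles 1 \<X>. u = cls \<beta>" if "u \<in> Z" for u
      using that by (auto simp: Z_def carrier_H1)
    have Beq: "B = range (\<lambda>c. cls (\<lambda>\<sigma>. c * \<alpha> \<sigma>))"
      unfolding B_def \<alpha>(2) by (rule cup_1_0[OF \<alpha>(1)])
    have Zc: "(\<lambda>\<sigma>. c * \<beta> \<sigma>) \<in> cocycles 1 \<X>" if "\<beta> \<in> cocycles 1 \<X>" for c \<beta>
      using H1.Zin(4)[OF that, of c] unfolding cochains_ops .
    have Za: "(\<lambda>\<sigma>. \<beta> \<sigma> + \<gamma> \<sigma>) \<in> cocycles 1 \<X>" if "\<beta> \<in> cocycles 1 \<X>" "\<gamma> \<in> cocycles 1 \<X>" for \<beta> \<gamma>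
      using H1.Zin(3)[OF that] unfolding cochains_ops .
    have B2: "x \<in> coboundaries 2 \<X> \<Longrightarrow> y \<in> coboundaries 2 \<X> \<Longrightarrow> (\<lambda>\<sigma>. x \<sigma> + y \<sigma>) \<in> coboundaries 2 \<X>"
      "x \<in> coboundaries 2 \<X> \<Longrightarrow> (\<lambda>\<sigma>. c * x \<sigma>) \<in> coboundaries 2 \<X>" for x y c
      using subspace_coboundaries[of 2 \<X>] unfolding linear_subspace_def cochains_ops by auto
    have zero: "cls (\<lambda>\<sigma>. 0) = \<zero>\<^bsub>cohomology 1 \<X>\<^esub>"
      using H1.coset_zero unfolding zero_H1 cochains_ops .
    have BZ: "B \<subseteq> Z"
    proof -
      have "cochain_cup 1 1 \<X> \<alpha> (\<lambda>\<sigma>. c * \<alpha> \<sigma>) \<in> coboundaries 2 \<X>" for c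
        using \<alpha>(1) unfolding cocycles_1_iff
        by (intro cup_exact_coboundary cup_exact_delta[where f = "\<lambda>_. 0" and c = c]) auto
      then show ?thesis using Zcls Zc[OF \<alpha>(1)] by (auto simp: Beq)
    qed
    have "linear_subspace (cohomology 1 \<X>) B"
      unfolding linear_subspace_def
    proof (intro conjI ballI allI)
      show "B \<subseteq> carrier (cohomology 1 \<X>)" using BZ by (auto simp: Z_def)
      show "\<zero>\<^bsub>cohomology 1 \<X>\<^esub> \<in> B"
        unfolding Beq zero[symmetric] by (intro image_eqI[of _ _ 0]) auto
      show "x \<oplus>\<^bsub>cohomology 1 \<X>\<^esub> y \<in> B" if "x \<in> B" "y \<in> B" for x y
        using that Zc[OF \<alpha>(1)] by (auto simp: Beq cls_add simp flip: distrib_right)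
      show "c \<odot>\<^bsub>cohomology 1 \<X>\<^esub> x \<in> B" if "x \<in> B" for c x
        using that Zc[OF \<alpha>(1)] by (auto simp: Beq cls_smult simp flip: mult.assoc)
    qed
    moreover have "linear_subspace (cohomology 1 \<X>) Z"
      unfolding linear_subspace_def
    proof (intro conjI ballI allI)
      show "Z \<subseteq> carrier (cohomology 1 \<X>)" by (auto simp: Z_def)
      show "\<zero>\<^bsub>cohomology 1 \<X>\<^esub> \<in> Z"
        using BZ calculation by (auto simp: linear_subspace_def)
      show "x \<oplus>\<^bsub>cohomology 1 \<X>\<^esub> y \<in> Z" if xy: "x \<in> Z" "y \<in> Z" for x y
      proof -
        obtain \<beta> \<gamma> where *: "\<beta> \<in> cocycles 1 \<X>" "x = cls \<beta>" "\<gamma> \<in> cocycles 1 \<X>" "y = cls \<gamma>"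
          using ZE[OF xy(1)] ZE[OF xy(2)] by blast
        then show ?thesis
          using xy Zcls B2(1) by (simp add: cls_add Za cochain_cup_add)
      qed
      show "c \<odot>\<^bsub>cohomology 1 \<X>\<^esub> x \<in> Z" if x: "x \<in> Z" for c x
      proof -
        obtain \<beta> where *: "\<beta> \<in> cocycles 1 \<X>" "x = cls \<beta>" using ZE[OF x] by blast
        then show ?thesis
          using x Zcls B2(2) by (simp add: cls_smult Zc cochain_cup_cmult)
      qed
    qed
    ultimately interpret R: subquotient_space "cohomology 1 \<X>" Z B
      using BZ by unfold_locales
    obtain F where F: "path_cocycle \<X> (+) F" "cup_exact \<X> (\<lambda>p. \<alpha> (path_simplex p)) F"
      and nF: "\<And>c f. \<exists>p. pathin \<X> p \<and> F p \<noteq> c * \<alpha> (path_simplex p) + (f (p 1) - f (p 0))"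
      using partner \<alpha>(1) unfolding cocycles_1_iff by blast
    define \<beta> where "\<beta> = path_cochain \<X> F"
    have \<beta>: "\<beta> \<in> cocycles 1 \<X>" and \<beta>p: "\<And>p. pathin \<X> p \<Longrightarrow> \<beta> (path_simplex p) = F p"
      unfolding \<beta>_def using path_cochain_cocycle[OF F(1)] by blast+
    obtain C where "path_cocycle \<X> heisenberg (\<lambda>p. (\<alpha> (path_simplex p), F p, C p))"
      using F(2) unfolding cup_exact_def by blast
    then have "cup_exact \<X> (\<lambda>p. \<alpha> (path_simplex p)) (\<lambda>p. \<beta> (path_simplex p))"
      unfolding cup_exact_def by (intro exI[of _ C]) (erule path_cocycle_eq, simp add: \<beta>p)
    then have "cls \<beta> \<in> Z" using Zcls[OF \<beta>] cup_exact_coboundary by blast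
    moreover have "cls \<beta> \<notin> B"
    proof
      assume "cls \<beta> \<in> B"
      then obtain c where "cls \<beta> = cls (\<lambda>\<sigma>. c * \<alpha> \<sigma>)" by (auto simp: Beq)
      moreover have "\<beta> \<in> cls \<beta>" using \<beta> H1.Zin(1) by (auto intro: H1.in_coset)
      ultimately have "\<beta> \<in> cls (\<lambda>\<sigma>. c * \<alpha> \<sigma>)" by simp
      then obtain b where b: "b \<in> coboundaries 1 \<X>" "\<beta> = (\<lambda>\<sigma>. b \<sigma> + c * \<alpha> \<sigma>)"
        unfolding in_cls_iff by blast
      then obtain f where f: "\<And>p. pathin \<X> p \<Longrightarrow> b (path_simplex p) = f (p 1) - f (p 0)"
        unfolding coboundaries_1_iff by blast
      obtain p where p: "pathin \<X> p" "F p \<noteq> c * \<alpha> (path_simplex p) + (f (p 1) - f (p 0))"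
        using nF by blast
      then show False using \<beta>p[OF p(1)] f[OF p(1)] b(2) by (simp add: algebra_simps)
    qed
    ultimately have "vdim R.Q \<ge> enat 1" by (rule R.vdim_ge_1_if)
    moreover have "resonance_cohomology 1 \<X> a = R.Q"
      by (simp add: resonance_cohomology_def Z_def B_def numeral_2_eq_2 One_nat_def)
    ultimately show ?thesis by simp
  qed
  then show ?thesis by (auto simp: resonance_variety_def)
qed

end

section \<open>The local system of a character\<close>

definition path_homotopic :: "'a topology \<Rightarrow> (real \<Rightarrow> 'a) \<Rightarrow> (real \<Rightarrow> 'a) \<Rightarrow> bool" where
  "path_homotopic \<X> p q \<longleftrightarrow> homotopic_with (\<lambda>r. r 0 = p 0 \<and> r 1 = p 1) (top_of_set {0..1}) \<X> p q"

lemma path_homotopicD: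
  assumes "path_homotopic \<X> p q"
  shows "pathin \<X> p" "pathin \<X> q" "q 0 = p 0" "q 1 = p 1"
  using homotopic_with_imp_continuous_maps[OF assms[unfolded path_homotopic_def]]
    homotopic_with_imp_property[OF assms[unfolded path_homotopic_def]]
  by (auto simp: pathin_def)

lemma path_homotopic_refl: "pathin \<X> p \<Longrightarrow> path_homotopic \<X> p p"
  by (simp add: path_homotopic_def pathin_def)

lemma path_homotopic_sym: "path_homotopic \<X> p q \<Longrightarrow> path_homotopic \<X> q p"
  using path_homotopicD[of \<X> p q] unfolding path_homotopic_def by (simp add: homotopic_with_sym)

lemma path_homotopic_trans [trans]: "path_homotopic \<X> p q \<Longrightarrow> path_homotopic \<X> q r \<Longrightarrow> path_homotopic \<X> p r"
  using path_homotopicD[of \<X> p q] unfolding path_homotopic_def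
  by (auto intro: homotopic_with_trans)

lemma path_homotopic_eq:
  assumes "pathin \<X> p" "\<And>t. 0 \<le> t \<Longrightarrow> t \<le> 1 \<Longrightarrow> p t = q t"
  shows "path_homotopic \<X> p q"
  unfolding path_homotopic_def
  by (rule homotopic_with_equal) (use assms in \<open>auto simp: pathin_def\<close>)

lemma path_class_eq:
  assumes "path_homotopic \<X> p q" shows "path_class \<X> p = path_class \<X> q"
proof -
  have "path_class \<X> r = {q. path_homotopic \<X> r q}" for r
    by (simp add: path_class_def path_homotopic_def)
  then show ?thesis
    using assms path_homotopic_sym path_homotopic_trans by blast
qed

lemma in_path_class: "q \<in> path_class \<X> p \<longleftrightarrow> path_homotopic \<X> p q"
  by (simp add: path_class_def path_homotopic_def)

text \<open>The straight-line homotopy in the parameter domain, pushed forward by \<open>s\<close>.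
  It is used on the interval for reparametrisations, on \<open>tri\<close> for the edge relation and
  on a ball to straighten paths.\<close>

lemma path_homotopic_convex:
  fixes D :: "'v::real_normed_vector set"
  assumes D: "convex D" and s: "continuous_map (top_of_set D) \<X> s"
    and f: "continuous_on {0..1} f" "f ` {0..1} \<subseteq> D" and g: "continuous_on {0..1} g" "g ` {0..1} \<subseteq> D"
    and ends: "f 0 = g 0" "f 1 = g 1"
  shows "path_homotopic \<X> (s \<circ> f) (s \<circ> g)"
  unfolding path_homotopic_def homotopic_with_def
proof (intro exI conjI)
  let ?h = "\<lambda>z. (1 - fst z) *\<^sub>R f (snd z) + fst z *\<^sub>R g (snd z)"
  have "continuous_on ({0..1} \<times> {0..1}) ?h"
    by (intro continuous_intros continuous_on_compose2[OF f(1)] continuous_on_compose2[OF g(1)]) auto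
  moreover have "?h ` ({0..1} \<times> {0..1}) \<subseteq> D"
    using convexD_alt[OF D] f(2) g(2) by (auto simp: image_subset_iff)
  ultimately have "continuous_map (prod_topology (top_of_set {0..1}) (top_of_set {0..1})) (top_of_set D) ?h"
    by (auto simp: prod_topology_subtopology_eu)
  from continuous_map_compose[OF this s]
  show "continuous_map (prod_topology (top_of_set {0..1}) (top_of_set {0..1})) \<X> (s \<circ> ?h)" .
qed (use ends in \<open>auto simp flip: scaleR_add_left\<close>)

lemma path_homotopic_join:
  assumes p: "path_homotopic \<X> p p'" and q: "path_homotopic \<X> q q'" and pq: "p 1 = q 0"
  shows "path_homotopic \<X> (path_join p q) (path_join p' q')"
proof -
  let ?I = "top_of_set {0..1::real}"
  obtain h :: "real \<times> real \<Rightarrow> 'a" where h: "continuous_map (prod_topology ?I ?I) \<X> h"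
    "\<forall>x. h (0, x) = p x" "\<forall>x. h (1, x) = p' x" "\<forall>t\<in>{0..1}. h (t, 0) = p 0 \<and> h (t, 1) = p 1"
    using p unfolding path_homotopic_def homotopic_with_def by blast
  obtain k :: "real \<times> real \<Rightarrow> 'a" where k: "continuous_map (prod_topology ?I ?I) \<X> k"
    "\<forall>x. k (0, x) = q x" "\<forall>x. k (1, x) = q' x" "\<forall>t\<in>{0..1}. k (t, 0) = q 0 \<and> k (t, 1) = q 1"
    using q unfolding path_homotopic_def homotopic_with_def by blast
  define H where "H = (\<lambda>z. if snd z \<le> 1/2 then h (fst z, 2 * snd z) else k (fst z, 2 * snd z - 1))"
  have S: "prod_topology ?I ?I = top_of_set ({0..1} \<times> {0..1})" by (simp add: prod_topology_subtopology_eu)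
  have "continuous_map (prod_topology ?I ?I) \<X> H"
    unfolding H_def S
  proof (rule continuous_map_cases_le)
    have 1: "continuous_map (top_of_set ({0..1} \<times> {0..1/2})) \<X> (h \<circ> (\<lambda>z. (fst z, 2 * snd z)))"
      by (rule continuous_map_compose[OF _ h(1)[unfolded S]]) (auto intro!: continuous_intros)
    have 2: "continuous_map (top_of_set ({0..1} \<times> {1/2..1})) \<X> (k \<circ> (\<lambda>z. (fst z, 2 * snd z - 1)))"
      by (rule continuous_map_compose[OF _ k(1)[unfolded S]]) (auto intro!: continuous_intros)
    have "{0..1} \<times> {0..1} \<inter> {x \<in> topspace (top_of_set ({0..1::real} \<times> {0..1::real})). snd x \<le> 1/2} = {0..1} \<times> {0..1/2}"
      "{0..1} \<times> {0..1} \<inter> {x \<in> topspace (top_of_set ({0..1::real} \<times> {0..1::real})). 1/2 \<le> snd x} = {0..1} \<times> {1/2..1}" by auto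
    with 1 2 show "continuous_map (subtopology (top_of_set ({0..1} \<times> {0..1})) {x \<in> topspace (top_of_set ({0..1} \<times> {0..1})). snd x \<le> 1/2}) \<X> (\<lambda>z. h (fst z, 2 * snd z))"
      "continuous_map (subtopology (top_of_set ({0..1} \<times> {0..1})) {x \<in> topspace (top_of_set ({0..1} \<times> {0..1})). 1/2 \<le> snd x}) \<X> (\<lambda>z. k (fst z, 2 * snd z - 1))"
      unfolding subtopology_subtopology by (simp_all only: o_def)
  next
    fix z :: "real \<times> real" assume z: "z \<in> topspace (top_of_set ({0..1} \<times> {0..1}))" "snd z = 1/2"
    then have "2 * snd z = 1" "fst z \<in> {0..1}" by auto
    then show "h (fst z, 2 * snd z) = k (fst z, 2 * snd z - 1)"
      using h(4) k(4) pq by simp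
  qed (auto intro!: continuous_intros)
  then show ?thesis
    unfolding path_homotopic_def homotopic_with_def
    by (intro exI[of _ H] conjI) (use h k in \<open>auto simp: H_def path_join_def\<close>)
qed

lemma path_homotopic_reparam:
  assumes p: "pathin \<X> p"
    and f: "continuous_on {0..1} f" "f ` {0..1} \<subseteq> {0..1}" and g: "continuous_on {0..1} g" "g ` {0..1} \<subseteq> {0..1}"
    and ends: "f 0 = g 0" "f 1 = g 1"
    and p1: "\<And>t. 0 \<le> t \<Longrightarrow> t \<le> 1 \<Longrightarrow> p1 t = p (f t)" and p2: "\<And>t. 0 \<le> t \<Longrightarrow> t \<le> 1 \<Longrightarrow> p2 t = p (g t)"
  shows "path_homotopic \<X> p1 p2"
proof -
  have "path_homotopic \<X> (p \<circ> f) (p \<circ> g)"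
    by (rule path_homotopic_convex[of "{0..1}"]) (use assms in \<open>auto simp: pathin_def\<close>)
  moreover have "path_homotopic \<X> (p \<circ> f) p1"
    using p1 by (intro path_homotopic_eq pathin_compose_left[OF p f]) auto
  moreover have "path_homotopic \<X> (p \<circ> g) p2"
    using p2 by (intro path_homotopic_eq pathin_compose_left[OF p g]) auto
  ultimately show ?thesis by (meson path_homotopic_sym path_homotopic_trans)
qed

lemma path_join_assoc:
  assumes "pathin \<X> p" "pathin \<X> q" "pathin \<X> r" "p 1 = q 0" "q 1 = r 0"
  shows "path_homotopic \<X> (path_join (path_join p q) r) (path_join p (path_join q r))"
proof (rule path_homotopic_reparam)
  show "pathin \<X> (path_join p (path_join q r))"
    using assms by (intro pathin_path_join) auto
  \<comment> \<open>The piecewise linear map sends [0,1/4], [1/4,1/2], [1/2,1] onto [0,1/2],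
    [1/2,3/4], [3/4,1]. Its slopes 2, 1, 1/2 decrease, so it is the minimum of its three linear
    parts.\<close>
  let ?f = "\<lambda>t::real. min (2 * t) (min (t + 1/4) ((t + 1) / 2))"
  show "continuous_on {0..1} ?f" by (intro continuous_intros) auto
  show "path_join (path_join p q) r t = path_join p (path_join q r) (?f t)" if "0 \<le> t" "t \<le> 1" for t
  proof -
    consider "t \<le> 1/4" | "1/4 < t" "t \<le> 1/2" | "1/2 < t" by linarith
    then show ?thesis
    proof cases
      case 1
      then have "?f t = 2 * t" by auto
      with 1 show ?thesis by (simp add: path_join_def)
    next
      case 2
      then have "?f t = t + 1/4" by auto
      with 2 show ?thesis by (simp add: path_join_def algebra_simps)
    next
      case 3
      then have "?f t = (t + 1) / 2" by auto
      with 3 show ?thesis by (simp add: path_join_def)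
    qed
  qed
qed (auto simp: min_def)

text \<open>The concatenation runs through \<open>b\<close> at the parameter
  \<open>\<bar>2 * t - 1\<bar>\<close>, which is contracted to the constant 1 inside the
  interval.\<close>

lemma path_join_rev:
  assumes "pathin \<X> b"
  shows "path_homotopic \<X> (path_join (path_rev b) b) (\<lambda>_. b 1)"
  by (rule path_homotopic_reparam[OF assms, where f = "\<lambda>t. \<bar>2 * t - 1\<bar>" and g = "\<lambda>_. 1"])
    (auto simp: path_join_def path_rev_def intro!: continuous_intros arg_cong[of _ _ b])

lemma path_join_const:
  assumes "pathin \<X> q"
  shows "path_homotopic \<X> (path_join (\<lambda>_. q 0) q) q"
  by (rule path_homotopic_reparam[OF assms, where f = "\<lambda>t. max 0 (2 * t - 1)" and g = "\<lambda>t. t"])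
    (auto simp: path_join_def intro!: continuous_intros arg_cong[of _ _ q])

lemma path_join_tri:
  assumes s: "continuous_map (top_of_set tri) \<X> s"
  shows "path_homotopic \<X> (path_join (\<lambda>t. s (t, 0)) (\<lambda>t. s (1 - t, t))) (\<lambda>t. s (0, t))"
proof -
  \<comment> \<open>This runs along the two edges from \<open>(0,0)\<close> through
    \<open>(1,0)\<close> to \<open>(0,1)\<close>, with the corner at time 1/2; the competing path is
    the third edge.\<close>
  let ?f = "\<lambda>t::real. (min (2 * t) (2 - 2 * t), max 0 (2 * t - 1))"
  have "path_homotopic \<X> (s \<circ> ?f) (s \<circ> (\<lambda>t. (0, t)))"
    by (rule path_homotopic_convex[OF convex_tri s]) (auto simp: tri_def intro!: continuous_intros)
  moreover have "s \<circ> ?f = path_join (\<lambda>t. s (t, 0)) (\<lambda>t. s (1 - t, t))"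
    by (auto simp: path_join_def fun_eq_iff intro!: arg_cong[of _ _ s])
  ultimately show ?thesis by (simp add: o_def)
qed

lemma Units_complex_field: "Units complex_field = - {0}"
proof -
  have "\<exists>y. y * x = 1 \<and> x * y = 1" if "x \<noteq> 0" for x :: complex
    using that by (intro exI[of _ "inverse x"]) simp
  then show ?thesis by (auto simp: Units_def)
qed

section \<open>Parallel transport of a character\<close>

context
  fixes \<X> :: "'a topology" and x0 :: 'a and \<rho> :: "(real \<Rightarrow> 'a) set \<Rightarrow> complex"
  assumes con: "path_connected_space \<X>" and x0: "x0 \<in> topspace \<X>" and \<rho>: "\<rho> \<in> characters \<X> x0"
begin

lemma base_path:
  assumes "x \<in> topspace \<X>"
  shows "pathin \<X> (base_path \<X> x0 x)" "base_path \<X> x0 x 0 = x0" "base_path \<X> x0 x 1 = x"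
proof -
  have "\<exists>g. pathin \<X> g \<and> g 0 = x0 \<and> g 1 = x"
    using con x0 assms unfolding path_connected_space_def by blast
  from someI_ex[OF this] show "pathin \<X> (base_path \<X> x0 x)" "base_path \<X> x0 x 0 = x0" "base_path \<X> x0 x 1 = x"
    unfolding base_path_def by blast+
qed

definition closed_up :: "(real \<Rightarrow> 'a) \<Rightarrow> real \<Rightarrow> 'a" where
  "closed_up p = path_join (base_path \<X> x0 (p 0)) (path_join p (path_rev (base_path \<X> x0 (p 1))))"

lemma closed_up_loop:
  assumes "pathin \<X> p"
  shows "pathin \<X> (closed_up p)" "closed_up p 0 = x0" "closed_up p 1 = x0"
  using base_path[OF pathin_start[OF assms]] base_path[OF pathin_end[OF assms]] assms
  by (auto simp: closed_up_def intro!: pathin_path_join pathin_path_rev)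

lemma transport_closed_up: "transport \<X> x0 \<rho> p = \<rho> (path_class \<X> (closed_up p))"
  by (simp add: transport_def closed_up_def)

lemma closed_up_in_carrier:
  "pathin \<X> p \<Longrightarrow> path_class \<X> (closed_up p) \<in> carrier (fundamental_group \<X> x0)"
  using closed_up_loop by (auto simp: fundamental_group_def)

lemma transport_nonzero: "pathin \<X> p \<Longrightarrow> transport \<X> x0 \<rho> p \<noteq> 0"
  using \<rho> closed_up_in_carrier[of p] unfolding characters_def transport_closed_up
  by (auto simp: hom_def units_of_def Units_complex_field)

text \<open>The product is defined as a union over all representatives of both classes; homotopic
  factors have homotopic joins, so all members of the union are equal.\<close>

lemma fundamental_group_mult:
  assumes "pathin \<X> p" "pathin \<X> q" "p 1 = q 0"
  shows "path_class \<X> p \<otimes>\<^bsub>fundamental_group \<X> x0\<^esub> path_class \<X> q = path_class \<X> (path_join p q)"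
proof -
  have eq: "path_class \<X> (path_join p' q') = path_class \<X> (path_join p q)"
    if "p' \<in> path_class \<X> p" "q' \<in> path_class \<X> q" for p' q'
    using path_class_eq[OF path_homotopic_join[of \<X> p p' q q']] that assms(3) by (simp add: in_path_class)
  have pq: "p \<in> path_class \<X> p" "q \<in> path_class \<X> q"
    using assms path_homotopic_refl in_path_class by blast+
  have "(\<Union>p'\<in>path_class \<X> p. \<Union>q'\<in>path_class \<X> q. path_class \<X> (path_join p' q')) = path_class \<X> (path_join p q)"
    (is "?l = ?r")
  proof
    show "?l \<subseteq> ?r" by (intro UN_least equalityD1[OF eq])
    show "?r \<subseteq> ?l" by (rule order_trans[OF UN_upper[OF pq(2)] UN_upper[OF pq(1)]])
  qed
  then show ?thesis by (simp add: fundamental_group_def)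
qed

text \<open>With base paths a, b, c to the three vertices and edges p, q, r, the product (a p
  b^-1)(b q c^-1) is reassociated, the middle pair b^-1 b is contracted, and p q is replaced by
  r.\<close>

lemma closed_up_tri:
  assumes s: "continuous_map (top_of_set tri) \<X> s"
  shows "path_homotopic \<X> (path_join (closed_up (\<lambda>t. s (t, 0))) (closed_up (\<lambda>t. s (1 - t, t)))) (closed_up (\<lambda>t. s (0, t)))"
proof -
  let ?p = "\<lambda>t. s (t, 0)" and ?q = "\<lambda>t. s (1 - t, t)" and ?r = "\<lambda>t. s (0, t)"
  note [simp] = edges_pathin[OF s]
  let ?a = "base_path \<X> x0 (s (0, 0))" and ?b = "base_path \<X> x0 (s (1, 0))" and ?c = "base_path \<X> x0 (s (0, 1))"
  have top: "s (0, 0) \<in> topspace \<X>" "s (1, 0) \<in> topspace \<X>" "s (0, 1) \<in> topspace \<X>"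
    using pathin_start[of \<X> ?p] pathin_end[of \<X> ?p] pathin_end[of \<X> ?r] by auto
  note [simp] = base_path[OF top(1)] base_path[OF top(2)] base_path[OF top(3)]
  note [simp] = pathin_path_join pathin_path_rev path_homotopic_refl
  let ?tail = "path_join ?q (path_rev ?c)"
  have "path_homotopic \<X> (path_join (path_rev ?b) (path_join ?b ?tail)) (path_join (path_join (path_rev ?b) ?b) ?tail)"
    by (rule path_homotopic_sym[OF path_join_assoc]) simp_all
  also have "path_homotopic \<X> \<dots> (path_join (\<lambda>_. ?b 1) ?tail)"
    by (rule path_homotopic_join[OF path_join_rev]) simp_all
  also have "path_homotopic \<X> \<dots> ?tail"
  proof -
    have "?tail 0 = ?b 1" "pathin \<X> ?tail" by simp_all
    then show ?thesis using path_join_const[of \<X> ?tail] by simp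
  qed
  finally have tail: "path_homotopic \<X> (path_join (path_rev ?b) (path_join ?b ?tail)) ?tail" .
  have "path_homotopic \<X> (path_join (path_join ?p (path_rev ?b)) (path_join ?b ?tail))
      (path_join ?p (path_join (path_rev ?b) (path_join ?b ?tail)))"
    by (rule path_join_assoc) simp_all
  also have "path_homotopic \<X> \<dots> (path_join ?p ?tail)"
    by (rule path_homotopic_join[OF _ tail]) simp_all
  also have "path_homotopic \<X> \<dots> (path_join (path_join ?p ?q) (path_rev ?c))"
    by (rule path_homotopic_sym[OF path_join_assoc]) simp_all
  also have "path_homotopic \<X> \<dots> (path_join ?r (path_rev ?c))"
    by (rule path_homotopic_join[OF path_join_tri[OF s]]) simp_all
  finally have mid: "path_homotopic \<X> (path_join (path_join ?p (path_rev ?b)) (path_join ?b ?tail)) (path_join ?r (path_rev ?c))" .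
  have "path_homotopic \<X> (path_join (path_join ?a (path_join ?p (path_rev ?b))) (path_join ?b ?tail))
      (path_join ?a (path_join (path_join ?p (path_rev ?b)) (path_join ?b ?tail)))"
    by (rule path_join_assoc) simp_all
  also have "path_homotopic \<X> \<dots> (path_join ?a (path_join ?r (path_rev ?c)))"
    by (rule path_homotopic_join[OF _ mid]) simp_all
  finally show ?thesis by (simp add: closed_up_def)
qed

text \<open>This removes the chosen base paths from the rest of the argument: the character enters
  twisted homology as a multiplicative cocycle with non-zero values.\<close>

lemma path_cocycle_transport: "path_cocycle \<X> (*) (transport \<X> x0 \<rho>)"
  unfolding path_cocycle_def
proof (intro conjI allI impI; (elim conjE)?)
  fix p q assume p: "pathin \<X> p" and pq: "\<forall>t\<in>{0..1}. p t = q t"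
  have "path_homotopic \<X> (closed_up p) (closed_up q)"
    using pq by (intro path_homotopic_eq closed_up_loop p) (auto simp: closed_up_def path_join_def)
  then show "transport \<X> x0 \<rho> p = transport \<X> x0 \<rho> q"
    unfolding transport_closed_up by (simp add: path_class_eq)
next
  fix s assume s: "continuous_map (top_of_set tri) \<X> s"
  let ?p = "\<lambda>t. s (t, 0)" and ?q = "\<lambda>t. s (1 - t, t)" and ?r = "\<lambda>t. s (0, t)"
  note e = edges_pathin[OF s]
  let ?G = "fundamental_group \<X> x0"
  have "\<rho> (path_class \<X> (closed_up ?p) \<otimes>\<^bsub>?G\<^esub> path_class \<X> (closed_up ?q)) =
      \<rho> (path_class \<X> (closed_up ?p)) * \<rho> (path_class \<X> (closed_up ?q))"
    using \<rho> closed_up_in_carrier[OF e(1)] closed_up_in_carrier[OF e(2)]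
    by (auto simp: characters_def hom_def units_of_def)
  moreover have "path_class \<X> (closed_up ?p) \<otimes>\<^bsub>?G\<^esub> path_class \<X> (closed_up ?q) =
      path_class \<X> (path_join (closed_up ?p) (closed_up ?q))"
    by (rule fundamental_group_mult) (use closed_up_loop e in auto)
  moreover have "\<dots> = path_class \<X> (closed_up ?r)"
    by (rule path_class_eq[OF closed_up_tri[OF s]])
  ultimately show "transport \<X> x0 \<rho> ?p * transport \<X> x0 \<rho> ?q = transport \<X> x0 \<rho> ?r"
    by (simp add: transport_closed_up)
qed

end

section \<open>Twisted homology in degree one\<close>

lemma chains_ops:
  "c \<oplus>\<^bsub>complex_chains n \<X>\<^esub> d = c + d" "z \<odot>\<^bsub>complex_chains n \<X>\<^esub> c = Poly_Mapping.map ((*) z) c"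
  "\<zero>\<^bsub>complex_chains n \<X>\<^esub> = 0"
  by (simp_all add: complex_chains_def)

lemma chains_carrier: "c \<in> carrier (complex_chains n \<X>) \<longleftrightarrow> Poly_Mapping.keys c \<subseteq> singular_simplex_set n \<X>"
  by (simp add: complex_chains_def)

definition face_term where
  "face_term T n \<sigma> = (\<Sum>i\<le>n. Poly_Mapping.single (singular_face n i \<sigma>)
      ((- 1) ^ i * (if i = 0 then T (initial_edge \<sigma>) else 1 :: complex)))"

lemma map_times_sum: "Poly_Mapping.map ((*) z) (sum f A) = (\<Sum>a\<in>A. Poly_Mapping.map ((*) z) (f a))" for z :: complex
  by (rule poly_mapping_eqI) (simp add: lookup_sum sum_distrib_left)

lemma map_times_single: "Poly_Mapping.map ((*) z) (Poly_Mapping.single k x) = Poly_Mapping.single k (z * x)" for z :: complex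
  by (rule poly_mapping_eqI) (simp add: lookup_single when_def)

text \<open>The defining sum runs over the keys, and keys can disappear when chains are added. Sums
  over a common finite superset make linearity visible.\<close>

lemma twisted_boundary_superset:
  assumes "n > 0" "finite K" "Poly_Mapping.keys c \<subseteq> K"
  shows "twisted_boundary T n c = (\<Sum>\<sigma>\<in>K. Poly_Mapping.map ((*) (Poly_Mapping.lookup c \<sigma>)) (face_term T n \<sigma>))"
proof -
  have "twisted_boundary T n c = (\<Sum>\<sigma>\<in>Poly_Mapping.keys c. Poly_Mapping.map ((*) (Poly_Mapping.lookup c \<sigma>)) (face_term T n \<sigma>))"
    using assms(1) by (simp add: twisted_boundary_def face_term_def map_times_sum map_times_single mult.commute)
  also have "\<dots> = (\<Sum>\<sigma>\<in>K. Poly_Mapping.map ((*) (Poly_Mapping.lookup c \<sigma>)) (face_term T n \<sigma>))"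
    using assms by (intro sum.mono_neutral_left) (auto simp: in_keys_iff intro!: poly_mapping_eqI)
  finally show ?thesis .
qed

lemma twisted_boundary_add:
  "twisted_boundary T n (c + d) = twisted_boundary T n c + twisted_boundary T n d"
proof (cases "n = 0")
  case False
  let ?K = "Poly_Mapping.keys c \<union> Poly_Mapping.keys d"
  have K: "finite ?K" "Poly_Mapping.keys c \<subseteq> ?K" "Poly_Mapping.keys d \<subseteq> ?K" "Poly_Mapping.keys (c + d) \<subseteq> ?K"
    by (auto simp: keys_add)
  have "Poly_Mapping.map ((*) (a + b)) x = Poly_Mapping.map ((*) a) x + Poly_Mapping.map ((*) b) x" for a b :: complex and x :: "((nat \<Rightarrow> real) \<Rightarrow> 'a) \<Rightarrow>\<^sub>0 complex"
    by (rule poly_mapping_eqI) (simp add: lookup_add algebra_simps)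
  then show ?thesis
    using False K by (simp add: twisted_boundary_superset[of n ?K] lookup_add sum.distrib)
qed (simp add: twisted_boundary_def)

lemma twisted_boundary_smult:
  "twisted_boundary T n (Poly_Mapping.map ((*) z) c) = Poly_Mapping.map ((*) z) (twisted_boundary T n c)"
proof (cases "n = 0")
  case False
  have "Poly_Mapping.map ((*) (a * b)) x = Poly_Mapping.map ((*) a) (Poly_Mapping.map ((*) b) x)" for a b :: complex and x :: "((nat \<Rightarrow> real) \<Rightarrow> 'a) \<Rightarrow>\<^sub>0 complex"
    by (rule poly_mapping_eqI) simp
  then show ?thesis
    using False keys_map_times[of z c]
    by (simp add: twisted_boundary_superset[of n "Poly_Mapping.keys c"] map_times_sum)
qed (auto simp: twisted_boundary_def intro!: poly_mapping_eqI)

lemma twisted_boundary_0: "twisted_boundary T n 0 = 0"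
  by (simp add: twisted_boundary_def)

lemma twisted_boundary_single:
  "n > 0 \<Longrightarrow> twisted_boundary T n (Poly_Mapping.single \<sigma> x) = Poly_Mapping.map ((*) x) (face_term T n \<sigma>)"
  by (simp add: twisted_boundary_superset[of n "{\<sigma>}"])

lemma twisted_boundary_sum:
  "twisted_boundary T n (sum f A) = (\<Sum>a\<in>A. twisted_boundary T n (f a))"
  by (induction A rule: infinite_finite_induct) (simp_all add: twisted_boundary_add twisted_boundary_0)

lemma face_term_1:
  assumes T: "path_cocycle \<X> (*) T" and p: "pathin \<X> p"
  shows "face_term T 1 (path_simplex p) = Poly_Mapping.single (point_simplex (p 1)) (T p) - Poly_Mapping.single (point_simplex (p 0)) 1"
proof -
  have "T (initial_edge (path_simplex p)) = T p"
    using path_cocycle_cong[OF T p] initial_edge_path_simplex[of _ p] by metis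
  moreover have "{..1} = {0, 1::nat}" by auto
  ultimately show ?thesis
    using face_path_simplex[of p] by (simp add: face_term_def single_uminus)
qed

lemma face_term_2:
  assumes T: "path_cocycle \<X> (*) T" and s: "continuous_map (top_of_set tri) \<X> s"
  shows "face_term T 2 (tri_simplex s) = Poly_Mapping.single (path_simplex (\<lambda>t. s (1 - t, t))) (T (\<lambda>t. s (t, 0)))
     - Poly_Mapping.single (path_simplex (\<lambda>t. s (0, t))) 1 + Poly_Mapping.single (path_simplex (\<lambda>t. s (t, 0))) 1"
proof -
  have "T (initial_edge (tri_simplex s)) = T (\<lambda>t. s (t, 0))"
    using path_cocycle_cong[OF T edges_pathin(1)[OF s]] initial_edge_tri_simplex[of _ s] by metis
  moreover have "{..2} = {0, 1, 2::nat}" by auto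
  ultimately show ?thesis
    using face_tri_simplex[of s] by (simp add: face_term_def single_uminus)
qed

lemma map_times_diff_add:
  "Poly_Mapping.map ((*) z) (c - d) = Poly_Mapping.map ((*) z) c - Poly_Mapping.map ((*) z) d"
  "Poly_Mapping.map ((*) z) (c + d) = Poly_Mapping.map ((*) z) c + Poly_Mapping.map ((*) z) d" for z :: complex
  by (rule poly_mapping_eqI; simp add: lookup_add lookup_minus algebra_simps)+

section \<open>Twisted cycles and boundaries in degree one\<close>

context
  fixes \<X> :: "'a topology" and T :: "(real \<Rightarrow> 'a) \<Rightarrow> complex"
  assumes T: "path_cocycle \<X> (*) T"
begin

lemma twisted_boundary_path:
  "pathin \<X> p \<Longrightarrow> twisted_boundary T 1 (Poly_Mapping.single (path_simplex p) x) =
    Poly_Mapping.single (point_simplex (p 1)) (x * T p) - Poly_Mapping.single (point_simplex (p 0)) x"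
  using face_term_1[OF T, of p] twisted_boundary_single[of 1 T "path_simplex p" x]
  by (simp add: map_times_diff_add map_times_single)

text \<open>At vertices 0 and 1 the terms cancel as in the untwisted case up to the factor T(01); at
  vertex 2 the cancellation is T(01) T(12) = T(02).\<close>

lemma twisted_boundary_twisted_boundary:
  assumes c: "c \<in> carrier (complex_chains 2 \<X>)"
  shows "twisted_boundary T 1 (twisted_boundary T 2 c) = 0"
proof -
  have "twisted_boundary T 1 (face_term T 2 \<sigma>) = 0" if \<sigma>: "singular_simplex 2 \<X> \<sigma>" for \<sigma>
  proof -
    obtain s where s: "continuous_map (top_of_set tri) \<X> s" "\<sigma> = tri_simplex s"
      using \<sigma> by (rule singular_simplex_2E)
    let ?S = "Poly_Mapping.single"
    have *: "face_term T 2 \<sigma> = ?S (path_simplex (\<lambda>t. s (1 - t, t))) (T (\<lambda>t. s (t, 0)))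
       + ?S (path_simplex (\<lambda>t. s (0, t))) (-1) + ?S (path_simplex (\<lambda>t. s (t, 0))) 1"
      unfolding s(2) face_term_2[OF T s(1)] by (simp add: single_uminus)
    show ?thesis
      unfolding * twisted_boundary_add edges_pathin[OF s(1), THEN twisted_boundary_path] path_cocycle_tri[OF T s(1)]
      by (simp add: single_uminus)
  qed
  then have "twisted_boundary T 1 (Poly_Mapping.map ((*) (Poly_Mapping.lookup c \<sigma>)) (face_term T 2 \<sigma>)) = 0"
    if "\<sigma> \<in> Poly_Mapping.keys c" for \<sigma>
    using that c by (auto simp: twisted_boundary_smult chains_carrier intro!: poly_mapping_eqI)
  then show ?thesis
    by (simp add: twisted_boundary_superset[of 2 "Poly_Mapping.keys c"] twisted_boundary_sum del: One_nat_def)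
qed

lemma twisted_boundary_closed:
  assumes c: "c \<in> carrier (complex_chains 2 \<X>)"
  shows "twisted_boundary T 2 c \<in> carrier (complex_chains 1 \<X>)"
proof -
  interpret module complex_field "complex_chains 1 \<X>" by (rule module_complex_chains)
  have zero: "0 \<in> carrier (complex_chains 1 \<X>)" by (simp add: chains_carrier)
  have add: "x + y \<in> carrier (complex_chains 1 \<X>)" if "x \<in> carrier (complex_chains 1 \<X>)" "y \<in> carrier (complex_chains 1 \<X>)" for x y
    using that a_closed by (simp add: chains_ops)
  have sum_in_chains: "sum f A \<in> carrier (complex_chains 1 \<X>)" if "finite A" "\<And>a. a \<in> A \<Longrightarrow> f a \<in> carrier (complex_chains 1 \<X>)" for f :: "nat \<Rightarrow> _" and A
    using that by (induction A rule: finite_induct) (auto intro!: add zero simp del: One_nat_def)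
  have "Poly_Mapping.map ((*) (Poly_Mapping.lookup c \<sigma>)) (face_term T 2 \<sigma>) \<in> carrier (complex_chains 1 \<X>)"
    if "\<sigma> \<in> Poly_Mapping.keys c" for \<sigma>
  proof -
    have "singular_simplex 2 \<X> \<sigma>" using c that by (auto simp: chains_carrier)
    then have "Poly_Mapping.single (singular_face 2 i \<sigma>) x \<in> carrier (complex_chains 1 \<X>)" if "i \<le> 2" for i x
      using singular_simplex_singular_face[of 2 \<X> \<sigma> i] that by (auto simp: chains_carrier)
    then have "face_term T 2 \<sigma> \<in> carrier (complex_chains 1 \<X>)"
      unfolding face_term_def
      by (intro sum_in_chains) (auto simp del: One_nat_def)
    then show ?thesis using smult_closed by (simp add: chains_ops)
  qed
  note term_in = this
  have "(\<Sum>\<sigma>\<in>K. Poly_Mapping.map ((*) (Poly_Mapping.lookup c \<sigma>)) (face_term T 2 \<sigma>)) \<in> carrier (complex_chains 1 \<X>)"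
    if "K \<subseteq> Poly_Mapping.keys c" for K
    using finite_subset[OF that finite_keys] that
    by (induction K rule: finite_induct) (auto intro!: add zero term_in simp del: One_nat_def)
  then show ?thesis
    by (simp add: twisted_boundary_superset[of 2 "Poly_Mapping.keys c"])
qed

lemma subquotient_local_homology:
  "subquotient_space (complex_chains 1 \<X>)
     {c \<in> carrier (complex_chains 1 \<X>). twisted_boundary T 1 c = 0}
     (twisted_boundary T (Suc 1) ` carrier (complex_chains (Suc 1) \<X>))"
proof -
  interpret C1: module complex_field "complex_chains 1 \<X>" by (rule module_complex_chains)
  interpret C2: module complex_field "complex_chains 2 \<X>" by (rule module_complex_chains)
  have 2: "Suc 1 = 2" by simp
  let ?Z = "{c \<in> carrier (complex_chains 1 \<X>). twisted_boundary T 1 c = 0}"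
  let ?B = "twisted_boundary T 2 ` carrier (complex_chains 2 \<X>)"
  have BZ: "?B \<subseteq> ?Z"
    using twisted_boundary_twisted_boundary twisted_boundary_closed by blast
  have "linear_subspace (complex_chains 1 \<X>) ?Z"
    using C1.a_closed C1.smult_closed C1.zero_closed unfolding linear_subspace_def chains_ops
    by (auto simp: twisted_boundary_add twisted_boundary_smult twisted_boundary_0 intro!: poly_mapping_eqI
        simp del: One_nat_def)
  moreover have "linear_subspace (complex_chains 1 \<X>) ?B"
    unfolding linear_subspace_def chains_ops
  proof (intro conjI ballI allI)
    show "?B \<subseteq> carrier (complex_chains 1 \<X>)" using BZ by blast
    show "0 \<in> ?B"
      using C2.zero_closed by (intro image_eqI[of _ _ 0]) (simp_all add: chains_ops twisted_boundary_0)
    show "x + y \<in> ?B" if x: "x \<in> ?B" and y: "y \<in> ?B" for x y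
    proof -
      obtain c d where "c \<in> carrier (complex_chains 2 \<X>)" "x = twisted_boundary T 2 c"
        "d \<in> carrier (complex_chains 2 \<X>)" "y = twisted_boundary T 2 d" using x y by blast
      then show ?thesis
        using C2.a_closed[of c d] by (intro image_eqI[of _ _ "c + d"]) (simp_all add: chains_ops twisted_boundary_add)
    qed
    show "Poly_Mapping.map ((*) z) x \<in> ?B" if x: "x \<in> ?B" for z x
    proof -
      obtain c where "c \<in> carrier (complex_chains 2 \<X>)" "x = twisted_boundary T 2 c" using x by blast
      then show ?thesis
        using C2.smult_closed[of z c]
        by (intro image_eqI[of _ _ "Poly_Mapping.map ((*) z) c"]) (simp_all add: chains_ops twisted_boundary_smult)
    qed
  qed
  ultimately show ?thesis
    unfolding 2
    by (intro subquotient_space.intro subquotient_space_axioms.intro module_complex_chains BZ)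
qed

text \<open>The linear extension of \<open>\<psi>\<close> to chains kills boundaries, because the
  affine law reads \<psi>(01) + T(01) \<psi>(12) - \<psi>(02) = 0. A twisted cycle on which it is
  non-zero is therefore no boundary.\<close>

lemma vdim_local_homology_ge_1:
  assumes \<psi>: "path_cocycle \<X> affine_mult (\<lambda>p. (T p, \<psi> p))"
    and l: "pathin \<X> l" "l 1 = l 0" and k: "pathin \<X> k" "k 0 = l 0" "k 1 = l 0"
    and c0: "c * (T l - 1) + d * (T k - 1) = 0" and n0: "c * \<psi> l + d * \<psi> k \<noteq> 0"
  shows "vdim (local_homology 1 \<X> T) \<ge> enat 1"
proof -
  interpret S: subquotient_space "complex_chains 1 \<X>"
     "{c \<in> carrier (complex_chains 1 \<X>). twisted_boundary T 1 c = 0}"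
     "twisted_boundary T (Suc 1) ` carrier (complex_chains (Suc 1) \<X>)"
    by (rule subquotient_local_homology)
  define \<Psi> where "\<Psi> a = (\<Sum>\<sigma>\<in>Poly_Mapping.keys a. Poly_Mapping.lookup a \<sigma> * \<psi> (initial_edge \<sigma>))"
    for a :: "((nat \<Rightarrow> real) \<Rightarrow> 'a) \<Rightarrow>\<^sub>0 complex"
  have sup: "\<Psi> a = (\<Sum>\<sigma>\<in>K. Poly_Mapping.lookup a \<sigma> * \<psi> (initial_edge \<sigma>))"
    if "finite K" "Poly_Mapping.keys a \<subseteq> K" for a K
    unfolding \<Psi>_def using that by (intro sum.mono_neutral_left) (auto simp: in_keys_iff)
  have add: "\<Psi> (a + b) = \<Psi> a + \<Psi> b" for a b
  proof -
    let ?K = "Poly_Mapping.keys a \<union> Poly_Mapping.keys b"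
    have "finite ?K" "Poly_Mapping.keys (a + b) \<subseteq> ?K" by (auto simp: keys_add)
    then show ?thesis using sup[of ?K] by (simp add: lookup_add algebra_simps sum.distrib)
  qed
  have smult: "\<Psi> (Poly_Mapping.map ((*) z) a) = z * \<Psi> a" for z a
    using sup[OF finite_keys keys_map_times[of z a]] by (simp add: \<Psi>_def sum_distrib_left mult.assoc)
  have zero: "\<Psi> 0 = 0" by (simp add: \<Psi>_def)
  have sum: "\<Psi> (sum f A) = (\<Sum>a\<in>A. \<Psi> (f a))" for f :: "((nat \<Rightarrow> real) \<Rightarrow> 'a) \<Rightarrow> _" and A
    by (induction A rule: infinite_finite_induct) (simp_all add: add zero)
  have single: "\<Psi> (Poly_Mapping.single (path_simplex p) x) = x * \<psi> p" if "pathin \<X> p" for p x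
  proof -
    have "\<psi> (initial_edge (path_simplex p)) = \<psi> p"
      using path_cocycle_cong[OF \<psi> that, of "initial_edge (path_simplex p)"] initial_edge_path_simplex[of _ p] by simp
    then show ?thesis using sup[of "{path_simplex p}" "Poly_Mapping.single (path_simplex p) x"] by simp
  qed
  have "\<Psi> (face_term T 2 \<sigma>) = 0" if \<sigma>: "singular_simplex 2 \<X> \<sigma>" for \<sigma>
  proof -
    obtain s where s: "continuous_map (top_of_set tri) \<X> s" "\<sigma> = tri_simplex s"
      using \<sigma> by (rule singular_simplex_2E)
    let ?S = "Poly_Mapping.single"
    have *: "face_term T 2 \<sigma> = ?S (path_simplex (\<lambda>t. s (1 - t, t))) (T (\<lambda>t. s (t, 0)))
       + ?S (path_simplex (\<lambda>t. s (0, t))) (-1) + ?S (path_simplex (\<lambda>t. s (t, 0))) 1"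
      unfolding s(2) face_term_2[OF T s(1)] by (simp add: single_uminus)
    show ?thesis
      unfolding * add edges_pathin[OF s(1), THEN single]
      using path_cocycle_tri[OF \<psi> s(1)] by (simp add: affine_mult_def)
  qed
  then have boundary: "\<Psi> (twisted_boundary T 2 a) = 0" if "a \<in> carrier (complex_chains 2 \<X>)" for a
    using that by (auto simp: twisted_boundary_superset[of 2 "Poly_Mapping.keys a"] sum smult chains_carrier
        intro!: sum.neutral)
  define z where "z = Poly_Mapping.single (path_simplex l) c + Poly_Mapping.single (path_simplex k) d"
  have "z \<in> carrier (complex_chains 1 \<X>)"
    unfolding z_def chains_carrier
    using l(1) k(1) singular_simplex_path_simplex by (intro order_trans[OF keys_add]) (auto split: if_splits)
  moreover have "twisted_boundary T 1 z = 0"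
  proof -
    let ?S = "Poly_Mapping.single (point_simplex (l 0))"
    have "twisted_boundary T 1 z = ?S (c * T l) - ?S c + (?S (d * T k) - ?S d)"
      unfolding z_def twisted_boundary_add twisted_boundary_path[OF l(1)] twisted_boundary_path[OF k(1)] l(2) k(2,3) ..
    also have "\<dots> = ?S (c * (T l - 1) + d * (T k - 1))"
      by (simp add: single_add single_diff algebra_simps)
    finally show ?thesis by (simp add: c0)
  qed
  moreover have "\<Psi> z \<noteq> 0"
    unfolding z_def add single[OF l(1)] single[OF k(1)] using n0 .
  ultimately have "vdim S.Q \<ge> enat 1"
    using boundary by (intro S.vdim_ge_1_if) (auto simp: numeral_2_eq_2)
  then show ?thesis by (simp only: local_homology_def)
qed

end

theorem characteristic_variety_eqI:
  assumes con: "path_connected_space \<X>" and x0: "x0 \<in> topspace \<X>"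
    and cls: "\<And>T. \<lbrakk>path_cocycle \<X> (*) T; \<And>p. pathin \<X> p \<Longrightarrow> T p \<noteq> 0\<rbrakk> \<Longrightarrow>
      \<exists>\<psi>. path_cocycle \<X> affine_mult (\<lambda>p. (T p, \<psi> p)) \<and>
        (\<exists>l k c d. pathin \<X> l \<and> pathin \<X> k \<and> l 1 = l 0 \<and> k 0 = l 0 \<and> k 1 = l 0 \<and>
           c * (T l - 1) + d * (T k - 1) = 0 \<and> c * \<psi> l + d * \<psi> k \<noteq> 0)"
  shows "characteristic_variety 1 1 \<X> x0 = characters \<X> x0"
proof -
  have "vdim (local_homology 1 \<X> (transport \<X> x0 \<rho>)) \<ge> enat 1" if \<rho>: "\<rho> \<in> characters \<X> x0" for \<rho>
  proof -
    note T = path_cocycle_transport[OF con x0 \<rho>] transport_nonzero[OF con x0 \<rho>]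
    show ?thesis using cls[OF T] vdim_local_homology_ge_1[OF T(1)] by blast
  qed
  then show ?thesis by (auto simp: characteristic_variety_def)
qed

section \<open>The first Betti number\<close>

definition eval_chain :: "('s \<Rightarrow> complex) \<Rightarrow> ('s \<Rightarrow>\<^sub>0 int) \<Rightarrow> complex" where
  "eval_chain \<phi> c = (\<Sum>\<sigma>\<in>Poly_Mapping.keys c. of_int (Poly_Mapping.lookup c \<sigma>) * \<phi> \<sigma>)"

lemma eval_chain_superset:
  assumes "finite K" "Poly_Mapping.keys c \<subseteq> K"
  shows "eval_chain \<phi> c = (\<Sum>\<sigma>\<in>K. of_int (Poly_Mapping.lookup c \<sigma>) * \<phi> \<sigma>)"
  unfolding eval_chain_def using assms by (intro sum.mono_neutral_left) (auto simp: in_keys_iff)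

lemma eval_chain_add: "eval_chain \<phi> (c + d) = eval_chain \<phi> c + eval_chain \<phi> d"
proof -
  let ?K = "Poly_Mapping.keys c \<union> Poly_Mapping.keys d"
  have "finite ?K" "Poly_Mapping.keys (c + d) \<subseteq> ?K" by (auto simp: keys_add)
  then show ?thesis using eval_chain_superset[of ?K] by (simp add: lookup_add algebra_simps sum.distrib)
qed

lemma eval_chain_minus: "eval_chain \<phi> (- c) = - eval_chain \<phi> c"
  by (simp add: eval_chain_def sum_negf)

lemma eval_chain_diff: "eval_chain \<phi> (c - d) = eval_chain \<phi> c - eval_chain \<phi> d"
  using eval_chain_add[of \<phi> c "- d"] by (simp add: eval_chain_minus)

lemma eval_chain_0 [simp]: "eval_chain \<phi> 0 = 0"
  by (simp add: eval_chain_def)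

lemma eval_chain_of [simp]: "eval_chain \<phi> (frag_of \<sigma>) = \<phi> \<sigma>"
  by (simp add: eval_chain_def)

text \<open>
  The complex numbers are a divisible group; the extension is found inside the rational vector
  space spanned by the basis of the free abelian group.
\<close>

lemma separating_functional:
  fixes B :: "('s \<Rightarrow>\<^sub>0 int) set" and z :: "'s \<Rightarrow>\<^sub>0 int"
  assumes B0: "0 \<in> B" and Badd: "\<And>b c. b \<in> B \<Longrightarrow> c \<in> B \<Longrightarrow> b + c \<in> B"
    and Bcmul: "\<And>n b. b \<in> B \<Longrightarrow> frag_cmul n b \<in> B"
    and z: "\<And>n. frag_cmul n z \<in> B \<Longrightarrow> n = 0"
  obtains \<phi> where "eval_chain \<phi> z = 1" and "\<And>b. b \<in> B \<Longrightarrow> eval_chain \<phi> b = 0"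
proof -
  define emb :: "('s \<Rightarrow>\<^sub>0 int) \<Rightarrow> ('s \<Rightarrow>\<^sub>0 rat)" where "emb = Poly_Mapping.map of_int"
  define sc :: "rat \<Rightarrow> ('s \<Rightarrow>\<^sub>0 rat) \<Rightarrow> ('s \<Rightarrow>\<^sub>0 rat)" where "sc r = Poly_Mapping.map ((*) r)" for r
  have lookup_emb [simp]: "Poly_Mapping.lookup (emb c) k = of_int (Poly_Mapping.lookup c k)" for c k
    by (simp add: emb_def Poly_Mapping.map.rep_eq when_def)
  have lookup_sc [simp]: "Poly_Mapping.lookup (sc r c) k = r * Poly_Mapping.lookup c k" for r c k
    by (simp add: sc_def Poly_Mapping.map.rep_eq when_def)
  have emb_inj: "emb c = emb d \<Longrightarrow> c = d" for c d
    by (rule poly_mapping_eqI) (metis lookup_emb of_int_eq_iff)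
  interpret P: vector_space_pair sc "\<lambda>r (x::complex). of_rat r * x"
    by unfold_locales
      (auto simp: lookup_add algebra_simps of_rat_add of_rat_mult intro!: poly_mapping_eqI)
  \<comment> \<open>Clearing denominators: a positive integer multiple of any rational combination
    of elements of \<open>B\<close> is again in \<open>B\<close>. Since no positive multiple of
    \<open>z\<close> is in \<open>B\<close>, \<open>emb z\<close> lies outside the span.\<close>
  have span: "\<exists>n>0. \<exists>b\<in>B. sc (of_int n) v = emb b" if "v \<in> P.vs1.span (emb ` B)" for v
    using that
  proof (induction v rule: P.vs1.span_induct_alt)
    case base
    show ?case using B0 by (intro exI[of _ 1] conjI bexI[of _ 0]) (auto intro!: poly_mapping_eqI)
  next
    case (step r x y)
    obtain b where b: "b \<in> B" "x = emb b" using step by blast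
    obtain n c where n: "n > 0" "c \<in> B" "sc (of_int n) y = emb c" using step by blast
    obtain p q where pq: "quotient_of r = (p, q)" by fastforce
    then have q: "q > 0" "r = of_int p / of_int q"
      using quotient_of_denom_pos quotient_of_div by blast+
    have "sc (of_int (n * q)) (sc r x + y) = emb (frag_cmul (n * p) b + frag_cmul q c)"
    proof (rule poly_mapping_eqI)
      fix k
      have 1: "of_int n * Poly_Mapping.lookup y k = of_int (Poly_Mapping.lookup c k)"
        using arg_cong[OF n(3), of "\<lambda>f. Poly_Mapping.lookup f k"] by simp
      have 2: "of_int q * r = of_int p" using q by simp
      have "of_int (n * q) * (r * Poly_Mapping.lookup x k + Poly_Mapping.lookup y k) =
          of_int n * (of_int q * r) * Poly_Mapping.lookup x k + of_int q * (of_int n * Poly_Mapping.lookup y k)"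
        by (simp add: algebra_simps)
      then show "Poly_Mapping.lookup (sc (of_int (n * q)) (sc r x + y)) k =
          Poly_Mapping.lookup (emb (frag_cmul (n * p) b + frag_cmul q c)) k"
        unfolding 1 2 by (simp add: b(2) lookup_add)
    qed
    moreover have "n * q > 0" using n q by simp
    moreover have "frag_cmul (n * p) b + frag_cmul q c \<in> B" using b n by (intro Badd Bcmul)
    ultimately show ?case by blast
  qed
  have nz: "emb z \<notin> P.vs1.span (emb ` B)"
  proof
    assume "emb z \<in> P.vs1.span (emb ` B)"
    then obtain n b where n: "n > 0" "b \<in> B" "sc (of_int n) (emb z) = emb b" using span by blast
    have "sc (of_int n) (emb z) = emb (frag_cmul n z)" by (rule poly_mapping_eqI) simp
    then have "frag_cmul n z = b" using n(3) emb_inj by simp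
    then show False using z n by auto
  qed
  obtain S where S: "S \<subseteq> emb ` B" "P.vs1.independent S" "emb ` B \<subseteq> P.vs1.span S"
    using P.vs1.maximal_independent_subset by blast
  have zS: "emb z \<notin> P.vs1.span S" using nz P.vs1.span_mono[OF S(1)] by blast
  then have "P.vs1.independent (insert (emb z) S)"
    using S(2) by (simp add: P.vs1.independent_insert)
  \<comment> \<open>The functional is 1 on \<open>emb z\<close> and 0 on a basis of the span of
    \<open>B\<close>, which is possible because both together are independent.\<close>
  then obtain g :: "('s \<Rightarrow>\<^sub>0 rat) \<Rightarrow> complex"
    where g: "Vector_Spaces.linear sc (\<lambda>r x. of_rat r * x) g"
    and gv: "\<forall>x\<in>insert (emb z) S. g x = (if x = emb z then 1 else 0)"
    using P.linear_independent_extend[of _ "\<lambda>x. if x = emb z then 1 else 0"] by blast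
  interpret g: Vector_Spaces.linear sc "\<lambda>r x. of_rat r * x" g by fact
  have gS: "g x = 0" if "x \<in> P.vs1.span S" for x
    using that
  proof (induction x rule: P.vs1.span_induct_alt)
    case (step c x y)
    have "x \<noteq> emb z" using zS step(1) P.vs1.span_base by blast
    then have "g x = 0" using gv step(1) by simp
    with step show ?case by (simp add: g.add g.scale)
  qed (rule g.zero)
  define \<phi> where "\<phi> \<sigma> = g (Poly_Mapping.single \<sigma> 1)" for \<sigma>
  have eval: "eval_chain \<phi> c = g (emb c)" for c
  proof -
    have "emb c = (\<Sum>\<sigma>\<in>Poly_Mapping.keys c. sc (of_int (Poly_Mapping.lookup c \<sigma>)) (Poly_Mapping.single \<sigma> 1))"
      by (rule poly_mapping_eqI)
        (simp add: lookup_sum lookup_single when_def in_keys_iff if_distrib[of "\<lambda>x. _ * x"] cong: if_cong)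
    then show ?thesis by (simp add: g.sum g.scale eval_chain_def \<phi>_def)
  qed
  show ?thesis
    by (rule that[of \<phi>]) (use eval gS gv S(3) in auto)
qed

text \<open>A non-zero rank yields a non-empty independent set of homology classes. Any member has
  infinite order, and \<open>z\<close> is a cycle representing it.\<close>

lemma betti_1_cycle:
  assumes "betti 1 \<X> \<noteq> 0"
  obtains z where "singular_relcycle 1 \<X> {} z"
    and "\<And>n. singular_relboundary 1 \<X> {} (frag_cmul n z) \<Longrightarrow> n = 0"
proof -
  let ?H = "homology_group 1 \<X>"
  have H: "?H = relcycle_group 1 \<X> {} Mod singular_relboundary_set 1 \<X> {}"
    by (simp add: relative_homology_group_def)
  interpret comm_group ?H by (rule abelian_homology_group)
  interpret N: normal "singular_relboundary_set 1 \<X> {}" "relcycle_group 1 \<X> {}"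
    by (rule normal_subgroup_singular_relboundary_relcycle)
  obtain S where S: "finite S" "S \<subseteq> carrier ?H" "S \<noteq> {}"
    "\<And>c :: _ \<Rightarrow> int. finprod ?H (\<lambda>x. x [^]\<^bsub>?H\<^esub> c x) S = \<one>\<^bsub>?H\<^esub> \<Longrightarrow> \<forall>x\<in>S. c x = 0"
  proof -
    define P where "P S \<longleftrightarrow> finite S \<and> S \<subseteq> carrier ?H \<and>
       (\<forall>c :: _ \<Rightarrow> int. finprod ?H (\<lambda>x. x [^]\<^bsub>?H\<^esub> c x) S = \<one>\<^bsub>?H\<^esub> \<longrightarrow> (\<forall>x\<in>S. c x = 0))" for S
    have rank: "abelian_rank ?H = Sup {enat (card S) | S. P S}"
      by (simp add: abelian_rank_def P_def)
    obtain S where S: "P S" "S \<noteq> {}"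
    proof (rule ccontr)
      assume "\<not> thesis"
      then have "S = {}" if "P S" for S using that \<open>\<And>S. \<lbrakk>P S; S \<noteq> {}\<rbrakk> \<Longrightarrow> thesis\<close> by blast
      then have "Sup {enat (card S) | S. P S} \<le> 0" by (intro Sup_least) (force simp: zero_enat_def)
      then show False using assms rank by (simp add: betti_def)
    qed
    note PS = S(1)[unfolded P_def]
    show ?thesis
      by (rule that[OF conjunct1[OF PS] conjunct1[OF conjunct2[OF PS]] S(2)])
        (rule mp[OF spec[OF conjunct2[OF conjunct2[OF PS]]]])
  qed
  obtain x where x: "x \<in> S" using S(3) by blast
  then have xH: "x \<in> carrier ?H" using S(2) by blast
  have tf: "n = 0" if n: "x [^]\<^bsub>?H\<^esub> n = \<one>\<^bsub>?H\<^esub>" for n :: int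
  proof -
    \<comment> \<open>The exponents are concentrated at \<open>x\<close>, so that independence of
      \<open>S\<close> becomes torsion-freeness of \<open>x\<close>.\<close>
    have "finprod ?H (\<lambda>y. y [^]\<^bsub>?H\<^esub> (if y = x then n else 0)) S = finprod ?H (\<lambda>y. \<one>\<^bsub>?H\<^esub>) S"
      by (rule finprod_cong') (use n in auto)
    also have "\<dots> = \<one>\<^bsub>?H\<^esub>" by (rule finprod_one)
    finally have "\<forall>y\<in>S. (if y = x then n else 0) = 0" by (rule S(4))
    with x show ?thesis by auto
  qed
  obtain z where z: "singular_relcycle 1 \<X> {} z" "x = singular_relboundary_set 1 \<X> {} #>\<^bsub>relcycle_group 1 \<X> {}\<^esub> z"
    using xH unfolding H by (auto simp: FactGroup_def RCOSETS_def)
  have "n = 0" if n: "singular_relboundary 1 \<X> {} (frag_cmul n z)" for n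
  proof -
    have keys: "Poly_Mapping.keys z \<subseteq> singular_simplex_set 1 \<X>"
      using z(1) by (simp add: singular_cycle singular_chain_def)
    \<comment> \<open>The cycle group is a generated subgroup of the chain group, so powers may be
      computed there, where they are integer multiples of chains.\<close>
    have pow: "z [^]\<^bsub>relcycle_group 1 \<X> {}\<^esub> n = frag_cmul n z"
      using z(1) keys group.int_pow_subgroup_generated[OF group_chain_group, of z 1 \<X> "singular_relcycle_set 1 \<X> {}" n]
      by (simp add: relcycle_group_def[symmetric]) (simp add: chain_group_def)
    have "x [^]\<^bsub>?H\<^esub> n = singular_relboundary_set 1 \<X> {} #>\<^bsub>relcycle_group 1 \<X> {}\<^esub> (frag_cmul n z)"
      unfolding z(2) H using N.FactGroup_int_pow[of z n] z(1) pow by simp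
    also have "\<dots> = singular_relboundary_set 1 \<X> {}"
      using n by (intro N.rcos_const) auto
    finally show ?thesis using tf by (simp add: H)
  qed
  then show ?thesis using that z(1) by blast
qed

text \<open>Vanishing of \<open>\<Phi>\<close> on boundaries of 2-simplices is the triangle
  relation. A potential would make the value of \<open>\<Phi>\<close> on the cycle \<open>z\<close>
  a value on its boundary, hence 0, whereas it is 1.\<close>

theorem betti_1_cocycle:
  assumes "betti 1 \<X> \<noteq> 0"
  obtains \<phi> :: "(real \<Rightarrow> 'a) \<Rightarrow> complex" where "path_cocycle \<X> (+) \<phi>"
    and "\<And>f. \<exists>p. pathin \<X> p \<and> \<phi> p \<noteq> f (p 1) - f (p 0)"
proof -
  obtain z where z: "singular_relcycle 1 \<X> {} z"
    and tf: "\<And>n. singular_relboundary 1 \<X> {} (frag_cmul n z) \<Longrightarrow> n = 0"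
    using betti_1_cycle[OF assms] by blast
  let ?B = "singular_relboundary_set 1 \<X> {}"
  obtain \<Phi> where \<Phi>z: "eval_chain \<Phi> z = 1" and \<Phi>B: "\<And>b. b \<in> ?B \<Longrightarrow> eval_chain \<Phi> b = 0"
  proof (rule separating_functional[of ?B z])
    show "frag_cmul n b \<in> ?B" if b: "b \<in> ?B" for n b
    proof -
      obtain d where "singular_chain (Suc 1) \<X> d" "chain_boundary (Suc 1) d = b"
        using b by (auto simp: singular_boundary)
      then have "singular_chain (Suc 1) \<X> (frag_cmul n d)" "chain_boundary (Suc 1) (frag_cmul n d) = frag_cmul n b"
        by (simp_all add: singular_chain_cmul chain_boundary_cmul)
      then show ?thesis by (auto simp: singular_boundary)
    qed
  qed (use tf in \<open>auto simp: singular_relboundary_add\<close>)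
  define \<phi> where "\<phi> p = \<Phi> (path_simplex p)" for p
  have \<phi>: "path_cocycle \<X> (+) \<phi>"
    unfolding path_cocycle_def \<phi>_def
  proof (intro conjI allI impI; (elim conjE)?)
    fix p q :: "real \<Rightarrow> 'a" assume "\<forall>t\<in>{0..1}. p t = q t"
    then show "\<Phi> (path_simplex p) = \<Phi> (path_simplex q)" using path_simplex_eqI[of p q] by simp
  next
    fix s assume s: "continuous_map (top_of_set tri) \<X> s"
    have "chain_boundary 2 (frag_of (tri_simplex s)) \<in> ?B"
      using singular_simplex_tri_simplex[OF s]
      by (auto simp: singular_boundary singular_chain_of numeral_2_eq_2
          intro!: exI[of _ "frag_of (tri_simplex s)"])
    then have "eval_chain \<Phi> (chain_boundary 2 (frag_of (tri_simplex s))) = 0" by (rule \<Phi>B)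
    moreover have "{..2} = {0, 1, 2::nat}" by auto
    ultimately show "\<Phi> (path_simplex (\<lambda>t. s (t, 0))) + \<Phi> (path_simplex (\<lambda>t. s (1 - t, t))) = \<Phi> (path_simplex (\<lambda>t. s (0, t)))"
      using face_tri_simplex[of s] by (simp add: chain_boundary_of eval_chain_add eval_chain_diff eval_chain_minus algebra_simps)
  qed
  have "\<exists>p. pathin \<X> p \<and> \<phi> p \<noteq> f (p 1) - f (p 0)" for f
  proof (rule ccontr)
    assume "\<not> ?thesis"
    then have f: "\<phi> p = f (p 1) - f (p 0)" if "pathin \<X> p" for p using that by blast
    \<comment> \<open>The potential as a 0-cochain: a 0-simplex is sent to the value of
      \<open>f\<close> at its point.\<close>
    define F where "F = (\<lambda>\<sigma>::(nat \<Rightarrow> real) \<Rightarrow> 'a. f (\<sigma> (\<lambda>j. if j = 0 then 1 else 0)))"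
    have Fp: "F (point_simplex x) = f x" for x
      by (simp add: F_def point_simplex_def standard_simplex_0)
    have "Poly_Mapping.keys z \<subseteq> singular_simplex_set 1 \<X>"
      using z by (simp add: singular_cycle singular_chain_def)
    then have "eval_chain \<Phi> z = eval_chain F (chain_boundary 1 z)"
    proof (induction z rule: frag_induction)
      case (one \<sigma>)
      then obtain p where p: "pathin \<X> p" "\<sigma> = path_simplex p" using singular_simplex_1E by blast
      have "{..1} = {0, 1::nat}" by auto
      then show ?case
        using f[OF p(1)] face_path_simplex[of p]
        by (simp add: p(2) \<phi>_def chain_boundary_of eval_chain_diff Fp)
    qed (simp_all add: chain_boundary_diff eval_chain_diff)
    then show False using z \<Phi>z by (simp add: singular_cycle)
  qed
  with \<phi> show ?thesis using that by blast
qed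

section \<open>Discs in manifolds\<close>

text \<open>The chart is the inverse of \<open>h\<close>. As a homeomorphism onto an open set it
  makes \<open>h\<close> continuous and open on a neighbourhood of the closed disc.\<close>

lemma disc_embeddingE:
  assumes "disc_embedding \<X> A h"
  obtains W where "open W" "cball 0 1 \<subseteq> W" "inj_on h W" "continuous_map (top_of_set W) \<X> h"
    and "\<And>S. \<lbrakk>S \<subseteq> W; open S\<rbrakk> \<Longrightarrow> openin \<X> (h ` S)"
proof -
  obtain W where W: "open W" "cball 0 1 \<subseteq> W" "inj_on h W" "is_chart \<X> (h ` W, inv_into W h)"
    using assms unfolding disc_embedding_def by blast
  let ?g = "inv_into W h"
  have gW: "?g ` h ` W = W" using W(3) by (simp add: image_image)
  have hW: "openin \<X> (h ` W)" and g: "homeomorphic_map (subtopology \<X> (h ` W)) (top_of_set W) ?g"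
    using W(4) gW by (auto simp: is_chart_def)
  have top: "topspace (subtopology \<X> (h ` W)) = h ` W"
    using openin_subset[OF hW] by auto
  obtain h' where h': "homeomorphic_maps (subtopology \<X> (h ` W)) (top_of_set W) ?g h'"
    using g homeomorphic_map_maps by blast
  have h'h: "h' w = h w" if "w \<in> W" for w
  proof -
    have "h' (?g (h w)) = h w"
      using h' that top by (auto simp: homeomorphic_maps_def)
    then show ?thesis using W(3) that by simp
  qed
  have h: "homeomorphic_map (top_of_set W) (subtopology \<X> (h ` W)) h"
  proof (rule homeomorphic_map_eq)
    show "homeomorphic_map (top_of_set W) (subtopology \<X> (h ` W)) h'"
      using h' homeomorphic_maps_map homeomorphic_maps_sym by blast
  qed (use h'h in auto)
  show ?thesis
  proof
    show "continuous_map (top_of_set W) \<X> h"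
      using homeomorphic_imp_continuous_map[OF h] by (simp add: continuous_map_in_subtopology)
    show "openin \<X> (h ` S)" if "S \<subseteq> W" "open S" for S
    proof -
      have "openin (top_of_set W) S" using that by (simp add: open_openin_trans open_subset W(1))
      then have "openin (subtopology \<X> (h ` W)) (h ` S)"
        using homeomorphic_map_openness[OF h, of S] that by simp
      then show ?thesis using hW openin_trans_full by blast
    qed
  qed (use W in auto)
qed

text \<open>Inverse charts carry small balls to path-connected neighbourhoods. This turns
  connectedness of the space without the centre of a disc into path-connectedness.\<close>

lemma locally_path_connected_manifold:
  assumes "smooth_atlas \<X> A"
  shows "locally_path_connected_space \<X>"
  unfolding locally_path_connected_space
proof (intro allI impI; elim conjE)
  fix V x assume V: "openin \<X> V" "x \<in> V"
  then have "x \<in> topspace \<X>" using openin_subset by blast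
  then obtain c where c: "c \<in> A" "x \<in> fst c" using assms unfolding smooth_atlas_def by blast
  obtain U f where cU: "c = (U, f)" by fastforce
  have U: "openin \<X> U" "open (f ` U)" "homeomorphic_map (subtopology \<X> U) (top_of_set (f ` U)) f"
    using assms c(1) cU unfolding smooth_atlas_def is_chart_def by fastforce+
  have xU: "x \<in> U" using c cU by simp
  have top: "topspace (subtopology \<X> U) = U" using openin_subset[OF U(1)] by auto
  obtain g where g: "homeomorphic_maps (subtopology \<X> U) (top_of_set (f ` U)) f g"
    using U(3) homeomorphic_map_maps by blast
  then have gh: "homeomorphic_map (top_of_set (f ` U)) (subtopology \<X> U) g" and gf: "\<And>y. y \<in> U \<Longrightarrow> g (f y) = y"
    using homeomorphic_maps_map homeomorphic_maps_sym top by (blast, auto simp: homeomorphic_maps_def)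
  have "openin (subtopology \<X> U) (U \<inter> V)"
    using openin_subtopology_Int2[OF V(1)] .
  then have "openin (top_of_set (f ` U)) (f ` (U \<inter> V))"
    using homeomorphic_map_openness[OF U(3), of "U \<inter> V"] top by auto
  then have "open (f ` (U \<inter> V))" using U(2) openin_open_trans by blast
  moreover have "f x \<in> f ` (U \<inter> V)" using xU V by blast
  ultimately obtain e where e: "e > 0" "ball (f x) e \<subseteq> f ` (U \<inter> V)" by (meson open_contains_ball)
  then have bU: "ball (f x) e \<subseteq> f ` U" by blast
  let ?B = "g ` ball (f x) e"
  have "openin (subtopology \<X> U) ?B"
    using homeomorphic_map_openness[OF gh, of "ball (f x) e"] bU U(2) by (simp add: open_openin_trans open_subset)
  then have "openin \<X> ?B" using U(1) openin_trans_full by blast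
  moreover have "path_connectedin \<X> ?B"
  proof -
    have "path_connectedin (top_of_set (f ` U)) (ball (f x) e)"
      using bU by (simp add: path_connectedin_subtopology convex_imp_path_connected)
    moreover have "continuous_map (top_of_set (f ` U)) \<X> g"
      using homeomorphic_imp_continuous_map[OF gh] by (simp add: continuous_map_in_subtopology)
    ultimately show ?thesis using path_connectedin_continuous_map_image by blast
  qed
  moreover have "x \<in> ?B" using gf[OF xU] e(1) by (intro image_eqI[of _ _ "f x"]) auto
  moreover have "?B \<subseteq> V"
  proof
    fix v assume "v \<in> ?B"
    then obtain u where "u \<in> U" "u \<in> V" "v = g (f u)" using e(2) by blast
    then show "v \<in> V" using gf by simp
  qed
  ultimately show "\<exists>W. openin \<X> W \<and> path_connectedin \<X> W \<and> x \<in> W \<and> W \<subseteq> V" by blast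
qed

text \<open>The topological content of a disc in a manifold: \<open>h\<close> is an open embedding
  of a neighbourhood of the closed unit ball into a connected, locally path-connected Hausdorff
  space.\<close>

locale embedded_disc =
  fixes \<X> :: "'a topology" and h :: "'v::euclidean_space \<Rightarrow> 'a" and W :: "'v set"
  assumes con: "connected_space \<X>" and haus: "Hausdorff_space \<X>"
    and lpc: "locally_path_connected_space \<X>"
    and dim: "DIM('v) \<ge> 3"
    and W: "open W" "cball 0 1 \<subseteq> W" and inj: "inj_on h W" and cont: "continuous_map (top_of_set W) \<X> h"
    and openh: "\<And>S. \<lbrakk>S \<subseteq> W; open S\<rbrakk> \<Longrightarrow> openin \<X> (h ` S)"
begin

definition pball :: "'v set" where "pball = ball 0 1 - {0}"

lemma pball: "open pball" "pball \<subseteq> ball 0 1" "pball \<subseteq> W" "ball 0 1 \<subseteq> W" "0 \<in> W" "path_connected pball" "pball \<noteq> {}"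
proof -
  show "ball 0 1 \<subseteq> W" using W(2) ball_subset_cball by blast
  then show "pball \<subseteq> W" "0 \<in> W" by (auto simp: pball_def)
  show "path_connected pball" unfolding pball_def by (rule path_connected_punctured_ball) (use dim in simp)
  obtain b :: 'v where "b \<in> Basis" using nonempty_Basis by blast
  then have "(1/2) *\<^sub>R b \<in> pball" by (auto simp: pball_def nonzero_Basis)
  then show "pball \<noteq> {}" by blast
qed (auto simp: pball_def open_delete)

definition rest :: "'a set" where "rest = topspace \<X> - {h 0}"

lemma h_top: "h ` W \<subseteq> topspace \<X>"
  using openin_subset[OF openh[OF order_refl W(1)]] .

lemma rest: "openin \<X> rest" "h ` pball \<subseteq> rest"
proof -
  have "h 0 \<in> topspace \<X>" using h_top pball by blast
  then have "closedin \<X> {h 0}" using closedin_Hausdorff_singleton[OF haus] by blast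
  then show "openin \<X> rest" unfolding rest_def by blast
  show "h ` pball \<subseteq> rest"
    using h_top pball inj by (auto simp: rest_def pball_def inj_on_eq_iff subset_iff)
qed

lemma top_rest: "topspace (subtopology \<X> rest) = rest"
  using openin_subset[OF rest(1)] by auto

lemma path_connected_h: "S \<subseteq> W \<Longrightarrow> path_connected S \<Longrightarrow> path_connectedin \<X> (h ` S)"
  by (rule path_connectedin_continuous_map_image[OF cont]) (simp add: path_connectedin_subtopology)

text \<open>In a separation of the complement the connected punctured disc would lie in one of the
  two halves; adding the centre to that half would separate \<open>\<X>\<close>.\<close>

lemma connected_rest: "connected_space (subtopology \<X> rest)"
  unfolding connected_space_def
proof (intro notI; elim exE conjE)
  fix E1 E2
  assume E: "openin (subtopology \<X> rest) E1" "openin (subtopology \<X> rest) E2"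
    "topspace (subtopology \<X> rest) \<subseteq> E1 \<union> E2" "E1 \<inter> E2 = {}" "E1 \<noteq> {}" "E2 \<noteq> {}"
  have no: False
    if E1: "openin (subtopology \<X> rest) E1" "openin (subtopology \<X> rest) E2" "rest \<subseteq> E1 \<union> E2"
      "E1 \<inter> E2 = {}" "E2 \<noteq> {}" "h ` pball \<subseteq> E1" for E1 E2
  proof -
    have o: "openin \<X> E1" "openin \<X> E2" "E1 \<subseteq> rest" "E2 \<subseteq> rest"
      using E1(1,2) rest(1) openin_trans_full openin_subset top_rest by blast+
    have hb: "h ` ball 0 1 = insert (h 0) (h ` pball)" by (auto simp: pball_def)
    let ?F = "E1 \<union> h ` ball 0 1"
    have "openin \<X> ?F" using o(1) openh[OF pball(4)] by blast
    moreover have "?F \<inter> E2 = {}" using hb E1(4,6) o(4) by (auto simp: rest_def)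
    moreover have "topspace \<X> \<subseteq> ?F \<union> E2" using E1(3) hb by (auto simp: rest_def)
    moreover have "?F \<noteq> {}" by simp
    ultimately show False using con o(2) E1(5) unfolding connected_space_def by blast
  qed
  have "connectedin (subtopology \<X> rest) (h ` pball)"
    using path_connected_h[OF pball(3,6)] rest(2)
    by (simp add: connectedin_subtopology path_connectedin_imp_connectedin)
  then have "h ` pball \<subseteq> E1 \<or> h ` pball \<subseteq> E2"
    using connectedinD[OF _ E(1,2), of "h ` pball"] E(3,4) rest(2) top_rest by blast
  moreover have "rest \<subseteq> E1 \<union> E2" "rest \<subseteq> E2 \<union> E1" "E2 \<inter> E1 = {}" using E(3,4) top_rest by auto
  ultimately show False
    using no[OF E(1,2)] no[OF E(2,1)] E(4-6) by blast
qed

lemma path_connected_rest: "path_connected_space (subtopology \<X> rest)"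
proof -
  have "locally_path_connected_space (subtopology \<X> rest)"
    using lpc rest(1) locally_path_connected_space_open_subset by blast
  then show ?thesis
    using connected_rest path_connected_eq_connected_space by blast
qed

text \<open>A potential on the punctured space extends over the disc, because the punctured disc is path-connected.\<close>

lemma loop_avoiding_centre:
  fixes \<phi> :: "(real \<Rightarrow> 'a) \<Rightarrow> complex"
  assumes \<phi>: "path_cocycle \<X> (+) \<phi>" and no: "\<And>f. \<exists>p. pathin \<X> p \<and> \<phi> p \<noteq> f (p 1) - f (p 0)"
  obtains l where "pathin (subtopology \<X> rest) l" "l 0 = l 1" "\<phi> l \<noteq> 0"
proof (rule additive_loop_or_potential[OF path_cocycle_subtopology[OF \<phi>] path_connected_rest])
  fix f1 assume f1: "\<And>p. pathin (subtopology \<X> rest) p \<Longrightarrow> \<phi> p = f1 (p 1) - f1 (p 0)"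
  let ?B = "ball (0::'v) 1"
  have cB: "continuous_map (top_of_set ?B) \<X> h"
    using continuous_map_from_subtopology_mono[OF cont pball(4)] .
  \<comment> \<open>On the disc the potential is the value of \<open>\<phi>\<close> along the image
    of the radius to the point.\<close>
  define f2 where "f2 x = \<phi> (h \<circ> linepath 0 (inv_into W h x))" for x
  have f2: "\<phi> p = f2 (p 1) - f2 (p 0)" if p: "pathin \<X> p" "p ` {0..1} \<subseteq> h ` ?B" for p
  proof -
    define w where "w = inv_into W h \<circ> p"
    have hw: "h (w t) = p t \<and> w t \<in> ?B" if t: "t \<in> {0..1}" for t
    proof -
      obtain y where "y \<in> ?B" "p t = h y" using t p(2) by blast
      then show ?thesis using inj pball(4) by (simp add: w_def inv_into_f_f subset_iff)
    qed
    have "continuous_map (top_of_set {0..1}) (top_of_set W) w"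
    proof (rule continuous_map_openin_preimage_eq[THEN iffD2], intro conjI allI impI)
      show "w \<in> topspace (top_of_set {0..1}) \<rightarrow> topspace (top_of_set W)" using hw pball(4) by auto
      fix S assume "openin (top_of_set W) S"
      then have S: "S \<subseteq> W" "open S" using W(1) openin_open_eq by auto
      have "w t \<in> S \<longleftrightarrow> p t \<in> h ` S" if t: "t \<in> {0..1}" for t
      proof
        assume "p t \<in> h ` S"
        then obtain y where "y \<in> S" "h (w t) = h y" using hw[OF t] by auto
        then show "w t \<in> S" using inj_onD[OF inj, of "w t" y] hw[OF t] S(1) pball(4) by (metis subsetD)
      qed (use hw[OF t] in force)
      then have "topspace (top_of_set {0..1}) \<inter> w -` S = {t \<in> topspace (top_of_set {0..1}). p t \<in> h ` S}"
        by auto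
      then show "openin (top_of_set {0..1}) (topspace (top_of_set {0..1}) \<inter> w -` S)"
        using p(1) openh[OF S] unfolding pathin_def continuous_map_def by simp
    qed
    then have cw: "continuous_on {0..1} w" by simp
    have "path_homotopic \<X> (h \<circ> w) (h \<circ> linepath (w 0) (w 1))"
    proof (rule path_homotopic_convex[OF convex_ball cB])
      show "linepath (w 0) (w 1) ` {0..1} \<subseteq> ?B"
        unfolding linepath_image_01 by (rule closed_segment_subset) (use hw in auto)
    qed (use cw hw in \<open>auto simp: linepath_0' linepath_1' continuous_on_linepath\<close>)
    then have "\<phi> (h \<circ> w) = \<phi> (h \<circ> linepath (w 0) (w 1))"
      unfolding path_homotopic_def by (rule path_cocycle_homotopic[OF \<phi>])
    moreover have "\<phi> p = \<phi> (h \<circ> w)"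
      by (rule path_cocycle_cong[OF \<phi> p(1)]) (use hw in auto)
    moreover have "\<phi> (h \<circ> linepath 0 (w 0)) + \<phi> (h \<circ> linepath (w 0) (w 1)) = \<phi> (h \<circ> linepath 0 (w 1))"
      by (rule path_cocycle_convex[OF \<phi> convex_ball cB]) (use hw in auto)
    ultimately show ?thesis by (simp add: f2_def w_def algebra_simps)
  qed
  obtain w0 where w0: "w0 \<in> pball" using pball(7) by blast
  \<comment> \<open>Two potentials of the same cocycle differ by a constant on the path-connected
    punctured disc; shifting \<open>f2\<close> by it gives a function that extends \<open>f1\<close>
    over the centre.\<close>
  define c where "c = f1 (h w0) - f2 (h w0)"
  have eq: "f1 x = f2 x + c" if x: "x \<in> h ` pball" for x
  proof -
    have "path_connected_space (subtopology \<X> (h ` pball))"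
      using path_connected_h[OF pball(3,6)] by (simp add: path_connectedin_def)
    moreover have "topspace (subtopology \<X> (h ` pball)) = h ` pball"
      using h_top pball(3) by auto
    ultimately obtain p where p: "pathin (subtopology \<X> (h ` pball)) p" "p 0 = h w0" "p 1 = x"
      using x w0 unfolding path_connected_space_def by blast
    then have "pathin \<X> p" "p ` {0..1} \<subseteq> h ` pball" by (auto simp: pathin_subtopology)
    moreover from this have "p ` {0..1} \<subseteq> h ` ?B" "p ` {0..1} \<subseteq> rest"
      using image_mono[OF pball(2), of h] rest(2) by (metis order_trans)+
    ultimately have "pathin (subtopology \<X> rest) p" "pathin \<X> p" "p ` {0..1} \<subseteq> h ` ?B"
      by (auto simp: pathin_subtopology)
    from f1[OF this(1)] f2[OF this(2,3)] show ?thesis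
      using p by (simp add: c_def algebra_simps)
  qed
  define f where "f x = (if x = h 0 then f2 x + c else f1 x)" for x
  have "\<phi> p = f (p 1) - f (p 0)" if p: "pathin \<X> p" for p
  proof (rule path_cocycle_unique[OF \<phi> path_cocycle_delta rest(1) openh[OF pball(4)] _ _ p])
    show "topspace \<X> \<subseteq> rest \<union> h ` ?B" by (auto simp: rest_def)
    fix p assume p: "pathin \<X> p" "p ` {0..1} \<subseteq> rest \<or> p ` {0..1} \<subseteq> h ` ?B"
    then show "\<phi> p = f (p 1) - f (p 0)"
    proof (elim disjE)
      assume *: "p ` {0..1} \<subseteq> rest"
      then have "p 0 \<in> rest" "p 1 \<in> rest" by auto
      with * have "pathin (subtopology \<X> rest) p" "p 0 \<noteq> h 0" "p 1 \<noteq> h 0"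
        using p(1) by (auto simp: pathin_subtopology rest_def)
      then show ?thesis using f1 by (simp add: f_def)
    next
      assume B: "p ` {0..1} \<subseteq> h ` ?B"
      have "f x = f2 x + c" if "x \<in> h ` ?B" for x
        using that eq[of x] by (auto simp: f_def pball_def)
      moreover have "p 0 \<in> h ` ?B" "p 1 \<in> h ` ?B" using B by auto
      ultimately show ?thesis using f2[OF p(1) B] by simp
    qed
  qed simp
  then show ?thesis using no[of f] by blast
qed (use that in blast)

end

text \<open>Polar coordinates identify it with the product of an open interval and the unit sphere.
  The bound on the dimension makes the sphere simply connected.\<close>

lemma simply_connected_punctured_ball:
  assumes "DIM('v::euclidean_space) \<ge> 3"
  shows "simply_connected (ball (0::'v) 1 - {0})"
proof (rule simply_connected_retraction_gen)
  show "simply_connected ({0<..<1::real} \<times> sphere (0::'v) 1)"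
    using assms by (intro simply_connected_Times convex_imp_simply_connected simply_connected_sphere) auto
  show "(\<lambda>z. fst z *\<^sub>R snd z) ` ({0<..<1} \<times> sphere (0::'v) 1) = ball 0 1 - {0}"
  proof (intro equalityI subsetI)
    fix x :: 'v assume x: "x \<in> ball 0 1 - {0}"
    then have "x = norm x *\<^sub>R ((1 / norm x) *\<^sub>R x)" by simp
    then show "x \<in> (\<lambda>z. fst z *\<^sub>R snd z) ` ({0<..<1} \<times> sphere 0 1)"
      using x by (intro image_eqI[of _ _ "(norm x, (1 / norm x) *\<^sub>R x)"]) auto
  qed (auto simp: abs_mult)
  show "continuous_on (ball 0 1 - {0::'v}) (\<lambda>x. (norm x, (1 / norm x) *\<^sub>R x))"
    by (intro continuous_intros) auto
qed (auto intro!: continuous_intros)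

section \<open>Connected sums\<close>

text \<open>The identification of \<open>t u\<close> with \<open>(1 - t) u\<close> in the connected
  sum, as a self-map of the punctured ball: \<open>t\<close> is the norm of \<open>w\<close> and
  \<open>u\<close> its direction. It is an involution there.\<close>

definition flip_radius :: "'v::real_normed_vector \<Rightarrow> 'v" where
  "flip_radius w = ((1 - norm w) / norm w) *\<^sub>R w"

lemma norm_flip_radius: "w \<in> ball 0 1 - {0} \<Longrightarrow> norm (flip_radius w) = 1 - norm w"
  by (auto simp: flip_radius_def)

lemma flip_radius_in: "w \<in> ball 0 1 - {0} \<Longrightarrow> flip_radius w \<in> ball 0 1 - {0}"
proof -
  assume w: "w \<in> ball 0 1 - {0}"
  then have "norm (flip_radius w) < 1" "norm (flip_radius w) \<noteq> 0"
    unfolding norm_flip_radius[OF w] by auto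
  then show ?thesis by auto
qed

lemma flip_radius_flip_radius: "w \<in> ball 0 1 - {0} \<Longrightarrow> flip_radius (flip_radius w) = w"
  using norm_flip_radius[of w] by (auto simp: flip_radius_def)

lemma continuous_flip_radius: "continuous_on (ball 0 1 - {0}) flip_radius"
  unfolding flip_radius_def[abs_def] by (intro continuous_intros) auto

text \<open>The connected sum with the disjoint union eliminated: \<open>a\<close> and
  \<open>b\<close> are the two halves of the quotient map, and \<open>opens\<close> is the quotient
  topology. The loops come from classes of the whole summands but avoid the centres.\<close>

locale glued_discs =
  D1: embedded_disc \<X> h W + D2: embedded_disc \<Y> k W'
  for \<X> :: "'a topology" and h :: "'v::euclidean_space \<Rightarrow> 'a" and W
    and \<Y> :: "'b topology" and k :: "'v \<Rightarrow> 'b" and W' +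
  fixes M :: "'c topology" and a :: "'a \<Rightarrow> 'c" and b :: "'b \<Rightarrow> 'c"
  assumes top: "topspace M = a ` D1.rest \<union> b ` D2.rest"
    and opens: "\<And>O'. O' \<subseteq> topspace M \<Longrightarrow>
      openin M O' \<longleftrightarrow> openin \<X> {x \<in> D1.rest. a x \<in> O'} \<and> openin \<Y> {y \<in> D2.rest. b y \<in> O'}"
    and inja: "inj_on a D1.rest" and injb: "inj_on b D2.rest"
    and ab: "\<And>x y. \<lbrakk>x \<in> D1.rest; y \<in> D2.rest\<rbrakk> \<Longrightarrow>
      a x = b y \<longleftrightarrow> (\<exists>w\<in>ball 0 1 - {0}. x = h w \<and> y = k (flip_radius w))"
    and loop1: "\<exists>(\<phi> :: _ \<Rightarrow> complex) l. path_cocycle \<X> (+) \<phi> \<and> pathin (subtopology \<X> D1.rest) l \<and> l 0 = l 1 \<and> \<phi> l \<noteq> 0"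
    and loop2: "\<exists>(\<phi> :: _ \<Rightarrow> complex) l. path_cocycle \<Y> (+) \<phi> \<and> pathin (subtopology \<Y> D2.rest) l \<and> l 0 = l 1 \<and> \<phi> l \<noteq> 0"
begin

text \<open>The gluing relation is symmetric because \<open>flip_radius\<close> is an involution.
  What is proved for \<open>U\<close> then holds for the second piece.\<close>

lemma swapped: "glued_discs \<Y> k W' \<X> h W M b a"
proof (intro glued_discs.intro glued_discs_axioms.intro D1.embedded_disc_axioms D2.embedded_disc_axioms injb inja loop1 loop2)
  show "topspace M = b ` D2.rest \<union> a ` D1.rest" using top by blast
  show "openin M O' \<longleftrightarrow> openin \<Y> {y \<in> D2.rest. b y \<in> O'} \<and> openin \<X> {x \<in> D1.rest. a x \<in> O'}"
    if "O' \<subseteq> topspace M" for O' using opens[OF that] by blast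
  show "b y = a x \<longleftrightarrow> (\<exists>w\<in>ball 0 1 - {0}. y = k w \<and> x = h (flip_radius w))" if "y \<in> D2.rest" "x \<in> D1.rest" for x y
    using ab[OF that(2,1)] flip_radius_in flip_radius_flip_radius by metis
qed

text \<open>The image is open in the quotient if its preimages in both summands are open. The
  preimage in the second is the image under \<open>k\<close> of the set of ball points whose flip is
  sent into the given set by \<open>h\<close>, open since \<open>k\<close> is an open map.\<close>

lemma open_a:
  assumes "openin \<X> O'" "O' \<subseteq> D1.rest"
  shows "openin M (a ` O')"
proof -
  have sub: "a ` O' \<subseteq> topspace M" using assms top by blast
  have "{x \<in> D1.rest. a x \<in> a ` O'} = O'" using inj_on_image_mem_iff[OF inja _ assms(2)] assms(2) by blast
  moreover have "openin \<Y> {y \<in> D2.rest. b y \<in> a ` O'}"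
  proof -
    let ?P = "ball (0::'v) 1 - {0}"
    let ?S = "{w \<in> ?P. h (flip_radius w) \<in> O'}"
    have PW: "?P \<subseteq> W" "?P \<subseteq> W'" using D1.pball(3) D2.pball(3) by (auto simp: D1.pball_def D2.pball_def)
    have "continuous_map (top_of_set ?P) (top_of_set W) flip_radius"
      using continuous_flip_radius subsetD[OF PW(1) flip_radius_in] by (auto simp: Pi_iff)
    from continuous_map_compose[OF this D1.cont]
    have "openin (top_of_set ?P) {w \<in> ?P. (h \<circ> flip_radius) w \<in> O'}"
      using assms(1) by (simp add: continuous_map_def)
    then have "open ?S" using openin_open_trans[of ?P ?S] by (simp add: open_delete)
    then have "openin \<Y> (k ` ?S)" using PW by (intro D2.openh) auto
    moreover have "{y \<in> D2.rest. b y \<in> a ` O'} = k ` ?S"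
    proof (intro equalityI subsetI)
      fix y assume "y \<in> {y \<in> D2.rest. b y \<in> a ` O'}"
      then obtain x where x: "y \<in> D2.rest" "x \<in> O'" "a x = b y" by auto
      then obtain w where w: "w \<in> ?P" "x = h w" "y = k (flip_radius w)" using ab assms(2) by blast
      then show "y \<in> k ` ?S"
        using x flip_radius_in[OF w(1)] flip_radius_flip_radius[OF w(1)]
        by (intro image_eqI[of _ _ "flip_radius w"]) auto
    next
      fix y assume "y \<in> k ` ?S"
      then obtain w where w: "w \<in> ?P" "h (flip_radius w) \<in> O'" "y = k w" by blast
      have y: "y \<in> D2.rest" using D2.rest(2) w by (auto simp: D2.pball_def)
      have x: "h (flip_radius w) \<in> D1.rest" using w(2) assms(2) by blast
      have "a (h (flip_radius w)) = b y"
        unfolding ab[OF x y]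
        by (rule bexI[OF _ flip_radius_in[OF w(1)]]) (simp add: w(3) flip_radius_flip_radius[OF w(1)])
      with y show "y \<in> {y \<in> D2.rest. b y \<in> a ` O'}" using w(2) by (auto intro!: image_eqI[of _ _ "h (flip_radius w)"])
    qed
    ultimately show ?thesis by simp
  qed
  ultimately show ?thesis using opens[OF sub] assms(1) by simp
qed

definition U where "U = a ` D1.rest"

lemma openU: "openin M U"
  unfolding U_def by (rule open_a[OF D1.rest(1) order_refl])

lemma U_top: "U \<subseteq> topspace M"
  using top by (auto simp: U_def)

lemma homeo_a: "homeomorphic_map (subtopology \<X> D1.rest) (subtopology M U) a"
proof (rule bijective_open_imp_homeomorphic_map)
  show "continuous_map (subtopology \<X> D1.rest) (subtopology M U) a"
    unfolding continuous_map_in_subtopology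
  proof
    show "continuous_map (subtopology \<X> D1.rest) M a"
      unfolding continuous_map_def
    proof (intro conjI allI impI)
      show "a \<in> topspace (subtopology \<X> D1.rest) \<rightarrow> topspace M" using top D1.top_rest by auto
      fix O' assume O': "openin M O'"
      then have "openin \<X> {x \<in> D1.rest. a x \<in> O'}" using opens openin_subset by blast
      then show "openin (subtopology \<X> D1.rest) {x \<in> topspace (subtopology \<X> D1.rest). a x \<in> O'}"
        unfolding D1.top_rest using D1.rest(1) openin_open_subtopology by blast
    qed
  qed (auto simp: U_def D1.top_rest)
  show "open_map (subtopology \<X> D1.rest) (subtopology M U) a"
    unfolding open_map_def
  proof (intro allI impI)
    fix O' assume "openin (subtopology \<X> D1.rest) O'"
    then have "openin \<X> O'" "O' \<subseteq> D1.rest" using D1.rest(1) openin_open_subtopology by blast+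
    then have "openin M (a ` O')" "a ` O' \<subseteq> U" using open_a by (auto simp: U_def)
    then show "openin (subtopology M U) (a ` O')" using openin_open_subtopology openU by blast
  qed
  show "a ` topspace (subtopology \<X> D1.rest) = topspace (subtopology M U)"
    using U_top D1.top_rest by (auto simp: U_def)
  show "inj_on a (topspace (subtopology \<X> D1.rest))" using inja D1.top_rest by simp
qed

lemma path_connected_U: "path_connected_space (subtopology M U)"
  using homeomorphic_path_connected_space[OF homeomorphic_map_imp_homeomorphic_space[OF homeo_a]] D1.path_connected_rest by simp

lemma loop_U: "\<exists>(\<phi> :: _ \<Rightarrow> complex) l. path_cocycle (subtopology M U) (+) \<phi> \<and>
    pathin (subtopology M U) l \<and> l 0 = l 1 \<and> \<phi> l \<noteq> 0"
proof -
  obtain \<phi> :: "(real \<Rightarrow> 'a) \<Rightarrow> complex" and l where \<phi>: "path_cocycle \<X> (+) \<phi>"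
    and l: "pathin (subtopology \<X> D1.rest) l" "l 0 = l 1" "\<phi> l \<noteq> 0"
    using loop1 by blast
  obtain r where r: "homeomorphic_maps (subtopology \<X> D1.rest) (subtopology M U) a r"
    using homeo_a homeomorphic_map_maps by blast
  then have rc: "continuous_map (subtopology M U) (subtopology \<X> D1.rest) r"
    and ac: "continuous_map (subtopology \<X> D1.rest) (subtopology M U) a"
    and ra: "\<And>x. x \<in> D1.rest \<Longrightarrow> r (a x) = x"
    using D1.top_rest by (auto simp: homeomorphic_maps_def)
  have "path_cocycle (subtopology M U) (+) (\<lambda>p. \<phi> (r \<circ> p))"
    by (rule path_cocycle_pullback[OF path_cocycle_subtopology[OF \<phi>] rc])
  moreover have "pathin (subtopology M U) (a \<circ> l)" using l(1) ac pathin_compose by blast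
  moreover have "\<phi> (r \<circ> (a \<circ> l)) = \<phi> l"
    by (rule path_cocycle_cong[OF path_cocycle_subtopology[OF \<phi>, of D1.rest], symmetric])
      (use l(1) ra in \<open>auto simp: pathin_subtopology\<close>)
  ultimately show ?thesis
    using l(2,3) by (intro exI[of _ "\<lambda>p. \<phi> (r \<circ> p)"] exI[of _ "a \<circ> l"]) simp
qed

end

context glued_discs
begin

interpretation sw: glued_discs \<Y> k W' \<X> h W M b a by (rule swapped)

definition V where "V = b ` D2.rest"

lemma V_eq: "sw.U = V" by (simp add: sw.U_def V_def)

text \<open>Points of the two pieces are identified exactly along the gluing, so the intersection is
  a copy of the punctured disc.\<close>

lemma UV: "U \<inter> V = a ` h ` D1.pball"
proof (intro equalityI subsetI)
  fix z assume "z \<in> U \<inter> V"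
  then obtain x y where "x \<in> D1.rest" "y \<in> D2.rest" "z = a x" "a x = b y" by (auto simp: U_def V_def)
  moreover from this obtain w where "w \<in> ball 0 1 - {0}" "x = h w" using ab by blast
  ultimately show "z \<in> a ` h ` D1.pball" unfolding D1.pball_def by blast
next
  fix z assume "z \<in> a ` h ` D1.pball"
  then obtain w where w: "w \<in> D1.pball" "z = a (h w)" by blast
  have x: "h w \<in> D1.rest" using D1.rest(2) w(1) by blast
  have y: "k (flip_radius w) \<in> D2.rest"
    using D2.rest(2) flip_radius_in[of w] w(1) by (auto simp: D1.pball_def D2.pball_def)
  have "a (h w) = b (k (flip_radius w))"
    using ab[OF x y] w(1) by (auto simp: D1.pball_def)
  then show "z \<in> U \<inter> V" unfolding U_def V_def using w(2) x y by blast
qed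

lemma homeo_ah: "homeomorphic_map (top_of_set D1.pball) (subtopology M (U \<inter> V)) (a \<circ> h)"
proof (rule bijective_open_imp_homeomorphic_map)
  have top': "topspace (subtopology M (U \<inter> V)) = U \<inter> V" using U_top by auto
  have "continuous_map (top_of_set D1.pball) \<X> h"
    using continuous_map_from_subtopology_mono[OF D1.cont D1.pball(3)] .
  then have "continuous_map (top_of_set D1.pball) (subtopology \<X> D1.rest) h"
    using D1.rest(2) by (auto simp: continuous_map_in_subtopology)
  moreover have "continuous_map (subtopology \<X> D1.rest) M a"
    using homeomorphic_imp_continuous_map[OF homeo_a] by (simp add: continuous_map_in_subtopology)
  ultimately have "continuous_map (top_of_set D1.pball) M (a \<circ> h)" by (rule continuous_map_compose)
  then show "continuous_map (top_of_set D1.pball) (subtopology M (U \<inter> V)) (a \<circ> h)"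
    unfolding UV by (auto simp: continuous_map_in_subtopology)
  show "open_map (top_of_set D1.pball) (subtopology M (U \<inter> V)) (a \<circ> h)"
    unfolding open_map_def
  proof (intro allI impI)
    fix S assume "openin (top_of_set D1.pball) S"
    then have S: "open S" "S \<subseteq> D1.pball" using D1.pball(1) openin_open_eq by blast+
    have "openin \<X> (h ` S)" using S D1.pball(3) by (intro D1.openh) auto
    moreover have "h ` S \<subseteq> D1.rest" using S(2) D1.rest(2) by blast
    ultimately have "openin M (a ` h ` S)" by (rule open_a)
    moreover have "a ` h ` S \<subseteq> U \<inter> V" unfolding UV using S(2) by blast
    ultimately have "openin (subtopology M (U \<inter> V)) (a ` h ` S)"
      by (metis inf.absorb_iff2 openin_subtopology_Int2)
    then show "openin (subtopology M (U \<inter> V)) ((a \<circ> h) ` S)" by (simp add: image_comp)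
  qed
  have "(a \<circ> h) ` topspace (top_of_set D1.pball) = U \<inter> V"
    unfolding UV by (simp add: image_comp)
  then show "(a \<circ> h) ` topspace (top_of_set D1.pball) = topspace (subtopology M (U \<inter> V))"
    unfolding top' .
  have "inj_on h D1.pball" using D1.inj D1.pball(3) inj_on_subset by blast
  moreover have "inj_on a (h ` D1.pball)" using inja D1.rest(2) inj_on_subset by blast
  ultimately show "inj_on (a \<circ> h) (topspace (top_of_set D1.pball))" by (simp add: comp_inj_on)
qed

text \<open>Homotopies are transported through the homeomorphism with the punctured ball. A path
  sent there and back equals the original only on the unit interval, whence the extra homotopies at
  both ends.\<close>

lemma simply_connected_UV:
  assumes p: "pathin (subtopology M (U \<inter> V)) p" and q: "pathin (subtopology M (U \<inter> V)) q"
    and ends: "p 0 = q 0" "p 1 = q 1"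
  shows "homotopic_with (\<lambda>r. r 0 = p 0 \<and> r 1 = p 1) (top_of_set {0..1}) (subtopology M (U \<inter> V)) p q"
proof -
  let ?N = "subtopology M (U \<inter> V)" and ?f = "a \<circ> h"
  obtain r where r: "homeomorphic_maps (top_of_set D1.pball) ?N ?f r"
    using homeo_ah homeomorphic_map_maps by blast
  then have fc: "continuous_map (top_of_set D1.pball) ?N ?f" and rc: "continuous_map ?N (top_of_set D1.pball) r"
    and fr: "\<And>z. z \<in> topspace ?N \<Longrightarrow> ?f (r z) = z"
    by (auto simp: homeomorphic_maps_def)
  have path: "path (r \<circ> s)" "path_image (r \<circ> s) \<subseteq> D1.pball" "path_homotopic ?N (?f \<circ> (r \<circ> s)) s" if s: "pathin ?N s" for s
  proof -
    have c: "continuous_map (top_of_set {0..1}) (top_of_set D1.pball) (r \<circ> s)"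
      using s rc continuous_map_compose unfolding pathin_def by blast
    then show "path (r \<circ> s)" "path_image (r \<circ> s) \<subseteq> D1.pball"
      by (auto simp: path_def path_image_def)
    have "s t \<in> topspace ?N" if "0 \<le> t" "t \<le> 1" for t
      using s that by (auto simp: pathin_def continuous_map_def)
    then show "path_homotopic ?N (?f \<circ> (r \<circ> s)) s"
      using c fc continuous_map_compose[OF c fc] fr by (intro path_homotopic_eq) (auto simp: pathin_def)
  qed
  have "simply_connected D1.pball"
    unfolding D1.pball_def by (rule simply_connected_punctured_ball[OF D1.dim])
  then have "homotopic_paths D1.pball (r \<circ> p) (r \<circ> q)"
    using path[OF p] path[OF q] ends
    by (auto simp: simply_connected_eq_homotopic_paths pathstart_def pathfinish_def)
  then have "homotopic_with (\<lambda>s. s 0 = (?f \<circ> (r \<circ> p)) 0 \<and> s 1 = (?f \<circ> (r \<circ> p)) 1) (top_of_set {0..1}) ?N (?f \<circ> (r \<circ> p)) (?f \<circ> (r \<circ> q))"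
    unfolding homotopic_paths_def
    by (rule homotopic_with_compose_continuous_map_left[OF _ fc]) (auto simp: pathstart_def pathfinish_def)
  then have "path_homotopic ?N (?f \<circ> (r \<circ> p)) (?f \<circ> (r \<circ> q))" by (simp add: path_homotopic_def)
  then have "path_homotopic ?N p q"
    using path(3)[OF p] path(3)[OF q] path_homotopic_sym path_homotopic_trans by blast
  then show ?thesis by (simp add: path_homotopic_def)
qed

lemma two_piece_cover: "two_piece_cover M U V"
proof
  show "openin M U" by (rule openU)
  show "openin M V" using sw.openU by (simp add: V_eq)
  show "topspace M \<subseteq> U \<union> V" using top by (auto simp: U_def V_def)
  show "path_connected_space (subtopology M U)" by (rule path_connected_U)
  show "path_connected_space (subtopology M V)" using sw.path_connected_U by (simp add: V_eq)
  have "path_connectedin euclidean D1.pball" using D1.pball(6) by simp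
  then have "path_connected_space (top_of_set D1.pball)" by (simp only: path_connectedin_def)
  then show "path_connected_space (subtopology M (U \<inter> V))"
    using homeomorphic_path_connected_space[OF homeomorphic_map_imp_homeomorphic_space[OF homeo_ah]] by blast
  show "U \<inter> V \<noteq> {}" unfolding UV using D1.pball(7) by blast
qed (use simply_connected_UV loop_U sw.loop_U V_eq in simp_all)

lemma path_connected_M: "path_connected_space M"
proof -
  have "path_connectedin M U" "path_connectedin M V"
    using path_connected_U sw.path_connected_U U_top sw.U_top by (simp_all add: path_connectedin_def V_eq)
  moreover have "U \<inter> V \<noteq> {}" unfolding UV using D1.pball(7) by blast
  ultimately have "path_connectedin M (U \<union> V)" by (rule path_connectedin_Un)
  moreover have "U \<union> V = topspace M" using top by (auto simp: U_def V_def)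
  ultimately show ?thesis by (simp add: path_connectedin_topspace)
qed

end

section \<open>From smooth connected sums to glued discs\<close>

lemma embedded_disc_manifold:
  assumes "closed_smooth_manifold \<X> (A :: ('a, 'm::finite) chart set)" and "CARD('m) \<ge> 3" and "disc_embedding \<X> A h"
  obtains W where "embedded_disc \<X> h W"
proof -
  obtain W where W: "open W" "cball 0 1 \<subseteq> W" "inj_on h W" "continuous_map (top_of_set W) \<X> h"
    "\<And>S. \<lbrakk>S \<subseteq> W; open S\<rbrakk> \<Longrightarrow> openin \<X> (h ` S)"
    using disc_embeddingE[OF assms(3)] by metis
  have "embedded_disc \<X> h W"
    using assms(1,2) W locally_path_connected_manifold[of \<X> A]
    by unfold_locales (auto simp: closed_smooth_manifold_def)
  then show ?thesis by (rule that)
qed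

lemma connected_sum_glued_discs:
  fixes M1 :: "'a topology" and A1 :: "('a, 'm::finite) chart set"
    and M2 :: "'b topology" and A2 :: "('b, 'm) chart set" and M :: "'c topology"
  assumes card: "CARD('m) \<ge> 3"
    and man: "closed_smooth_manifold M1 A1" "closed_smooth_manifold M2 A2"
    and betti: "betti 1 M1 \<noteq> 0" "betti 1 M2 \<noteq> 0"
    and sum: "connected_sum M M1 A1 M2 A2"
  obtains h W k W' a b where "glued_discs M1 (h :: real^'m \<Rightarrow> 'a) W M2 k W' M a b"
proof -
  obtain h k where disc: "disc_embedding M1 A1 h" "disc_embedding M2 A2 k" and
    "let S = disjoint_union_topology (subtopology M1 (- {h 0})) (subtopology M2 (- {k 0}))
     in \<exists>q. quotient_map S M q \<and>
          (\<forall>x\<in>topspace S. \<forall>y\<in>topspace S.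
             q x = q y \<longleftrightarrow> (x, y) \<in> Id \<union> gluing h k \<union> (gluing h k)\<inverse>)"
    using sum unfolding connected_sum_def by blast
  then obtain S q where S: "S = disjoint_union_topology (subtopology M1 (- {h 0})) (subtopology M2 (- {k 0}))"
    and q: "quotient_map S M q"
    and glue: "\<And>x y. \<lbrakk>x \<in> topspace S; y \<in> topspace S\<rbrakk> \<Longrightarrow>
        q x = q y \<longleftrightarrow> (x, y) \<in> Id \<union> gluing h k \<union> (gluing h k)\<inverse>"
    unfolding Let_def by blast
  obtain W where W: "embedded_disc M1 h W" using embedded_disc_manifold[OF man(1) card disc(1)] by blast
  obtain W' where W': "embedded_disc M2 k W'" using embedded_disc_manifold[OF man(2) card disc(2)] by blast
  interpret D1: embedded_disc M1 h W by fact
  interpret D2: embedded_disc M2 k W' by fact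
  have rest: "topspace (subtopology M1 (- {h 0})) = D1.rest" "topspace (subtopology M2 (- {k 0})) = D2.rest"
    by (auto simp: D1.rest_def D2.rest_def)
  have restsub: "subtopology M1 (- {h 0}) = subtopology M1 D1.rest" "subtopology M2 (- {k 0}) = subtopology M2 D2.rest"
    by (metis D1.rest_def D2.rest_def Diff_eq subtopology_restrict)+
  have topS: "topspace S = Inl ` D1.rest \<union> Inr ` D2.rest"
  proof
    have "openin S (topspace S)" by simp
    then have sub: "Inl -` topspace S \<subseteq> D1.rest" "Inr -` topspace S \<subseteq> D2.rest"
      unfolding S openin_disjoint_union_topology using openin_subset rest by blast+
    show "topspace S \<subseteq> Inl ` D1.rest \<union> Inr ` D2.rest"
    proof (intro subsetI)
      fix z assume "z \<in> topspace S"
      with sub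
      show "z \<in> Inl ` D1.rest \<union> Inr ` D2.rest" by (cases z) auto
    qed
    have "Inl -` (Inl ` D1.rest \<union> Inr ` D2.rest) = D1.rest" "Inr -` (Inl ` D1.rest \<union> Inr ` D2.rest) = D2.rest"
      by auto
    moreover have "openin (subtopology M1 (- {h 0})) D1.rest" "openin (subtopology M2 (- {k 0})) D2.rest"
      using openin_topspace rest by metis+
    ultimately have "openin S (Inl ` D1.rest \<union> Inr ` D2.rest)"
      by (simp only: S openin_disjoint_union_topology)
    then show "Inl ` D1.rest \<union> Inr ` D2.rest \<subseteq> topspace S" by (rule openin_subset)
  qed
  \<comment> \<open>The pair \<open>t\<close>, \<open>u\<close> is encoded in the single vector
    \<open>w = t *\<^sub>R u\<close>, so that the norm of \<open>w\<close> recovers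
    \<open>t\<close>.\<close>
  have gluing: "(Inl x, Inr y) \<in> gluing h k \<longleftrightarrow> (\<exists>w\<in>ball 0 1 - {0}. x = h w \<and> y = k (flip_radius w))" for x y
  proof
    assume "(Inl x, Inr y) \<in> gluing h k"
    then obtain t u where t: "0 < t" "t < 1" "norm u = 1" "x = h (t *\<^sub>R u)" "y = k ((1 - t) *\<^sub>R u)"
      by (auto simp: gluing_def)
    then have "t *\<^sub>R u \<in> ball 0 1 - {0}" "flip_radius (t *\<^sub>R u) = (1 - t) *\<^sub>R u"
      by (auto simp: flip_radius_def)
    with t(4,5) show "\<exists>w\<in>ball 0 1 - {0}. x = h w \<and> y = k (flip_radius w)" by metis
  next
    assume "\<exists>w\<in>ball 0 1 - {0}. x = h w \<and> y = k (flip_radius w)"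
    then obtain w where w: "w \<in> ball 0 1 - {0}" "x = h w" "y = k (flip_radius w)" by blast
    have "w = norm w *\<^sub>R ((1 / norm w) *\<^sub>R w)" "flip_radius w = (1 - norm w) *\<^sub>R ((1 / norm w) *\<^sub>R w)"
      using w(1) by (auto simp: flip_radius_def)
    moreover have "0 < norm w" "norm w < 1" "norm ((1 / norm w) *\<^sub>R w) = 1" using w(1) by auto
    ultimately show "(Inl x, Inr y) \<in> gluing h k"
      unfolding gluing_def w(2,3) by (intro CollectI exI[of _ "norm w"] exI[of _ "(1 / norm w) *\<^sub>R w"]) simp
  qed
  have "glued_discs M1 h W M2 k W' M (q \<circ> Inl) (q \<circ> Inr)"
  proof (intro glued_discs.intro glued_discs_axioms.intro W W')
    show "topspace M = (q \<circ> Inl) ` D1.rest \<union> (q \<circ> Inr) ` D2.rest"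
      using q topS by (auto simp: quotient_map_def image_Un image_comp)
    show "openin M O' \<longleftrightarrow> openin M1 {x \<in> D1.rest. (q \<circ> Inl) x \<in> O'} \<and> openin M2 {y \<in> D2.rest. (q \<circ> Inr) y \<in> O'}"
      if O': "O' \<subseteq> topspace M" for O'
    proof -
      have "openin M O' \<longleftrightarrow> openin S {x \<in> topspace S. q x \<in> O'}" using q O' by (simp add: quotient_map_def)
      also have "\<dots> \<longleftrightarrow> openin (subtopology M1 D1.rest) {x \<in> D1.rest. (q \<circ> Inl) x \<in> O'} \<and>
          openin (subtopology M2 D2.rest) {y \<in> D2.rest. (q \<circ> Inr) y \<in> O'}"
      proof -
        have "Inl -` {x \<in> topspace S. q x \<in> O'} = {x \<in> D1.rest. (q \<circ> Inl) x \<in> O'}"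
          "Inr -` {x \<in> topspace S. q x \<in> O'} = {y \<in> D2.rest. (q \<circ> Inr) y \<in> O'}" using topS by auto
        then show ?thesis
          by (subst S) (simp only: openin_disjoint_union_topology restsub)
      qed
      finally show ?thesis
        using openin_open_subtopology[OF D1.rest(1)] openin_open_subtopology[OF D2.rest(1)] by auto
    qed
    \<comment> \<open>\<open>gluing\<close> relates only points of different summands, so no two
      points of one summand are identified.\<close>
    show "inj_on (q \<circ> Inl) D1.rest"
    proof (rule inj_onI)
      fix x y assume "x \<in> D1.rest" "y \<in> D1.rest" "(q \<circ> Inl) x = (q \<circ> Inl) y"
      then have "(Inl x, Inl y) \<in> Id \<union> gluing h k \<union> (gluing h k)\<inverse>"
        using glue[of "Inl x" "Inl y"] topS by auto
      then show "x = y" by (auto simp: gluing_def)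
    qed
    show "inj_on (q \<circ> Inr) D2.rest"
    proof (rule inj_onI)
      fix x y assume "x \<in> D2.rest" "y \<in> D2.rest" "(q \<circ> Inr) x = (q \<circ> Inr) y"
      then have "(Inr x, Inr y) \<in> Id \<union> gluing h k \<union> (gluing h k)\<inverse>"
        using glue[of "Inr x" "Inr y"] topS by auto
      then show "x = y" by (auto simp: gluing_def)
    qed
    show "(q \<circ> Inl) x = (q \<circ> Inr) y \<longleftrightarrow> (\<exists>w\<in>ball 0 1 - {0}. x = h w \<and> y = k (flip_radius w))"
      if "x \<in> D1.rest" "y \<in> D2.rest" for x y
    proof -
      have "q (Inl x) = q (Inr y) \<longleftrightarrow> (Inl x, Inr y) \<in> Id \<union> gluing h k \<union> (gluing h k)\<inverse>"
        using glue that topS by blast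
      also have "\<dots> \<longleftrightarrow> (Inl x, Inr y) \<in> gluing h k" by (auto simp: gluing_def)
      finally show ?thesis by (simp add: gluing)
    qed
    show "\<exists>(\<phi> :: _ \<Rightarrow> complex) l. path_cocycle M1 (+) \<phi> \<and> pathin (subtopology M1 D1.rest) l \<and> l 0 = l 1 \<and> \<phi> l \<noteq> 0"
      using betti_1_cocycle[OF betti(1)] D1.loop_avoiding_centre by metis
    show "\<exists>(\<phi> :: _ \<Rightarrow> complex) l. path_cocycle M2 (+) \<phi> \<and> pathin (subtopology M2 D2.rest) l \<and> l 0 = l 1 \<and> \<phi> l \<noteq> 0"
      using betti_1_cocycle[OF betti(2)] D2.loop_avoiding_centre by metis
  qed
  then show ?thesis by (rule that)
qed

theorem corollary8p3:
  fixes M1 :: "'a topology" and A1 :: "('a, 'm::finite) chart set"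
    and M2 :: "'b topology" and A2 :: "('b, 'm) chart set"
    and M :: "'c topology" and x0 :: 'c
  assumes "CARD('m) \<ge> 3"
    and "closed_smooth_manifold M1 A1" and "orientable M1 A1"
    and "closed_smooth_manifold M2 A2" and "orientable M2 A2"
    and "betti 1 M1 \<noteq> 0" and "betti 1 M2 \<noteq> 0"
    and "connected_sum M M1 A1 M2 A2"
    and "x0 \<in> topspace M"
  shows "characteristic_variety 1 1 M x0 = characters M x0 \<and>
         resonance_variety 1 1 M = carrier (cohomology 1 M)"
proof -
  obtain h :: "real^'m \<Rightarrow> 'a" and W k W' a b where "glued_discs M1 h W M2 k W' M a b"
    using connected_sum_glued_discs[OF assms(1,2,4,6,7,8)] by metis
  then interpret G: glued_discs M1 h W M2 k W' M a b .
  interpret C: two_piece_cover M G.U G.V by (rule G.two_piece_cover)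
  have "characteristic_variety 1 1 M x0 = characters M x0"
    by (rule characteristic_variety_eqI[OF G.path_connected_M assms(9)])
      (use C.affine_class in \<open>simp add: C.detects_class_def\<close>)
  moreover have "resonance_variety 1 1 M = carrier (cohomology 1 M)"
    by (rule resonance_variety_eqI[OF G.path_connected_M C.resonance_partner])
  ultimately show ?thesis by blast
qed

end
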